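(* The algebras $A(k)$ and $B(k)$ for $k\geq 2$ are Koszul.
   Context: Ground field $\mathbb C$. $C(k)$ is the quiver whose vertices are the vertices of the $k$-dimensional cube, each edge of the cube giving two arrows with opposite orientation. $B(k)$ is the quotient of the path algebra $\mathbb C[C(k)]$ by the relations identifying any two paths with the same beginning, the same end and the same length. Color the arrows of $C(k)$ by $k$ colors, two arrows having the same color iff the corresponding edges are parallel. $A(k)$ is the quotient of $\mathbb C[C(k)]$ by the relations identifying any two paths with the same beginning and end whose sequences of colors are permutations of each other. Both algebras are $\mathbb Z_{\ge0}$-graded by path length, with semisimple degree-zero part spanned by the vertex idempotents, and Koszulity is with respect to this grading. *)

theory Defs
  imports
    Complex_Main
    "HOL-Library.Multiset"
    "Graph_Theory.Arc_Walk"
    "HOL-Algebra.QuotRing"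
    "HOL-Algebra.Module"
begin

section \<open>Left modules over a ring that need not be commutative\<close>

text \<open>The library locale \<open>module\<close> requires a commutative ring. As there, the fields \<open>mult\<close> and
  \<open>one\<close> of the record type \<open>module\<close> are ignored.\<close>

locale left_module = R?: ring R + M?: abelian_group M
  for R :: "('a, 'c) ring_scheme" (structure) and M :: "('a, 'b, 'd) module_scheme" (structure) +
  assumes smult_closed [simp, intro]:
      "\<lbrakk>a \<in> carrier R; x \<in> carrier M\<rbrakk> \<Longrightarrow> a \<odot>\<^bsub>M\<^esub> x \<in> carrier M"
    and smult_l_distr:
      "\<lbrakk>a \<in> carrier R; b \<in> carrier R; x \<in> carrier M\<rbrakk> \<Longrightarrow>
        (a \<oplus>\<^bsub>R\<^esub> b) \<odot>\<^bsub>M\<^esub> x = a \<odot>\<^bsub>M\<^esub> x \<oplus>\<^bsub>M\<^esub> b \<odot>\<^bsub>M\<^esub> x"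
    and smult_r_distr:
      "\<lbrakk>a \<in> carrier R; x \<in> carrier M; y \<in> carrier M\<rbrakk> \<Longrightarrow>
        a \<odot>\<^bsub>M\<^esub> (x \<oplus>\<^bsub>M\<^esub> y) = a \<odot>\<^bsub>M\<^esub> x \<oplus>\<^bsub>M\<^esub> a \<odot>\<^bsub>M\<^esub> y"
    and smult_assoc1:
      "\<lbrakk>a \<in> carrier R; b \<in> carrier R; x \<in> carrier M\<rbrakk> \<Longrightarrow>
        (a \<otimes>\<^bsub>R\<^esub> b) \<odot>\<^bsub>M\<^esub> x = a \<odot>\<^bsub>M\<^esub> (b \<odot>\<^bsub>M\<^esub> x)"
    and smult_one [simp]:
      "x \<in> carrier M \<Longrightarrow> \<one>\<^bsub>R\<^esub> \<odot>\<^bsub>M\<^esub> x = x"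

definition left_module_hom ::
  "('a, 'c) ring_scheme \<Rightarrow> ('a, 'b) module \<Rightarrow> ('a, 'e) module \<Rightarrow> ('b \<Rightarrow> 'e) set" where
  "left_module_hom R M N = {f \<in> carrier M \<rightarrow> carrier N.
     (\<forall>x\<in>carrier M. \<forall>y\<in>carrier M. f (x \<oplus>\<^bsub>M\<^esub> y) = f x \<oplus>\<^bsub>N\<^esub> f y) \<and>
     (\<forall>a\<in>carrier R. \<forall>x\<in>carrier M. f (a \<odot>\<^bsub>M\<^esub> x) = a \<odot>\<^bsub>N\<^esub> f x)}"

text \<open>Lifting property along surjections. HOL does not allow quantifying over types, so \<open>M\<close> and \<open>N\<close>
  range over the modules whose elements are of the same type as those of \<open>P\<close>. This is genuine
  projectivity as soon as the type \<open>'b\<close> can hold a free module with a basis indexed by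
  \<open>carrier P\<close> (apply the property to a surjection from that free module onto \<open>P\<close>). It is only used
  below with \<open>'b = nat \<Rightarrow> 'a\<close>, which is large enough for every \<open>P\<close>: if \<open>'a\<close> has at least two elements,
  then \<open>nat \<Rightarrow> 'a\<close> is infinite and at least as large as \<open>'a\<close>; otherwise all modules are zero.\<close>

definition projective_module :: "('a, 'c) ring_scheme \<Rightarrow> ('a, 'b) module \<Rightarrow> bool" where
  "projective_module R P \<longleftrightarrow> left_module R P \<and>
     (\<forall>(M :: ('a, 'b) module) (N :: ('a, 'b) module) g f.
        left_module R M \<longrightarrow> left_module R N \<longrightarrow>
        g \<in> left_module_hom R M N \<longrightarrow> g ` carrier M = carrier N \<longrightarrow>
        f \<in> left_module_hom R P N \<longrightarrow>
        (\<exists>h \<in> left_module_hom R P M. \<forall>x\<in>carrier P. g (h x) = f x))"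

definition semisimple_module :: "('a, 'c) ring_scheme \<Rightarrow> ('a, 'b) module \<Rightarrow> bool" where
  "semisimple_module R M \<longleftrightarrow> left_module R M \<and>
     (\<forall>U. submodule U R M \<longrightarrow>
        (\<exists>V. submodule V R M \<and> U \<inter> V = {\<zero>\<^bsub>M\<^esub>} \<and> U <+>\<^bsub>M\<^esub> V = carrier M))"

definition regular_module :: "('a, 'c) ring_scheme \<Rightarrow> ('a, 'a) module" where
  "regular_module R = \<lparr>carrier = carrier R, mult = mult R, one = one R,
     zero = zero R, add = add R, smult = mult R\<rparr>"

definition semisimple_ring :: "('a, 'c) ring_scheme \<Rightarrow> bool" where
  "semisimple_ring R \<longleftrightarrow> ring R \<and> semisimple_module R (regular_module R)"


section \<open>Graded rings and modules\<close>

definition homogeneous_decomp ::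
  "('b, 'c) ring_scheme \<Rightarrow> ('i \<Rightarrow> 'b set) \<Rightarrow> 'b \<Rightarrow> ('i \<Rightarrow> 'b) \<Rightarrow> bool" where
  "homogeneous_decomp M D x c \<longleftrightarrow>
     (\<forall>n. c n \<in> D n) \<and> finite {n. c n \<noteq> \<zero>\<^bsub>M\<^esub>} \<and>
     x = (\<Oplus>\<^bsub>M\<^esub>n\<in>{n. c n \<noteq> \<zero>\<^bsub>M\<^esub>}. c n)"

definition internal_direct_sum :: "('b, 'c) ring_scheme \<Rightarrow> ('i \<Rightarrow> 'b set) \<Rightarrow> bool" where
  "internal_direct_sum M D \<longleftrightarrow>
     (\<forall>n. additive_subgroup (D n) M) \<and>
     (\<forall>x\<in>carrier M. \<exists>!c. homogeneous_decomp M D x c)"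

definition homogeneous_component ::
  "('b, 'c) ring_scheme \<Rightarrow> ('i \<Rightarrow> 'b set) \<Rightarrow> 'i \<Rightarrow> 'b \<Rightarrow> 'b" where
  "homogeneous_component M D n x = (THE c. homogeneous_decomp M D x c) n"

locale graded_ring = ring R for R :: "('a, 'c) ring_scheme" (structure) +
  fixes A :: "nat \<Rightarrow> 'a set"
  assumes direct_sum: "internal_direct_sum R A"
    and one_degree: "\<one> \<in> A 0"
    and mult_degree: "\<lbrakk>a \<in> A m; b \<in> A n\<rbrakk> \<Longrightarrow> a \<otimes> b \<in> A (m + n)"

locale graded_left_module = graded_ring R A + left_module R M
  for R :: "('a, 'c) ring_scheme" (structure) and A
    and M :: "('a, 'b) module" (structure) +
  fixes D :: "int \<Rightarrow> 'b set"
  assumes module_direct_sum: "internal_direct_sum M D"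
    and smult_degree: "\<lbrakk>a \<in> A m; x \<in> D n\<rbrakk> \<Longrightarrow> a \<odot>\<^bsub>M\<^esub> x \<in> D (int m + n)"

definition graded_hom ::
  "('a, 'c) ring_scheme \<Rightarrow> ('a, 'b) module \<Rightarrow> (int \<Rightarrow> 'b set) \<Rightarrow>
     ('a, 'e) module \<Rightarrow> (int \<Rightarrow> 'e set) \<Rightarrow> ('b \<Rightarrow> 'e) set" where
  "graded_hom R M D N E = {f \<in> left_module_hom R M N. \<forall>n. f ` D n \<subseteq> E n}"

definition generated_in_degree ::
  "('a, 'c) ring_scheme \<Rightarrow> ('a, 'b) module \<Rightarrow> (int \<Rightarrow> 'b set) \<Rightarrow> int \<Rightarrow> bool" where
  "generated_in_degree R M D n \<longleftrightarrow>
     (\<forall>U. submodule U R M \<longrightarrow> D n \<subseteq> U \<longrightarrow> U = carrier M)"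

text \<open>\<open>A 0\<close> as a left module over the whole ring: elements of positive degree act by zero.\<close>

definition degree_zero_module :: "('a, 'c) ring_scheme \<Rightarrow> (nat \<Rightarrow> 'a set) \<Rightarrow> ('a, 'a) module" where
  "degree_zero_module R A = \<lparr>carrier = A 0, mult = mult R, one = one R,
     zero = zero R, add = add R, smult = (\<lambda>a x. homogeneous_component R A 0 a \<otimes>\<^bsub>R\<^esub> x)\<rparr>"

definition degree_zero_grading :: "('a, 'c) ring_scheme \<Rightarrow> (nat \<Rightarrow> 'a set) \<Rightarrow> int \<Rightarrow> 'a set" where
  "degree_zero_grading R A n = (if n = 0 then A 0 else {\<zero>\<^bsub>R\<^esub>})"


section \<open>Koszul rings\<close>

text \<open>A positively graded ring is Koszul if its degree zero part is semisimple and has, as a graded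
  left module, a resolution by graded projective modules \<open>P i\<close> generated in degree \<open>i\<close>; graded
  projective means graded and projective as a module, which is equivalent to being a projective
  object of the category of graded modules.
  Taking the elements of all \<open>P i\<close> in the type \<open>nat \<Rightarrow> 'a\<close> is no restriction: in such a resolution
  \<open>P i\<close> is generated by its component of degree \<open>i\<close>, which for positive \<open>i\<close> is isomorphic to a
  subgroup of \<open>P (i - 1)\<close> and for \<open>i = 0\<close> is isomorphic to \<open>A 0\<close>. So each \<open>P i\<close> is countable or
  of cardinality at most that of the ring.\<close>

definition linear_projective_resolution ::
  "('a, 'c) ring_scheme \<Rightarrow> (nat \<Rightarrow> 'a set) \<Rightarrow>
     (nat \<Rightarrow> ('a, nat \<Rightarrow> 'a) module) \<Rightarrow> (nat \<Rightarrow> int \<Rightarrow> (nat \<Rightarrow> 'a) set) \<Rightarrow>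
     (nat \<Rightarrow> (nat \<Rightarrow> 'a) \<Rightarrow> (nat \<Rightarrow> 'a)) \<Rightarrow> ((nat \<Rightarrow> 'a) \<Rightarrow> 'a) \<Rightarrow> bool" where
  "linear_projective_resolution R A P D d \<epsilon> \<longleftrightarrow>
     (\<forall>i. graded_left_module R A (P i) (D i) \<and> projective_module R (P i) \<and>
          generated_in_degree R (P i) (D i) (int i)) \<and>
     (\<forall>i. d i \<in> graded_hom R (P (Suc i)) (D (Suc i)) (P i) (D i)) \<and>
     \<epsilon> \<in> graded_hom R (P 0) (D 0) (degree_zero_module R A) (degree_zero_grading R A) \<and>
     \<epsilon> ` carrier (P 0) = A 0 \<and>
     d 0 ` carrier (P 1) = {x \<in> carrier (P 0). \<epsilon> x = \<zero>\<^bsub>R\<^esub>} \<and>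
     (\<forall>i. d (Suc i) ` carrier (P (Suc (Suc i))) = {x \<in> carrier (P (Suc i)). d i x = \<zero>\<^bsub>P i\<^esub>})"

definition koszul :: "('a, 'c) ring_scheme \<Rightarrow> (nat \<Rightarrow> 'a set) \<Rightarrow> bool" where
  "koszul R A \<longleftrightarrow> graded_ring R A \<and> semisimple_ring (R\<lparr>carrier := A 0\<rparr>) \<and>
     (\<exists>P D d \<epsilon>. linear_projective_resolution R A P D d \<epsilon>)"


section \<open>Path algebras over the complex numbers\<close>

text \<open>Quivers are the digraphs of \<open>Graph_Theory\<close>. The triple \<open>(u, p, v)\<close> is the path from \<open>u\<close> to \<open>v\<close>
  along the list of arrows \<open>p\<close>; \<open>(u, [], u)\<close> is the trivial path at \<open>u\<close>.\<close>

type_synonym ('v, 'e) path = "'v \<times> 'e list \<times> 'v"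

definition paths :: "('v, 'e) pre_digraph \<Rightarrow> ('v, 'e) path set" where
  "paths G = {(u, p, v). pre_digraph.awalk G u p v}"

fun path_source :: "('v, 'e) path \<Rightarrow> 'v" where "path_source (u, p, v) = u"
fun path_arrows :: "('v, 'e) path \<Rightarrow> 'e list" where "path_arrows (u, p, v) = p"
fun path_target :: "('v, 'e) path \<Rightarrow> 'v" where "path_target (u, p, v) = v"

abbreviation path_length :: "('v, 'e) path \<Rightarrow> nat" where
  "path_length x \<equiv> length (path_arrows x)"

definition path_concat :: "('v, 'e) path \<Rightarrow> ('v, 'e) path \<Rightarrow> ('v, 'e) path" where
  "path_concat x y = (path_source x, path_arrows x @ path_arrows y, path_target y)"

definition path_supp :: "(('v, 'e) path \<Rightarrow> complex) \<Rightarrow> ('v, 'e) path set" where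
  "path_supp f = {x. f x \<noteq> 0}"

text \<open>Elements are the finite linear combinations of paths. The product \<open>x y\<close> of two paths is
  \<open>x\<close> followed by \<open>y\<close>, and zero if \<open>y\<close> does not begin where \<open>x\<close> ends.\<close>

definition path_algebra :: "('v, 'e) pre_digraph \<Rightarrow> (('v, 'e) path \<Rightarrow> complex) ring" where
  "path_algebra G = \<lparr>
     carrier = {f. finite (path_supp f) \<and> path_supp f \<subseteq> paths G},
     mult = (\<lambda>f g z. \<Sum>(x, y) \<in> {(x, y) \<in> path_supp f \<times> path_supp g.
                path_target x = path_source y \<and> path_concat x y = z}. f x * g y),
     one = (\<lambda>z. if z \<in> {(u, [], u) | u. u \<in> verts G} then 1 else 0),
     zero = (\<lambda>z. 0),
     add = (\<lambda>f g z. f z + g z)\<rparr>"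

definition path_basis :: "('v, 'e) path \<Rightarrow> ('v, 'e) path \<Rightarrow> complex" where
  "path_basis x = (\<lambda>z. if z = x then 1 else 0)"

definition path_ideal ::
  "('v, 'e) pre_digraph \<Rightarrow> (('v, 'e) path \<Rightarrow> ('v, 'e) path \<Rightarrow> bool) \<Rightarrow> (('v, 'e) path \<Rightarrow> complex) set" where
  "path_ideal G rel = Idl\<^bsub>path_algebra G\<^esub>
     {path_basis x \<ominus>\<^bsub>path_algebra G\<^esub> path_basis y | x y.
        x \<in> paths G \<and> y \<in> paths G \<and>
        path_source x = path_source y \<and> path_target x = path_target y \<and> rel x y}"

definition path_quotient ::
  "('v, 'e) pre_digraph \<Rightarrow> (('v, 'e) path \<Rightarrow> ('v, 'e) path \<Rightarrow> bool) \<Rightarrow> (('v, 'e) path \<Rightarrow> complex) set ring" where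
  "path_quotient G rel = path_algebra G Quot path_ideal G rel"

definition path_length_grading ::
  "('v, 'e) pre_digraph \<Rightarrow> (('v, 'e) path \<Rightarrow> ('v, 'e) path \<Rightarrow> bool) \<Rightarrow>
     nat \<Rightarrow> (('v, 'e) path \<Rightarrow> complex) set set" where
  "path_length_grading G rel n =
     (\<lambda>f. path_ideal G rel +>\<^bsub>path_algebra G\<^esub> f) `
       {f \<in> carrier (path_algebra G). \<forall>x \<in> path_supp f. path_length x = n}"


section \<open>The cube quiver and its two quotient algebras\<close>

text \<open>A vertex of the \<open>k\<close>-dimensional cube is given by the set of coordinates at which it is 1. The
  arrows are the ordered pairs of adjacent vertices.\<close>

definition cube_quiver :: "nat \<Rightarrow> (nat set, nat set \<times> nat set) pre_digraph" where
  "cube_quiver k = \<lparr>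
     verts = Pow {..<k},
     arcs = {(S, T). S \<subseteq> {..<k} \<and> T \<subseteq> {..<k} \<and> card (sym_diff S T) = 1},
     tail = fst,
     head = snd\<rparr>"

text \<open>The color of an arrow is the direction of the edge: the coordinate in which its ends differ.\<close>

fun arrow_color :: "nat set \<times> nat set \<Rightarrow> nat" where
  "arrow_color (S, T) = the_elem (sym_diff S T)"

type_synonym cube_path = "(nat set, nat set \<times> nat set) path"

definition same_colors :: "cube_path \<Rightarrow> cube_path \<Rightarrow> bool" where
  "same_colors x y \<longleftrightarrow>
     mset (map arrow_color (path_arrows x)) = mset (map arrow_color (path_arrows y))"

definition same_length :: "cube_path \<Rightarrow> cube_path \<Rightarrow> bool" where
  "same_length x y \<longleftrightarrow> path_length x = path_length y"

definition algebra_A :: "nat \<Rightarrow> (cube_path \<Rightarrow> complex) set ring" where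
  "algebra_A k = path_quotient (cube_quiver k) same_colors"

definition grading_A :: "nat \<Rightarrow> nat \<Rightarrow> (cube_path \<Rightarrow> complex) set set" where
  "grading_A k = path_length_grading (cube_quiver k) same_colors"

definition algebra_B :: "nat \<Rightarrow> (cube_path \<Rightarrow> complex) set ring" where
  "algebra_B k = path_quotient (cube_quiver k) same_length"

definition grading_B :: "nat \<Rightarrow> nat \<Rightarrow> (cube_path \<Rightarrow> complex) set set" where
  "grading_B k = path_length_grading (cube_quiver k) same_length"

end

theory Submission
  imports Defs "HOL-Algebra.Subrings"
begin

text \<open>Let \<open>x\<^sub>j\<close> be the sum of all arrows of color \<open>j\<close> and let \<open>I\<^sub>j\<close> be the left ideal generated by
  \<open>x\<^sub>i\<close> for \<open>i < j\<close>, so that \<open>I\<^sub>k\<close> is the ideal of elements of positive degree. Both algebras have a basis of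
  path classes on which right multiplication by \<open>x\<^sub>j\<close> acts injectively, and one reads off that the colon ideal
  of all \<open>r\<close> with \<open>r x\<^sub>j \<in> I\<^sub>j\<close> is again a member of the flag: it is \<open>I\<^sub>j\<close> for \<open>A(k)\<close>, while for
  \<open>B(k)\<close> it is \<open>I\<^sub>0\<close> if \<open>j = 0\<close> and \<open>I\<close> with index \<open>j + 1\<close> otherwise.

  Call a tuple of vectors of degree one in a free module a linear flag if, for every member, the ideal multiplying it
  into the span of its predecessors is some \<open>I\<^sub>t\<close>. The generators of \<open>I\<^sub>k\<close> form a linear flag, and the syzygies
  of a linear flag are generated by a linear flag: each \<open>x\<^sub>i\<close> with \<open>i < t\<close> gives one relation, and the colon
  ideals of these relations are those of the \<open>x\<^sub>i\<close>. Iterating gives a linear free resolution of the degree zero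
  part, which is semisimple because its multiplication is pointwise in the coordinates at the vertices.\<close>

section \<open>Free modules\<close>

text \<open>The flag is a one-sided analogue of a Koszul filtration: a chain of ideals whose
  successive colon ideals stay in the chain, so that only k + 1 ideals govern the syzygies at every
  stage. Summing all arrows of one color, instead of using the projectives at single vertices, makes
  each term of the resolution a free module. Colors are appended at the end of a path, hence left
  ideals and right multiplication. For A(k) the colon condition says that
  \<open>x_0, ..., x_(k-1)\<close> behave like the variables of a polynomial ring, a regular
  sequence. For B(k) this fails at every j > 0, because a path class longer than a geodesic can end
  in any direction; its resolution need not stop, which is why the syzygies are produced by an
  unending recursion and not by an explicit complex. Two facts keep the recursion going. A relation
  between vectors of degree one can be cut down to coefficients of degree one. The last nonzero
  coordinate of a new relation is some \<open>x_i\<close>, so its colon ideal is read off from that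
  coordinate alone.\<close>

definition lin_comb :: "('a, 'b, 'd) module_scheme \<Rightarrow> (nat \<Rightarrow> 'b) \<Rightarrow> nat \<Rightarrow> (nat \<Rightarrow> 'a) \<Rightarrow> 'b" where
  "lin_comb M g n c = rec_nat \<zero>\<^bsub>M\<^esub> (\<lambda>j s. s \<oplus>\<^bsub>M\<^esub> c j \<odot>\<^bsub>M\<^esub> g j) n"

lemma lin_comb_0 [simp]: "lin_comb M g 0 c = \<zero>\<^bsub>M\<^esub>"
  and lin_comb_Suc [simp]: "lin_comb M g (Suc n) c = lin_comb M g n c \<oplus>\<^bsub>M\<^esub> c n \<odot>\<^bsub>M\<^esub> g n"
  by (simp_all add: lin_comb_def)

lemma lin_comb_cong:
  "(\<And>j. j < n \<Longrightarrow> c j = c' j) \<Longrightarrow> (\<And>j. j < n \<Longrightarrow> g j = g' j) \<Longrightarrow> lin_comb M g n c = lin_comb M g' n c'"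
  by (induction n) auto

definition lspan :: "('a, 'c) ring_scheme \<Rightarrow> ('a, 'b, 'd) module_scheme \<Rightarrow> (nat \<Rightarrow> 'b) \<Rightarrow> nat \<Rightarrow> 'b set" where
  "lspan R M g n = {lin_comb M g n c | c. \<forall>j. c j \<in> carrier R}"

text \<open>Vectors are functions on all naturals that vanish from n on, so that free modules of
  every rank live in the one type \<open>nat \<Rightarrow> 'a\<close> required of a resolution. The
  fields \<open>mult\<close> and \<open>one\<close> are dummies.\<close>

definition free_module :: "('a, 'c) ring_scheme \<Rightarrow> nat \<Rightarrow> ('a, nat \<Rightarrow> 'a) module" where
  "free_module R n = \<lparr>carrier = {f. (\<forall>j. f j \<in> carrier R) \<and> (\<forall>j\<ge>n. f j = \<zero>\<^bsub>R\<^esub>)},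
     mult = (\<lambda>f g. f), one = (\<lambda>j. \<zero>\<^bsub>R\<^esub>), zero = (\<lambda>j. \<zero>\<^bsub>R\<^esub>),
     add = (\<lambda>f g j. f j \<oplus>\<^bsub>R\<^esub> g j), smult = (\<lambda>a f j. a \<otimes>\<^bsub>R\<^esub> f j)\<rparr>"

lemma free_module_simps [simp]:
  "carrier (free_module R n) = {f. (\<forall>j. f j \<in> carrier R) \<and> (\<forall>j\<ge>n. f j = \<zero>\<^bsub>R\<^esub>)}"
  "\<zero>\<^bsub>free_module R n\<^esub> = (\<lambda>j. \<zero>\<^bsub>R\<^esub>)"
  "f \<oplus>\<^bsub>free_module R n\<^esub> g = (\<lambda>j. f j \<oplus>\<^bsub>R\<^esub> g j)"
  "a \<odot>\<^bsub>free_module R n\<^esub> f = (\<lambda>j. a \<otimes>\<^bsub>R\<^esub> f j)"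
  by (simp_all add: free_module_def)

context left_module
begin

lemma smult_r_zero [simp]:
  assumes "a \<in> carrier R"
  shows "a \<odot>\<^bsub>M\<^esub> \<zero>\<^bsub>M\<^esub> = \<zero>\<^bsub>M\<^esub>"
proof -
  have "a \<odot>\<^bsub>M\<^esub> \<zero>\<^bsub>M\<^esub> \<oplus>\<^bsub>M\<^esub> a \<odot>\<^bsub>M\<^esub> \<zero>\<^bsub>M\<^esub> = a \<odot>\<^bsub>M\<^esub> \<zero>\<^bsub>M\<^esub>"
    using smult_r_distr[OF assms, of "\<zero>\<^bsub>M\<^esub>" "\<zero>\<^bsub>M\<^esub>"] by simp
  then show ?thesis
    using assms M.add.l_cancel_one M.zero_closed smult_closed by blast
qed

lemma smult_l_zero [simp]:
  assumes "x \<in> carrier M"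
  shows "\<zero> \<odot>\<^bsub>M\<^esub> x = \<zero>\<^bsub>M\<^esub>"
proof -
  have "\<zero> \<odot>\<^bsub>M\<^esub> x \<oplus>\<^bsub>M\<^esub> \<zero> \<odot>\<^bsub>M\<^esub> x = \<zero> \<odot>\<^bsub>M\<^esub> x"
    using smult_l_distr[of \<zero> \<zero> x] assms by simp
  then show ?thesis
    using assms M.add.l_cancel_one R.zero_closed smult_closed by blast
qed

lemma lin_comb_closed:
  assumes "\<And>j. j < n \<Longrightarrow> g j \<in> carrier M" "\<And>j. c j \<in> carrier R"
  shows "lin_comb M g n c \<in> carrier M"
  using assms(1) by (induction n) (auto simp: assms(2))

lemma lin_comb_add:
  assumes "\<And>j. j < n \<Longrightarrow> g j \<in> carrier M" "\<And>j. c j \<in> carrier R" "\<And>j. c' j \<in> carrier R"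
  shows "lin_comb M g n (\<lambda>j. c j \<oplus> c' j) = lin_comb M g n c \<oplus>\<^bsub>M\<^esub> lin_comb M g n c'"
  using assms(1)
proof (induction n)
  case (Suc n)
  then show ?case
    using assms lin_comb_closed[of n g c] lin_comb_closed[of n g c']
    by (simp add: smult_l_distr M.a_ac)
qed auto

lemma lin_comb_smult:
  assumes "\<And>j. j < n \<Longrightarrow> g j \<in> carrier M" "\<And>j. c j \<in> carrier R" "a \<in> carrier R"
  shows "lin_comb M g n (\<lambda>j. a \<otimes> c j) = a \<odot>\<^bsub>M\<^esub> lin_comb M g n c"
  using assms(1)
proof (induction n)
  case (Suc n)
  then show ?case
    using assms lin_comb_closed[of n g c] by (simp add: smult_r_distr smult_assoc1)
qed (use assms in auto)

lemma lin_comb_zero [simp]: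
  "(\<And>j. j < n \<Longrightarrow> g j \<in> carrier M) \<Longrightarrow> lin_comb M g n (\<lambda>j. \<zero>) = \<zero>\<^bsub>M\<^esub>"
  by (induction n) auto

lemma lin_comb_truncate:
  assumes "\<And>j. j < n \<Longrightarrow> g j \<in> carrier M" "\<And>j. c j \<in> carrier R" "m \<le> n"
    "\<And>j. m \<le> j \<Longrightarrow> j < n \<Longrightarrow> c j = \<zero>"
  shows "lin_comb M g n c = lin_comb M g m c"
  using assms(3,1,4)
proof (induction n rule: dec_induct)
  case (step n)
  then show ?case using assms(2) lin_comb_closed[of n g c] lin_comb_closed[of m g c] by simp
qed auto

lemma lspan_0 [simp]: "lspan R M g 0 = {\<zero>\<^bsub>M\<^esub>}"
proof -
  have "\<exists>c. \<forall>j::nat. c j \<in> carrier R"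
    by (intro exI[of _ "\<lambda>_. \<zero>"]) simp
  then show ?thesis
    by (simp add: lspan_def)
qed

text \<open>The same recursion as the one postulated for the ideals in \<open>koszul_flag\<close>,
  so spans and ideals can be compared by induction.\<close>

lemma lspan_Suc:
  "lspan R M g (Suc n) = {a \<oplus>\<^bsub>M\<^esub> r \<odot>\<^bsub>M\<^esub> g n | a r. a \<in> lspan R M g n \<and> r \<in> carrier R}"
proof (intro equalityI subsetI)
  fix y assume "y \<in> {a \<oplus>\<^bsub>M\<^esub> r \<odot>\<^bsub>M\<^esub> g n | a r. a \<in> lspan R M g n \<and> r \<in> carrier R}"
  then obtain r c where "r \<in> carrier R" "\<forall>j. c j \<in> carrier R"
    "y = lin_comb M g n c \<oplus>\<^bsub>M\<^esub> r \<odot>\<^bsub>M\<^esub> g n"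
    by (auto simp: lspan_def)
  then show "y \<in> lspan R M g (Suc n)"
    unfolding lspan_def
    by (intro CollectI exI[of _ "c(n := r)"]) (auto intro!: lin_comb_cong arg_cong2[where f = "add M"])
next
  fix y assume "y \<in> lspan R M g (Suc n)"
  then obtain c where c: "\<forall>j. c j \<in> carrier R" "y = lin_comb M g n c \<oplus>\<^bsub>M\<^esub> c n \<odot>\<^bsub>M\<^esub> g n"
    by (auto simp: lspan_def)
  moreover from c(1) have "lin_comb M g n c \<in> lspan R M g n" "c n \<in> carrier R"
    by (auto simp: lspan_def)
  ultimately show "y \<in> {a \<oplus>\<^bsub>M\<^esub> r \<odot>\<^bsub>M\<^esub> g n | a r. a \<in> lspan R M g n \<and> r \<in> carrier R}"
    by blast
qed

text \<open>Turns a span into the image of the differential given by its generators; exactness is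
  formulated with images.\<close>

lemma lspan_eq_image_free:
  "lspan R M g n = lin_comb M g n ` carrier (free_module R n)"
proof (intro equalityI subsetI)
  fix y assume "y \<in> lspan R M g n"
  then obtain c where c: "\<forall>j. c j \<in> carrier R" "y = lin_comb M g n c"
    by (auto simp: lspan_def)
  then have "y = lin_comb M g n (\<lambda>j. if j < n then c j else \<zero>)"
    by (auto intro: lin_comb_cong)
  then show "y \<in> lin_comb M g n ` carrier (free_module R n)"
    using c(1) by (auto intro!: image_eqI[of _ _ "\<lambda>j. if j < n then c j else \<zero>"])
qed (auto simp: lspan_def)

end

lemma lin_comb_hom:
  assumes "left_module R M" "\<And>j. j < n \<Longrightarrow> g j \<in> carrier M"
  shows "lin_comb M g n \<in> left_module_hom R (free_module R n) M"
proof -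
  interpret left_module R M by fact
  show ?thesis
    using assms(2) by (auto simp: left_module_hom_def lin_comb_closed lin_comb_add lin_comb_smult)
qed

lemma lspan_cong: "(\<And>j. j < n \<Longrightarrow> g j = g' j) \<Longrightarrow> lspan R M g n = lspan R M g' n"
  using lin_comb_cong[of n _ _ g g' M] by (simp add: lspan_def)

lemma hom_lin_comb:
  assumes "left_module R M" "left_module R N" "f \<in> left_module_hom R M N"
    "\<And>j. j < n \<Longrightarrow> g j \<in> carrier M" "\<And>j. c j \<in> carrier R"
  shows "f (lin_comb M g n c) = lin_comb N (\<lambda>j. f (g j)) n c"
proof -
  interpret M: left_module R M by fact
  interpret N: left_module R N by fact
  have f: "\<And>x. x \<in> carrier M \<Longrightarrow> f x \<in> carrier N"
    "\<And>x y. x \<in> carrier M \<Longrightarrow> y \<in> carrier M \<Longrightarrow> f (x \<oplus>\<^bsub>M\<^esub> y) = f x \<oplus>\<^bsub>N\<^esub> f y"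
    "\<And>a x. a \<in> carrier R \<Longrightarrow> x \<in> carrier M \<Longrightarrow> f (a \<odot>\<^bsub>M\<^esub> x) = a \<odot>\<^bsub>N\<^esub> f x"
    using assms(3) by (auto simp: left_module_hom_def)
  \<comment> \<open>Preservation of zero is not part of being a homomorphism here; it follows by
    writing zero as \<open>\<zero>\<close> times zero.\<close>
  have f0: "f \<zero>\<^bsub>M\<^esub> = \<zero>\<^bsub>N\<^esub>"
    using f(3)[OF M.R.zero_closed M.M.zero_closed] M.smult_r_zero[OF M.R.zero_closed]
      N.smult_l_zero[OF f(1)[OF M.M.zero_closed]] by metis
  show ?thesis
    using assms(4)
  proof (induction n)
    case (Suc n)
    have "lin_comb M g n c \<in> carrier M"
      by (rule M.lin_comb_closed) (use Suc.prems assms(5) in auto)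
    moreover have "c n \<odot>\<^bsub>M\<^esub> g n \<in> carrier M"
      using Suc.prems assms(5) by blast
    ultimately show ?case
      using Suc f(3)[OF assms(5) Suc.prems, of n n] by (simp only: lin_comb_Suc f(2))
  qed (simp add: f0)
qed

context ring
begin

lemma free_module_left_module: "left_module R (free_module R n)"
proof -
  have "abelian_group (free_module R n)"
  proof (rule abelian_groupI)
    fix f assume "f \<in> carrier (free_module R n)"
    then show "\<exists>g\<in>carrier (free_module R n). g \<oplus>\<^bsub>free_module R n\<^esub> f = \<zero>\<^bsub>free_module R n\<^esub>"
      by (intro bexI[of _ "\<lambda>j. \<ominus> f j"]) (auto simp: l_neg)
  next
    fix f g assume "f \<in> carrier (free_module R n)" "g \<in> carrier (free_module R n)"
    then show "f \<oplus>\<^bsub>free_module R n\<^esub> g = g \<oplus>\<^bsub>free_module R n\<^esub> f"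
      by (simp add: fun_eq_iff a_comm)
  qed (simp_all add: fun_eq_iff a_assoc)
  then show ?thesis
    by (intro left_module.intro left_module_axioms.intro ring_axioms)
      (simp_all add: fun_eq_iff l_distr r_distr m_assoc)
qed

definition unit_vec :: "nat \<Rightarrow> nat \<Rightarrow> 'a" where
  "unit_vec l = (\<lambda>j. if j = l then \<one> else \<zero>)"

lemma unit_vec_closed: "l < n \<Longrightarrow> unit_vec l \<in> carrier (free_module R n)"
  by (auto simp: unit_vec_def)

lemma lin_comb_unit_vec:
  assumes "\<And>j. c j \<in> carrier R"
  shows "lin_comb (free_module R m) unit_vec n c = (\<lambda>j. if j < n then c j else \<zero>)"
proof (induction n)
  case (Suc n)
  then show ?case
    using assms by (auto simp: unit_vec_def less_Suc_eq)
qed simp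

lemma free_module_expand:
  "c \<in> carrier (free_module R n) \<Longrightarrow> lin_comb (free_module R n) unit_vec n c = c"
  by (subst lin_comb_unit_vec) (auto simp: fun_eq_iff not_less)

text \<open>Choose preimages of the images of the unit vectors; the linear combinations of these
  preimages define the lift.\<close>

lemma free_module_projective: "projective_module R (free_module R n)"
  unfolding projective_module_def
proof (intro conjI allI impI free_module_left_module)
  fix M N :: "('a, nat \<Rightarrow> 'a) module" and g f
  assume M: "left_module R M" and N: "left_module R N"
    and g: "g \<in> left_module_hom R M N" "g ` carrier M = carrier N"
    and f: "f \<in> left_module_hom R (free_module R n) N"
  interpret M: left_module R M by fact
  have "\<exists>m \<in> carrier M. g m = f (unit_vec j)" if "j < n" for j
  proof -
    have "f (unit_vec j) \<in> carrier N"
      using f unit_vec_closed[OF that] unfolding left_module_hom_def by blast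
    then show ?thesis
      unfolding g(2)[symmetric] by force
  qed
  then obtain m where m: "m j \<in> carrier M" "g (m j) = f (unit_vec j)" if "j < n" for j
    by metis
  have "g (lin_comb M m n c) = f c" if c: "c \<in> carrier (free_module R n)" for c
  proof -
    have c': "\<And>j. c j \<in> carrier R" using c by auto
    have "g (lin_comb M m n c) = lin_comb N (\<lambda>j. g (m j)) n c"
      by (rule hom_lin_comb[OF M N g(1)]) (use m c' in auto)
    also have "\<dots> = lin_comb N (\<lambda>j. f (unit_vec j)) n c"
      by (rule lin_comb_cong) (use m in auto)
    also have "\<dots> = f (lin_comb (free_module R n) unit_vec n c)"
      by (rule hom_lin_comb[OF free_module_left_module N f, symmetric]) (use unit_vec_closed c' in auto)
    finally show ?thesis using free_module_expand[OF c] by simp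
  qed
  then show "\<exists>h\<in>left_module_hom R (free_module R n) M. \<forall>x\<in>carrier (free_module R n). g (h x) = f x"
    using lin_comb_hom[OF M, of n m] m by blast
qed

end

section \<open>Gradings given by projections\<close>

context abelian_group
begin

lemma additive_finsum:
  assumes "finite S" "\<And>i. i \<in> S \<Longrightarrow> c i \<in> carrier G"
    and "\<And>x. x \<in> carrier G \<Longrightarrow> p x \<in> carrier G" "p \<zero> = \<zero>"
    and "\<And>x y. x \<in> carrier G \<Longrightarrow> y \<in> carrier G \<Longrightarrow> p (x \<oplus> y) = p x \<oplus> p y"
  shows "p (\<Oplus>i\<in>S. c i) = (\<Oplus>i\<in>S. p (c i))"
  using assms(1,2)
proof (induction S rule: finite_induct)
  case (insert i S)
  have "p (\<Oplus>j\<in>insert i S. c j) = p (c i \<oplus> (\<Oplus>j\<in>S. c j))"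
    using insert by (subst finsum_insert) auto
  also have "\<dots> = p (c i) \<oplus> p (\<Oplus>j\<in>S. c j)"
    by (intro assms(5) finsum_closed) (use insert in auto)
  also have "\<dots> = (\<Oplus>j\<in>insert i S. p (c j))"
    using insert assms(3) by (subst finsum_insert) auto
  finally show ?case .
qed (simp add: assms(4))

lemma finsum_mono_neutral:
  assumes "finite S" "T \<subseteq> S" "\<And>i. i \<in> S - T \<Longrightarrow> c i = \<zero>" "\<And>i. i \<in> S \<Longrightarrow> c i \<in> carrier G"
  shows "(\<Oplus>i\<in>T. c i) = (\<Oplus>i\<in>S. c i)"
proof -
  have "(\<Oplus>i\<in>S. c i) = (\<Oplus>i\<in>T \<union> (S - T). c i)"
    using assms(2) by (simp add: Un_absorb1)
  also have "\<dots> = (\<Oplus>i\<in>T. c i) \<oplus> (\<Oplus>i\<in>S - T. c i)"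
    by (rule finsum_Un_disjoint) (use assms finite_subset in auto)
  also have "(\<Oplus>i\<in>S - T. c i) = (\<Oplus>i\<in>S - T. \<zero>)"
    by (rule finsum_cong') (use assms in auto)
  finally show ?thesis
    using assms by (auto simp: subset_iff)
qed

lemma finsum_single:
  assumes "finite S" "\<And>i. i \<in> S \<Longrightarrow> i \<noteq> m \<Longrightarrow> c i = \<zero>" "c m \<in> carrier G" "m \<notin> S \<Longrightarrow> c m = \<zero>"
  shows "(\<Oplus>i\<in>S. c i) = c m"
proof (cases "m \<in> S")
  case True
  then have "(\<Oplus>i\<in>S. c i) = (\<Oplus>i\<in>{m}. c i)"
    by (intro finsum_mono_neutral[symmetric]) (use assms in \<open>auto, metis zero_closed\<close>)
  then show ?thesis using assms by simp
next
  case False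
  then have "(\<Oplus>i\<in>S. c i) = (\<Oplus>i\<in>S. \<zero>)"
    by (intro finsum_cong') (use assms in auto)
  then show ?thesis using False assms by simp
qed

end

text \<open>Presenting a grading by its projections makes uniqueness of decompositions automatic
  (apply \<open>p n\<close> to a decomposition) and gives a usable value to
  \<open>homogeneous_component\<close>, which is a definite description.\<close>

locale graded_projections = abelian_group M for M :: "('a, 'b) ring_scheme" (structure) +
  fixes D :: "'i \<Rightarrow> 'a set" and p :: "'i \<Rightarrow> 'a \<Rightarrow> 'a"
  assumes subgroup_D: "additive_subgroup (D n) M"
    and p_mem: "x \<in> carrier M \<Longrightarrow> p n x \<in> D n"
    and p_add: "x \<in> carrier M \<Longrightarrow> y \<in> carrier M \<Longrightarrow> p n (x \<oplus> y) = p n x \<oplus> p n y"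
    and p_same: "x \<in> D n \<Longrightarrow> p n x = x"
    and p_other: "x \<in> D n \<Longrightarrow> m \<noteq> n \<Longrightarrow> p m x = \<zero>"
    and p_finite: "x \<in> carrier M \<Longrightarrow> finite {n. p n x \<noteq> \<zero>}"
    and p_sum: "x \<in> carrier M \<Longrightarrow> x = (\<Oplus>n\<in>{n. p n x \<noteq> \<zero>}. p n x)"
begin

lemma D_closed: "x \<in> D n \<Longrightarrow> x \<in> carrier M"
  using additive_subgroup.a_subset[OF subgroup_D] by blast

lemma zero_D: "\<zero> \<in> D n"
  by (rule additive_subgroup.zero_closed[OF subgroup_D])

lemma p_closed: "x \<in> carrier M \<Longrightarrow> p n x \<in> carrier M"
  by (rule D_closed[OF p_mem])

lemma p_zero: "p n \<zero> = \<zero>"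
  by (rule p_same[OF zero_D])

lemma p_finsum:
  assumes "finite S" "\<And>i. i \<in> S \<Longrightarrow> c i \<in> carrier M"
  shows "p n (\<Oplus>i\<in>S. c i) = (\<Oplus>i\<in>S. p n (c i))"
  by (rule additive_finsum) (use assms p_closed p_zero p_add in auto)

lemma sum_superset:
  assumes "x \<in> carrier M" "finite S" "{n. p n x \<noteq> \<zero>} \<subseteq> S"
  shows "(\<Oplus>n\<in>S. p n x) = x"
proof -
  have "(\<Oplus>n\<in>S. p n x) = (\<Oplus>n\<in>{n. p n x \<noteq> \<zero>}. p n x)"
    by (rule finsum_mono_neutral[symmetric]) (use assms p_closed in auto)
  then show ?thesis using p_sum[OF assms(1)] by simp
qed

lemma decomp_unique:
  assumes "homogeneous_decomp M D x c"
  shows "p n x = c n"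
proof -
  let ?S = "{n. c n \<noteq> \<zero>}"
  have c: "\<And>n. c n \<in> D n" "finite ?S" "x = (\<Oplus>n\<in>?S. c n)"
    using assms by (auto simp: homogeneous_decomp_def)
  have "p n x = (\<Oplus>i\<in>?S. p n (c i))"
    unfolding c(3) using c(1,2) D_closed by (intro p_finsum) auto
  also have "\<dots> = p n (c n)"
    by (rule finsum_single) (use c(2) p_closed[OF D_closed[OF c(1)]] p_zero in \<open>auto simp: p_other[OF c(1)]\<close>)
  finally show ?thesis using p_same c(1) by simp
qed

lemma decomp: "x \<in> carrier M \<Longrightarrow> homogeneous_decomp M D x (\<lambda>n. p n x)"
  by (simp add: homogeneous_decomp_def p_mem p_finite p_sum[symmetric])

lemma internal_direct_sum: "internal_direct_sum M D"
  unfolding internal_direct_sum_def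
proof (intro conjI allI ballI subgroup_D ex_ex1I)
  fix x c c' assume "homogeneous_decomp M D x c" "homogeneous_decomp M D x c'"
  then have "c n = c' n" for n
    using decomp_unique[of x c n] decomp_unique[of x c' n] by simp
  then show "c = c'" by (rule ext)
next
  fix x assume "x \<in> carrier M"
  then show "\<exists>c. homogeneous_decomp M D x c"
    by (intro exI[of _ "\<lambda>n. p n x"] decomp)
qed

lemma component_eq:
  assumes "x \<in> carrier M"
  shows "homogeneous_component M D n x = p n x"
proof -
  have "(THE c. homogeneous_decomp M D x c) = (\<lambda>n. p n x)"
    proof (rule the_equality[of "homogeneous_decomp M D x" "\<lambda>n. p n x"])
    fix c assume "homogeneous_decomp M D x c"
    from decomp_unique[OF this] show "c = (\<lambda>n. p n x)" by simp
  qed (rule decomp[OF assms])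
  then show ?thesis by (simp add: homogeneous_component_def)
qed

end

section \<open>Components of products in a graded ring\<close>

locale projection_graded_ring = ring R + graded_projections R A \<pi>
  for R :: "('a, 'c) ring_scheme" (structure) and A :: "nat \<Rightarrow> 'a set" and \<pi> +
  assumes one_A: "\<one> \<in> A 0"
    and mult_A: "a \<in> A m \<Longrightarrow> b \<in> A n \<Longrightarrow> a \<otimes> b \<in> A (m + n)"
begin

lemma graded_ring: "graded_ring R A"
  by (intro graded_ring.intro graded_ring_axioms.intro ring_axioms internal_direct_sum one_A mult_A)

text \<open>Expand \<open>c\<close> into components: the one of index j is sent to degree j + m, so
  only j = n - m reaches degree n. The case n < m is separate because subtraction of naturals
  truncates.\<close>

lemma p_mult_right:
  assumes "c \<in> carrier R" "g \<in> A m"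
  shows "\<pi> n (c \<otimes> g) = (if m \<le> n then \<pi> (n - m) c \<otimes> g else \<zero>)"
proof -
  let ?S = "{j. \<pi> j c \<noteq> \<zero>}"
  have g: "g \<in> carrier R" using assms D_closed by blast
  have cl: "\<pi> j c \<in> carrier R" for j using assms p_closed by blast
  have deg: "\<pi> j c \<otimes> g \<in> A (j + m)" for j
    by (rule mult_A) (use assms p_mem in auto)
  have "c \<otimes> g = (\<Oplus>j\<in>?S. \<pi> j c \<otimes> g)"
    using p_sum[OF assms(1)] finsum_ldistr[OF p_finite[OF assms(1)] g, of "\<lambda>j. \<pi> j c"] cl by simp
  then have eq: "\<pi> n (c \<otimes> g) = (\<Oplus>j\<in>?S. \<pi> n (\<pi> j c \<otimes> g))"
    using p_finsum[OF p_finite[OF assms(1)]] cl g by simp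
  show ?thesis
  proof (cases "m \<le> n")
    case True
    have "(\<Oplus>j\<in>?S. \<pi> n (\<pi> j c \<otimes> g)) = \<pi> n (\<pi> (n - m) c \<otimes> g)"
      by (rule finsum_single)
        (use cl g p_finite assms p_closed p_zero True in \<open>auto intro!: p_other[OF deg]\<close>)
    then show ?thesis
      using eq True p_same[OF deg, of "n - m"] by simp
  next
    case False
    then have "\<pi> n (\<pi> j c \<otimes> g) = \<zero>" for j
      by (intro p_other[OF deg]) auto
    then show ?thesis using False eq by simp
  qed
qed

text \<open>Components of \<open>b\<close> of positive degree cannot contribute to degree zero. This
  is what makes the augmentation linear over the whole ring.\<close>

lemma p_zero_mult:
  assumes "a \<in> carrier R" "b \<in> carrier R"
  shows "\<pi> 0 (a \<otimes> b) = \<pi> 0 a \<otimes> \<pi> 0 b"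
proof -
  let ?S = "{j. \<pi> j b \<noteq> \<zero>}"
  have cl: "\<pi> j b \<in> carrier R" for j using assms p_closed by blast
  have "a \<otimes> b = (\<Oplus>j\<in>?S. a \<otimes> \<pi> j b)"
    using p_sum[OF assms(2)] finsum_rdistr[OF p_finite[OF assms(2)] assms(1), of "\<lambda>j. \<pi> j b"] cl by simp
  then have "\<pi> 0 (a \<otimes> b) = (\<Oplus>j\<in>?S. \<pi> 0 (a \<otimes> \<pi> j b))"
    using p_finsum[OF p_finite[OF assms(2)]] cl assms by simp
  also have "\<dots> = \<pi> 0 (a \<otimes> \<pi> 0 b)"
    by (rule finsum_single)
      (use assms p_finite cl p_closed p_zero in \<open>auto simp: p_mult_right[OF assms(1) p_mem[OF assms(2)]]\<close>)
  also have "\<dots> = \<pi> 0 a \<otimes> \<pi> 0 b"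
    using p_mult_right[OF assms(1) p_mem[OF assms(2)], of 0 0] by simp
  finally show ?thesis .
qed

end

section \<open>Shifted gradings of free modules\<close>

context projection_graded_ring
begin

text \<open>Module degrees are integers while ring degrees are naturals. The case distinction is
  essential: \<open>nat\<close> would send every negative degree to \<open>A 0\<close>.\<close>

definition int_part :: "int \<Rightarrow> 'a set" where
  "int_part s = (if s < 0 then {\<zero>} else A (nat s))"

text \<open>The N-fold sum of the ring shifted by i, so that the unit vectors sit in degree
  i.\<close>

definition free_grading :: "nat \<Rightarrow> int \<Rightarrow> int \<Rightarrow> (nat \<Rightarrow> 'a) set" where
  "free_grading N i n = {f \<in> carrier (free_module R N). \<forall>j. f j \<in> int_part (n - i)}"

lemma int_part_subgroup: "additive_subgroup (int_part s) R"
  using subgroup_D[of "nat s"] by (auto simp: int_part_def intro: ideal.axioms(1)[OF zeroideal])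

lemma int_part_mult: "a \<in> A m \<Longrightarrow> b \<in> int_part s \<Longrightarrow> a \<otimes> b \<in> int_part (int m + s)"
  using mult_A[of a m b "nat s"] D_closed[of a m] zero_D
  by (auto simp: int_part_def nat_add_distrib split: if_splits)

lemma int_part_mult_right: "a \<in> int_part s \<Longrightarrow> b \<in> A m \<Longrightarrow> a \<otimes> b \<in> int_part (s + int m)"
  using mult_A[of a "nat s" b m] D_closed[of b m] zero_D
  by (auto simp: int_part_def nat_add_distrib split: if_splits)

lemma free_finsum_apply:
  assumes "finite S" "\<And>n. n \<in> S \<Longrightarrow> F n \<in> carrier (free_module R N)"
  shows "(\<Oplus>\<^bsub>free_module R N\<^esub>n\<in>S. F n) j = (\<Oplus>n\<in>S. F n j)"
proof -
  interpret F: left_module R "free_module R N" by (rule free_module_left_module)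
  show ?thesis
    using assms
  proof (induction S rule: finite_induct)
    case (insert n S)
    then have "F \<in> S \<rightarrow> carrier (free_module R N)" "F n \<in> carrier (free_module R N)"
      by blast+
    then show ?case
      using insert by (subst F.M.finsum_insert) (auto simp: finsum_insert Pi_iff)
  qed simp
qed

lemma free_graded_projections:
  "graded_projections (free_module R N) (free_grading N i)
     (\<lambda>n f j. if n < i then \<zero> else \<pi> (nat (n - i)) (f j))" (is "graded_projections ?F ?D ?p")
proof -
  interpret F: left_module R ?F by (rule free_module_left_module)
  have finite_p: "finite {n. ?p n f \<noteq> (\<lambda>j. \<zero>)}" if "f \<in> carrier ?F" for f
  proof (rule finite_subset)
    \<comment> \<open>Only the coordinates below N can be nonzero, and each has finitely many
      components; adding i translates ring degrees into module degrees.\<close>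
    show "{n. ?p n f \<noteq> (\<lambda>j. \<zero>)} \<subseteq> (\<Union>j<N. (\<lambda>m. int m + i) ` {m. \<pi> m (f j) \<noteq> \<zero>})"
    proof
      fix n assume "n \<in> {n. ?p n f \<noteq> (\<lambda>j. \<zero>)}"
      then obtain j where j: "i \<le> n" "\<pi> (nat (n - i)) (f j) \<noteq> \<zero>"
        by (auto simp: fun_eq_iff split: if_splits)
      then have "j < N" using that p_zero by (cases "j < N") auto
      then show "n \<in> (\<Union>j<N. (\<lambda>m. int m + i) ` {m. \<pi> m (f j) \<noteq> \<zero>})"
        using j by (auto intro!: bexI[of _ j] image_eqI[of _ _ "nat (n - i)"])
    qed
  qed (use that p_finite in auto)
  have p_sum_F: "f = (\<Oplus>\<^bsub>?F\<^esub>n\<in>{n. ?p n f \<noteq> (\<lambda>j. \<zero>)}. ?p n f)" if f: "f \<in> carrier ?F" for f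
  proof
    fix j
    define S where "S = {n. ?p n f \<noteq> (\<lambda>j. \<zero>)}"
    have fS: "finite S" using finite_p[OF f] by (simp add: S_def)
    have fj: "f j \<in> carrier R" using f by simp
    have "(\<Oplus>\<^bsub>?F\<^esub>n\<in>S. ?p n f) j = (\<Oplus>n\<in>S. ?p n f j)"
      by (rule free_finsum_apply) (use fS f p_closed p_zero in auto)
    \<comment> \<open>Degrees below i contribute zero. The remaining ones are reindexed by the ring
      degree n - i, which reduces the claim to the decomposition of the single entry
      \<open>f j\<close>.\<close>
    also have "\<dots> = (\<Oplus>n\<in>{n \<in> S. i \<le> n}. ?p n f j)"
      using fj p_closed fS by (intro finsum_mono_neutral[symmetric]) auto
    also have "{n \<in> S. i \<le> n} = (\<lambda>m. int m + i) ` {m. int m + i \<in> S}"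
    proof (intro equalityI subsetI)
      fix n assume "n \<in> {n \<in> S. i \<le> n}"
      then show "n \<in> (\<lambda>m. int m + i) ` {m. int m + i \<in> S}"
        by (intro image_eqI[of _ _ "nat (n - i)"]) auto
    qed auto
    also have "(\<Oplus>n\<in>(\<lambda>m. int m + i) ` {m. int m + i \<in> S}. ?p n f j)
      = (\<Oplus>m\<in>{m. int m + i \<in> S}. ?p (int m + i) f j)"
      using fj p_closed by (intro finsum_reindex) (auto simp: inj_on_def)
    also have "\<dots> = (\<Oplus>m\<in>{m. int m + i \<in> S}. \<pi> m (f j))"
      by simp
    also have "\<dots> = f j"
    proof (rule sum_superset[OF fj])
      show "finite {m. int m + i \<in> S}"
        using finite_vimageI[OF fS, of "\<lambda>m. int m + i"] by (simp add: vimage_def inj_on_def)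
    qed (auto simp: S_def fun_eq_iff)
    finally show "f j = (\<Oplus>\<^bsub>?F\<^esub>n\<in>{n. ?p n f \<noteq> (\<lambda>j. \<zero>)}. ?p n f) j"
      by (simp add: S_def)
  qed
  show ?thesis
  proof (intro graded_projections.intro graded_projections_axioms.intro F.M.abelian_group_axioms)
    fix n
    have "\<ominus>\<^bsub>?F\<^esub> f = (\<lambda>j. \<ominus> f j)" if "f \<in> carrier ?F" for f
      by (rule F.M.minus_equality) (use that in \<open>auto simp: l_neg\<close>)
    then show "additive_subgroup (free_grading N i n) ?F"
      using additive_subgroup.a_closed[OF int_part_subgroup[of "n - i"]]
        additive_subgroup.zero_closed[OF int_part_subgroup[of "n - i"]]
        additive_subgroup.a_inv_closed[OF int_part_subgroup[of "n - i"]]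
      by (intro additive_subgroupI F.M.add.subgroupI)
        (auto simp: free_grading_def a_inv_def[symmetric])
  next
    fix f n assume "f \<in> carrier ?F"
    then show "?p n f \<in> free_grading N i n"
      using p_mem p_zero p_closed by (auto simp: free_grading_def int_part_def)
  next
    fix f g n assume "f \<in> carrier ?F" "g \<in> carrier ?F"
    then show "?p n (f \<oplus>\<^bsub>?F\<^esub> g) = ?p n f \<oplus>\<^bsub>?F\<^esub> ?p n g"
      by (auto simp: p_add fun_eq_iff)
  next
    fix f n assume "f \<in> free_grading N i n"
    then show "?p n f = f"
      by (auto simp: free_grading_def int_part_def fun_eq_iff p_same split: if_splits)
  next
    fix f m n assume "f \<in> free_grading N i n" "m \<noteq> n"
    then show "?p m f = \<zero>\<^bsub>?F\<^esub>"
      by (auto simp: free_grading_def int_part_def fun_eq_iff p_zero nat_eq_iff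
          p_other[of _ "nat (n - i)" "nat (m - i)"] split: if_splits)
  qed (use finite_p p_sum_F in simp_all)
qed

lemma free_graded_left_module: "graded_left_module R A (free_module R N) (free_grading N i)"
proof -
  interpret F: graded_projections "free_module R N" "free_grading N i"
    "\<lambda>n f j. if n < i then \<zero> else \<pi> (nat (n - i)) (f j)"
    by (rule free_graded_projections)
  show ?thesis
    using int_part_mult D_closed
    by (intro graded_left_module.intro graded_left_module_axioms.intro graded_ring
        free_module_left_module F.internal_direct_sum)
      (fastforce simp: free_grading_def add_diff_eq)+
qed

text \<open>The unit vectors have degree i because \<open>\<one>\<close> has degree zero, and every
  vector is a combination of them.\<close>

lemma free_generated:
  "generated_in_degree R (free_module R N) (free_grading N i) i"
  unfolding generated_in_degree_def
proof (intro allI impI)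
  fix U assume U: "submodule U R (free_module R N)" and sub: "free_grading N i i \<subseteq> U"
  interpret F: left_module R "free_module R N" by (rule free_module_left_module)
  interpret U: submodule U R "free_module R N" by fact
  have unit: "unit_vec l \<in> U" if "l < N" for l
    using sub that unit_vec_closed[OF that] one_A zero_D
    by (auto simp: free_grading_def int_part_def unit_vec_def)
  have "lin_comb (free_module R N) unit_vec n c \<in> U" if "n \<le> N" "c \<in> carrier (free_module R N)" for n c
    using that(1)
  proof (induction n)
    case 0
    then show ?case using U.one_closed by simp
  next
    case (Suc n)
    then have "lin_comb (free_module R N) unit_vec n c \<in> U"
      "c n \<odot>\<^bsub>free_module R N\<^esub> unit_vec n \<in> U"
      using that(2) unit[of n] U.smult_closed[of "c n" "unit_vec n"] by auto
    then show ?case using U.m_closed by (simp only: lin_comb_Suc) simp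
  qed
  then have "carrier (free_module R N) \<subseteq> U"
    using free_module_expand by (metis order_refl subsetI)
  then show "U = carrier (free_module R N)"
    using U.subset by auto
qed

text \<open>Entries of degree one exactly make up for the change of shift from i to i + 1. This is
  the linearity of the resolution.\<close>

lemma lin_comb_graded_hom:
  assumes "\<And>l. l < n \<Longrightarrow> g l \<in> carrier (free_module R m)" "\<And>l j. l < n \<Longrightarrow> g l j \<in> A 1"
  shows "lin_comb (free_module R m) g n
    \<in> graded_hom R (free_module R n) (free_grading n (i + 1)) (free_module R m) (free_grading m i)"
proof -
  interpret F: left_module R "free_module R m" by (rule free_module_left_module)
  have "lin_comb (free_module R m) g n c \<in> free_grading m i d" if "c \<in> free_grading n (i + 1) d" for c d
  proof -
    have c: "\<And>j. c j \<in> carrier R" "\<And>j. c j \<in> int_part (d - (i + 1))"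
      using that by (auto simp: free_grading_def)
    have "\<forall>j. lin_comb (free_module R m) g n c j \<in> int_part (d - i)"
      using assms(2)
    proof (induction n)
      case 0
      then show ?case using additive_subgroup.zero_closed[OF int_part_subgroup] by simp
    next
      case (Suc n)
      have "c n \<otimes> g n j \<in> int_part (d - i)" for j
        using int_part_mult_right[OF c(2)[of n] Suc.prems[of n j]] by simp
      then show ?case
        using Suc additive_subgroup.a_closed[OF int_part_subgroup] by simp
    qed
    then show ?thesis
      using F.lin_comb_closed[of n g c] assms(1) c(1) by (simp add: free_grading_def)
  qed
  then show ?thesis
    using lin_comb_hom[OF free_module_left_module assms(1)] by (auto simp: graded_hom_def)
qed

end

section \<open>Linear resolutions from a flag of left ideals\<close>

text \<open>\<open>I_colon\<close> together with \<open>\<sigma>_le\<close> is the condition that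
  colon ideals stay in the flag. \<open>I_k\<close> is phrased through \<open>\<pi> 0\<close>
  because the top ideal has to be the kernel of the augmentation.\<close>

locale koszul_flag = projection_graded_ring R A \<pi> for R :: "('a, 'c) ring_scheme" (structure) and A \<pi> +
  fixes k :: nat and x :: "nat \<Rightarrow> 'a" and I :: "nat \<Rightarrow> 'a set" and \<sigma> :: "nat \<Rightarrow> nat"
  assumes x_degree: "j < k \<Longrightarrow> x j \<in> A 1"
    and I_0: "I 0 = {\<zero>}"
    and I_Suc: "j < k \<Longrightarrow> I (Suc j) = {a \<oplus> r \<otimes> x j | a r. a \<in> I j \<and> r \<in> carrier R}"
    and I_colon: "j < k \<Longrightarrow> {r \<in> carrier R. r \<otimes> x j \<in> I j} = I (\<sigma> j)"
    and \<sigma>_le: "j < k \<Longrightarrow> \<sigma> j \<le> k"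
    and I_k: "I k = {r \<in> carrier R. \<pi> 0 r = \<zero>}"
begin

definition linear_flag :: "nat \<Rightarrow> nat \<Rightarrow> (nat \<Rightarrow> nat \<Rightarrow> 'a) \<Rightarrow> bool" where
  "linear_flag m n g \<longleftrightarrow>
     (\<forall>l<n. g l \<in> carrier (free_module R m) \<and> (\<forall>j. g l j \<in> A 1)) \<and>
     (\<forall>l<n. \<exists>t\<le>k. {r \<in> carrier R. r \<odot>\<^bsub>free_module R m\<^esub> g l \<in> lspan R (free_module R m) g l} = I t)"

lemma x_closed: "j < k \<Longrightarrow> x j \<in> carrier R"
  by (rule D_closed[OF x_degree])

lemma I_subset: "j \<le> k \<Longrightarrow> I j \<subseteq> carrier R"
proof (induction j)
  case (Suc j)
  then show ?case using I_Suc[of j] x_closed[of j] by auto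
qed (simp add: I_0)

lemma I_mono: "i \<le> j \<Longrightarrow> j \<le> k \<Longrightarrow> I i \<subseteq> I j"
proof (induction j rule: dec_induct)
  case (step j)
  have "a \<in> I (Suc j)" if "a \<in> I j" for a
  proof -
    have "a = a \<oplus> \<zero> \<otimes> x j"
      using that I_subset[of j] x_closed[of j] step by (auto simp: subset_iff)
    then show ?thesis
      using that I_Suc[of j] step by fastforce
  qed
  then show ?case using step by auto
qed simp

lemma zero_I: "j \<le> k \<Longrightarrow> \<zero> \<in> I j"
  using I_mono[of 0 j] I_0 by simp

lemma x_mem_I: "i < j \<Longrightarrow> j \<le> k \<Longrightarrow> x i \<in> I j"
proof -
  assume "i < j" "j \<le> k"
  moreover have "x i = \<zero> \<oplus> \<one> \<otimes> x i" using calculation x_closed by simp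
  ultimately have "x i \<in> I (Suc i)"
    using I_Suc[of i] zero_I[of i] by fastforce
  then show "x i \<in> I j"
    using I_mono[of "Suc i" j] \<open>i < j\<close> \<open>j \<le> k\<close> by auto
qed

lemma linear_flag_append:
  assumes "linear_flag m n g" "t \<in> carrier (free_module R m)" "\<And>j. t j \<in> A 1" "i \<le> k"
    "{r \<in> carrier R. r \<odot>\<^bsub>free_module R m\<^esub> t \<in> lspan R (free_module R m) g n} = I i"
  shows "linear_flag m (Suc n) (g(n := t))"
proof -
  have "lspan R (free_module R m) (g(n := t)) l = lspan R (free_module R m) g l" if "l \<le> n" for l
    using that by (intro lspan_cong) auto
  then show ?thesis
    using assms by (auto simp: linear_flag_def less_Suc_eq simp del: free_module_simps)
qed

text \<open>Any coefficients of \<open>y\<close> may be replaced by their degree-one components: as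
  the \<open>g j\<close> have degree one, these are all that the degree-two part of the combination
  sees, and \<open>y\<close> equals its degree-two part.\<close>

lemma degree_one_relation:
  assumes g: "\<And>j. j < l \<Longrightarrow> g j \<in> carrier (free_module R m)" "\<And>i j. j < l \<Longrightarrow> g j i \<in> A 1"
    and y: "y \<in> lspan R (free_module R m) g l" "\<And>i. y i \<in> A 2"
  obtains c where "\<And>j. c j \<in> A 1" "y = lin_comb (free_module R m) g l c"
proof -
  interpret F: left_module R "free_module R m" by (rule free_module_left_module)
  obtain c where c: "\<And>j. c j \<in> carrier R" "y = lin_comb (free_module R m) g l c"
    using y(1) by (auto simp: lspan_def)
  have "lin_comb (free_module R m) g l (\<lambda>j. \<pi> 1 (c j)) i = \<pi> 2 (lin_comb (free_module R m) g l c i)" for i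
    using g
  proof (induction l)
    case (Suc l)
    have "lin_comb (free_module R m) g l c \<in> carrier (free_module R m)"
      using Suc.prems c(1) by (intro F.lin_comb_closed) auto
    moreover have "\<pi> 2 (c l \<otimes> g l i) = \<pi> 1 (c l) \<otimes> g l i"
      using p_mult_right[OF c(1)[of l] Suc.prems(2)[of l i], of 2] by simp
    moreover have "g l i \<in> carrier R" using Suc.prems(1)[of l] by auto
    ultimately show ?case
      using Suc c(1) by (simp add: p_add)
  qed (simp add: p_zero)
  then have "y = lin_comb (free_module R m) g l (\<lambda>j. \<pi> 1 (c j))"
    using p_same[OF y(2)] c(2) by (auto simp: fun_eq_iff)
  then show thesis using that[of "\<lambda>j. \<pi> 1 (c j)"] p_mem[OF c(1)] by blast
qed

lemma syzygies_linear_flag: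
  assumes g: "linear_flag m n g"
  shows "\<exists>n' s. linear_flag n n' s \<and>
    lspan R (free_module R n) s n' =
      {c \<in> carrier (free_module R n). lin_comb (free_module R m) g n c = \<zero>\<^bsub>free_module R m\<^esub>}"
proof -
  interpret F: left_module R "free_module R m" by (rule free_module_left_module)
  interpret E: left_module R "free_module R n" by (rule free_module_left_module)
  let ?L = "lin_comb (free_module R m) g" and ?zero = "\<zero>\<^bsub>free_module R m\<^esub>"
  \<comment> \<open>The syzygy module is filtered by the position of the last nonzero coordinate and by the ideal of the
    flag containing it; consecutive steps of this filtration differ by one new generator.\<close>
  define Z where "Z l i = {c \<in> carrier (free_module R n). (\<forall>j>l. c j = \<zero>) \<and> c l \<in> I i \<and> ?L n c = ?zero}"
    for l i
  define Q where "Q l i \<longleftrightarrow> (\<exists>n' s. linear_flag n n' s \<and> lspan R (free_module R n) s n' = Z l i)" for l i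
  have gc: "\<And>l. l < n \<Longrightarrow> g l \<in> carrier (free_module R m)" and g1: "\<And>l j. l < n \<Longrightarrow> g l j \<in> A 1"
    using g by (auto simp: linear_flag_def)
  have L_hom: "?L n (\<lambda>j. c j \<oplus> c' j) = ?L n c \<oplus>\<^bsub>free_module R m\<^esub> ?L n c'"
    "?L n (\<lambda>j. r \<otimes> c j) = r \<odot>\<^bsub>free_module R m\<^esub> ?L n c"
    if "\<And>j. c j \<in> carrier R" "\<And>j. c' j \<in> carrier R" "r \<in> carrier R" for c c' r
    using gc that by (auto intro!: F.lin_comb_add F.lin_comb_smult simp del: free_module_simps)
  have L_split: "?L n c = ?L l c \<oplus>\<^bsub>free_module R m\<^esub> c l \<odot>\<^bsub>free_module R m\<^esub> g l"
    if "l < n" "\<And>j. c j \<in> carrier R" "\<And>j. l < j \<Longrightarrow> c j = \<zero>" for c l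
    using F.lin_comb_truncate[of n g c "Suc l"] gc that by (simp del: free_module_simps)
  have L_neg: "?L l (\<lambda>j. \<ominus> c j) \<oplus>\<^bsub>free_module R m\<^esub> ?L l c = ?zero"
    if "l \<le> n" "\<And>j. c j \<in> carrier R" for c l
    using F.lin_comb_add[of l g "\<lambda>j. \<ominus> c j" c] F.lin_comb_zero[of l g] that gc
    by (simp add: l_neg del: free_module_simps)
  have step: "Q l (Suc i)" if Q: "Q l i" and l: "l < n" and i: "i < t" "t \<le> k"
    and t: "{r \<in> carrier R. r \<odot>\<^bsub>free_module R m\<^esub> g l \<in> lspan R (free_module R m) g l} = I t" for l i t
  proof -
    obtain n' s where s: "linear_flag n n' s" "lspan R (free_module R n) s n' = Z l i"
      using Q by (auto simp: Q_def)
    have ik: "i < k" using i by simp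
    \<comment> \<open>The colon ideal \<open>I t\<close> contains \<open>x i\<close> because i < t,
      so \<open>x i\<close> times \<open>g l\<close> is a combination of the earlier vectors. Moving
      that combination to the other side gives the new syzygy.\<close>
    have span: "x i \<odot>\<^bsub>free_module R m\<^esub> g l \<in> lspan R (free_module R m) g l"
      using t x_mem_I[OF i] by blast
    have deg2: "(x i \<odot>\<^bsub>free_module R m\<^esub> g l) j \<in> A 2" for j
      using mult_A[OF x_degree[OF ik] g1[OF l, of j]] by (simp add: numeral_2_eq_2)
    have g_less: "\<And>j. j < l \<Longrightarrow> g j \<in> carrier (free_module R m)" "\<And>i j. j < l \<Longrightarrow> g j i \<in> A 1"
      using gc g1 l order_less_trans by blast+
    obtain c where c1: "\<And>j. c j \<in> A 1"
      and c: "x i \<odot>\<^bsub>free_module R m\<^esub> g l = ?L l c"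
      using degree_one_relation[OF g_less span deg2] by blast
    have cc: "\<And>j. c j \<in> carrier R" using c1 D_closed by blast
    \<comment> \<open>The last nonzero position is l, and the entry there is exactly
      \<open>x i\<close>; all other entries have degree one by the choice of
      \<open>c\<close>.\<close>
    define v where "v j = (if j = l then x i else if j < l then \<ominus> c j else \<zero>)" for j
    have v1: "v j \<in> A 1" for j
      using x_degree[OF ik] additive_subgroup.a_inv_closed[OF subgroup_D c1] zero_D by (simp add: v_def)
    have v_cl: "v j \<in> carrier R" for j using v1 D_closed by blast
    have v_carr: "v \<in> carrier (free_module R n)"
      using v_cl l by (auto simp: v_def)
    have "?L n v = ?L l v \<oplus>\<^bsub>free_module R m\<^esub> x i \<odot>\<^bsub>free_module R m\<^esub> g l"
      using L_split[of l v, OF l v_cl] by (simp add: v_def del: free_module_simps)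
    also have "?L l v = ?L l (\<lambda>j. \<ominus> c j)"
      by (rule lin_comb_cong) (auto simp: v_def)
    finally have Lv: "?L n v = ?zero"
      using c L_neg[of l c] l cc by (simp del: free_module_simps)
    \<comment> \<open>As \<open>v\<close> is itself a syzygy supported up to position l, adding a
      multiple of it affects membership in the filtration only through coordinate l, where it adds
      \<open>r \<otimes> x i\<close>.\<close>
    have mem_Z: "(\<lambda>j. a j \<oplus> r \<otimes> v j) \<in> Z l i' \<longleftrightarrow> a l \<oplus> r \<otimes> x i \<in> I i'"
      if a: "a \<in> carrier (free_module R n)" "\<And>j. l < j \<Longrightarrow> a j = \<zero>" "?L n a = ?zero"
        and r: "r \<in> carrier R" for a r i'
    proof -
      have "?L n (\<lambda>j. a j \<oplus> r \<otimes> v j) = ?zero"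
        using L_hom(1)[of a "\<lambda>j. r \<otimes> v j" r] L_hom(2)[of v v r] a r v_cl Lv by simp
      then show ?thesis
        using a r v_carr v_cl by (auto simp: Z_def v_def)
    qed
    have zero_free: "(\<lambda>j. \<zero>) \<in> carrier (free_module R n)" "?L n (\<lambda>j. \<zero>) = ?zero"
      using gc by (simp, intro F.lin_comb_zero)
    have "linear_flag n (Suc n') (s(n' := v))"
    proof (rule linear_flag_append[OF s(1) v_carr v1 \<sigma>_le[OF ik]])
      \<comment> \<open>The case a = 0 of \<open>mem_Z\<close>: the colon ideal of \<open>v\<close>
        over the previous generators is that of \<open>x i\<close> over \<open>I i\<close>, hence
        again in the flag.\<close>
      have "(\<lambda>j. r \<otimes> v j) \<in> Z l i \<longleftrightarrow> r \<otimes> x i \<in> I i" if "r \<in> carrier R" for r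
        using mem_Z[OF zero_free(1) _ zero_free(2) that, of i] that v_cl x_closed[OF ik] by simp
      then show "{r \<in> carrier R. r \<odot>\<^bsub>free_module R n\<^esub> v \<in> lspan R (free_module R n) s n'} = I (\<sigma> i)"
        using s(2) I_colon[OF ik] by auto
    qed
    moreover have "lspan R (free_module R n) (s(n' := v)) (Suc n')
      = {\<lambda>j. a j \<oplus> r \<otimes> v j | a r. a \<in> Z l i \<and> r \<in> carrier R}"
      using lspan_cong[of n' "s(n' := v)" s R "free_module R n"] s(2) by (simp add: E.lspan_Suc)
    moreover have "\<dots> = Z l (Suc i)"
    proof (intro equalityI subsetI)
      fix c' assume "c' \<in> {\<lambda>j. a j \<oplus> r \<otimes> v j | a r. a \<in> Z l i \<and> r \<in> carrier R}"
      then obtain a r where "c' = (\<lambda>j. a j \<oplus> r \<otimes> v j)" "a \<in> Z l i" "r \<in> carrier R" by blast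
      moreover from this have "a l \<oplus> r \<otimes> x i \<in> I (Suc i)"
        using I_Suc[OF ik] by (auto simp: Z_def)
      ultimately show "c' \<in> Z l (Suc i)"
        using mem_Z[of a r "Suc i"] by (auto simp: Z_def)
    next
      fix c' assume c': "c' \<in> Z l (Suc i)"
      then obtain a0 r where r: "c' l = a0 \<oplus> r \<otimes> x i" "a0 \<in> I i" "r \<in> carrier R"
        using I_Suc[OF ik] by (auto simp: Z_def)
      have a0: "a0 \<in> carrier R" using r I_subset[of i] ik by auto
      \<comment> \<open>Subtracting \<open>r\<close> times \<open>v\<close> removes the multiple of
        \<open>x i\<close> from coordinate l. The difference is written as a sum with
        \<open>\<ominus> r\<close> to fit \<open>mem_Z\<close>.\<close>
      define a where "a = (\<lambda>j. c' j \<oplus> (\<ominus> r) \<otimes> v j)"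
      have "c' l \<oplus> (\<ominus> r) \<otimes> x i = a0"
        using r a0 x_closed[OF ik] by (simp add: l_minus a_assoc r_neg)
      then have "a \<in> Z l i"
        unfolding a_def using c' r by (subst mem_Z) (auto simp: Z_def)
      moreover have "c' = (\<lambda>j. a j \<oplus> r \<otimes> v j)"
        using c' r v_cl by (auto simp: a_def Z_def fun_eq_iff l_minus a_assoc l_neg)
      ultimately show "c' \<in> {\<lambda>j. a j \<oplus> r \<otimes> v j | a r. a \<in> Z l i \<and> r \<in> carrier R}"
        using r(3) by blast
    qed
    ultimately show ?thesis unfolding Q_def by metis
  qed
  have steps: "Q l t" if "Q l 0" "l < n" "t \<le> k"
    and t: "{r \<in> carrier R. r \<odot>\<^bsub>free_module R m\<^esub> g l \<in> lspan R (free_module R m) g l} = I t" for l t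
  proof -
    have "Q l i" if "i \<le> t" for i
      using that
    proof (induction i)
      case (Suc i)
      then show ?case using step[of l i t] \<open>l < n\<close> \<open>t \<le> k\<close> t by simp
    qed (rule \<open>Q l 0\<close>)
    then show ?thesis by simp
  qed
  have "Q l 0" if "l \<le> n" for l
    using that
  proof (induction l)
    case 0
    have "Z 0 0 = {\<lambda>j. \<zero>}"
    proof (intro equalityI subsetI)
      fix c assume "c \<in> Z 0 0"
      then have "c j = \<zero>" for j by (cases j) (auto simp: Z_def I_0)
      then show "c \<in> {\<lambda>j. \<zero>}" by auto
    next
      fix c :: "nat \<Rightarrow> 'a" assume "c \<in> {\<lambda>j. \<zero>}"
      then show "c \<in> Z 0 0" using F.lin_comb_zero[of n g] gc by (simp add: Z_def I_0)
    qed
    then show ?case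
      unfolding Q_def by (intro exI[of _ 0] exI[of _ "\<lambda>_ _. \<zero>"]) (simp add: linear_flag_def)
  next
    case (Suc l)
    then have "l < n" by simp
    then obtain t where t: "t \<le> k"
      "{r \<in> carrier R. r \<odot>\<^bsub>free_module R m\<^esub> g l \<in> lspan R (free_module R m) g l} = I t"
      using g unfolding linear_flag_def by blast
    \<comment> \<open>A syzygy vanishing beyond l multiplies \<open>g l\<close> into the span of its
      predecessors, so its coordinate l lies in the colon ideal \<open>I t\<close> already. After t
      steps at position l the filtration can move on to the next position.\<close>
    have "Z l t = Z (Suc l) 0"
    proof (intro equalityI subsetI)
      fix c assume "c \<in> Z l t"
      then show "c \<in> Z (Suc l) 0" by (auto simp: Z_def I_0)
    next
      fix c assume c: "c \<in> Z (Suc l) 0"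
      then have c0: "c j = \<zero>" if "l < j" for j
        using that by (cases "j = Suc l") (auto simp: Z_def I_0)
      have cc: "\<And>j. c j \<in> carrier R" using c by (auto simp: Z_def)
      have cl: "?L l c \<in> carrier (free_module R m)" "c l \<odot>\<^bsub>free_module R m\<^esub> g l \<in> carrier (free_module R m)"
        "?L l (\<lambda>j. \<ominus> c j) \<in> carrier (free_module R m)"
        using Suc.prems gc cc by (auto intro!: F.lin_comb_closed F.smult_closed simp del: free_module_simps)
      have "?L l c \<oplus>\<^bsub>free_module R m\<^esub> c l \<odot>\<^bsub>free_module R m\<^esub> g l = ?zero"
        using L_split[of l c] Suc.prems cc c0 c by (simp add: Z_def del: free_module_simps)
      moreover have "?L l c \<oplus>\<^bsub>free_module R m\<^esub> ?L l (\<lambda>j. \<ominus> c j) = ?zero"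
        using L_neg[of l c] cc Suc.prems cl by (simp add: F.M.a_comm del: free_module_simps)
      ultimately have "c l \<odot>\<^bsub>free_module R m\<^esub> g l = ?L l (\<lambda>j. \<ominus> c j)"
        using cl by (metis F.M.a_comm F.M.minus_equality)
      then have "c l \<odot>\<^bsub>free_module R m\<^esub> g l \<in> lspan R (free_module R m) g l"
        unfolding lspan_def using cc by auto
      then have "c l \<in> I t" using t(2) cc by blast
      then show "c \<in> Z l t" using c c0 by (simp add: Z_def)
    qed
    then show ?case
      using steps[of l t] Suc t by (simp add: Q_def)
  qed
  from this[of n] have "Q n 0" by simp
  \<comment> \<open>Position n lies outside the support of every vector of rank n, so both
    conditions on coordinates hold automatically there.\<close>
  moreover have "Z n 0 = {c \<in> carrier (free_module R n). ?L n c = ?zero}"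
    by (auto simp: Z_def I_0)
  ultimately show ?thesis by (simp add: Q_def)
qed

end

section \<open>The resolution of the degree-zero part\<close>

context koszul_flag
begin

text \<open>Embeds the flag of ideals into the free module of rank one, where only coordinate 0
  matters. It yields both the colon ideals of the first flag and exactness at the
  augmentation.\<close>

lemma lspan_generators:
  "l \<le> k \<Longrightarrow> lspan R (free_module R 1) (\<lambda>l j. if j = 0 then x l else \<zero>) l
    = {f \<in> carrier (free_module R 1). f 0 \<in> I l}"
proof (induction l)
  interpret F: left_module R "free_module R 1" by (rule free_module_left_module)
  case 0
  have "f = (\<lambda>j. \<zero>)" if "f \<in> carrier (free_module R 1)" "f 0 = \<zero>" for f
  proof
    fix j show "f j = \<zero>" using that by (cases j) auto
  qed
  then show ?case using F.lspan_0 by (auto simp: I_0 simp del: One_nat_def)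
next
  interpret F: left_module R "free_module R 1" by (rule free_module_left_module)
  case (Suc l)
  let ?g = "\<lambda>l j. if j = 0 then x l else \<zero>"
  have span: "lspan R (free_module R 1) ?g (Suc l) =
    {\<lambda>j. f j \<oplus> r \<otimes> ?g l j | f r. f \<in> carrier (free_module R 1) \<and> f 0 \<in> I l \<and> r \<in> carrier R}"
    using F.lspan_Suc[of ?g l] Suc by simp
  show ?case
    unfolding span
  proof (intro equalityI subsetI)
    fix f assume "f \<in> {\<lambda>j. f j \<oplus> r \<otimes> ?g l j | f r.
      f \<in> carrier (free_module R 1) \<and> f 0 \<in> I l \<and> r \<in> carrier R}"
    then obtain f' r where f': "f = (\<lambda>j. f' j \<oplus> r \<otimes> ?g l j)" "f' \<in> carrier (free_module R 1)"
      "f' 0 \<in> I l" "r \<in> carrier R"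
      by blast
    then show "f \<in> {f \<in> carrier (free_module R 1). f 0 \<in> I (Suc l)}"
      using I_Suc[of l] x_closed[of l] Suc.prems by auto
  next
    fix f assume f: "f \<in> {f \<in> carrier (free_module R 1). f 0 \<in> I (Suc l)}"
    then obtain a r where r: "f 0 = a \<oplus> r \<otimes> x l" "a \<in> I l" "r \<in> carrier R"
      using I_Suc[of l] Suc.prems by auto
    moreover have "a \<in> carrier R" using r I_subset[of l] Suc.prems by auto
    ultimately show "f \<in> {\<lambda>j. f j \<oplus> r \<otimes> ?g l j | f r.
      f \<in> carrier (free_module R 1) \<and> f 0 \<in> I l \<and> r \<in> carrier R}"
      using f by (intro CollectI exI[of _ "\<lambda>j. if j = 0 then a else \<zero>"] exI[of _ r])
        (auto simp: fun_eq_iff)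
  qed
qed

lemma generators_linear_flag: "linear_flag 1 k (\<lambda>l j. if j = 0 then x l else \<zero>)"
proof -
  let ?g = "\<lambda>l j. if j = 0 then x l else \<zero>"
  have "{r \<in> carrier R. r \<odot>\<^bsub>free_module R 1\<^esub> ?g l \<in> lspan R (free_module R 1) ?g l} = I (\<sigma> l)"
    if "l < k" for l
    using lspan_generators[of l] that I_colon[OF that] x_closed[OF that] by (simp cong: conj_cong)
  then show ?thesis
    using x_degree x_closed zero_D \<sigma>_le
    by (force simp: linear_flag_def simp del: One_nat_def)
qed

theorem koszul:
  assumes "semisimple_ring (R\<lparr>carrier := A 0\<rparr>)"
  shows "koszul R A"
proof -
  let ?F = "free_module R" and ?g = "\<lambda>l j. if j = 0 then x l else \<zero>"
  \<comment> \<open>A state (m, n, g) stands for a differential from rank n to rank m whose columns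
    are the vectors \<open>g\<close>. The clause for i = 0 pins the start to the generators of the
    top ideal, which dependent choice would otherwise forget.\<close>
  define P :: "nat \<Rightarrow> nat \<times> nat \<times> (nat \<Rightarrow> nat \<Rightarrow> 'a) \<Rightarrow> bool" where
    "P i = (\<lambda>(m, n, g). linear_flag m n g \<and> (i = 0 \<longrightarrow> m = 1 \<and> n = k \<and> g = ?g))" for i
  define Q :: "nat \<Rightarrow> nat \<times> nat \<times> (nat \<Rightarrow> nat \<Rightarrow> 'a) \<Rightarrow> nat \<times> nat \<times> (nat \<Rightarrow> nat \<Rightarrow> 'a) \<Rightarrow> bool" where
    "Q i = (\<lambda>(m, n, g) (m', n', g'). m' = n \<and>
      lspan R (?F n) g' n' = {c \<in> carrier (?F n). lin_comb (?F m) g n c = \<zero>\<^bsub>?F m\<^esub>})" for i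
  have "\<exists>S. \<forall>i. P i (S i) \<and> Q i (S i) (S (Suc i))"
  proof (rule dependent_nat_choice)
    show "\<exists>s. P 0 s"
      using generators_linear_flag by (auto simp: P_def)
  next
    fix s i assume "P i s"
    moreover obtain m n g where s: "s = (m, n, g)" by (cases s)
    ultimately have "linear_flag m n g" by (simp add: P_def)
    from syzygies_linear_flag[OF this] obtain n' g' where "linear_flag n n' g'"
      "lspan R (?F n) g' n' = {c \<in> carrier (?F n). lin_comb (?F m) g n c = \<zero>\<^bsub>?F m\<^esub>}"
      by blast
    then show "\<exists>s'. P (Suc i) s' \<and> Q i s s'"
      by (intro exI[of _ "(n, n', g')"]) (simp add: P_def Q_def s)
  qed
  then obtain S where S: "\<And>i. P i (S i)" "\<And>i. Q i (S i) (S (Suc i))" by blast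
  define N where "N i = fst (S i)" for i
  define G where "G i = snd (snd (S i))" for i
  define d where "d i = lin_comb (?F (N i)) (G i) (N (Suc i))" for i
  have S_eq: "S i = (N i, N (Suc i), G i)" for i
    using S(2)[of i] by (cases "S i"; cases "S (Suc i)") (auto simp: Q_def N_def G_def)
  have flag: "linear_flag (N i) (N (Suc i)) (G i)" for i
    using S(1)[of i] by (simp add: P_def S_eq)
  have G: "\<And>i l. l < N (Suc i) \<Longrightarrow> G i l \<in> carrier (?F (N i))"
    "\<And>i l j. l < N (Suc i) \<Longrightarrow> G i l j \<in> A 1"
    using flag unfolding linear_flag_def by blast+
  have start: "N 0 = 1" "N 1 = k" "G 0 = ?g"
    using S(1)[of 0] by (simp_all add: P_def S_eq)
  have im_d: "d i ` carrier (?F (N (Suc i))) = lspan R (?F (N i)) (G i) (N (Suc i))" for i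
    unfolding d_def by (rule left_module.lspan_eq_image_free[OF free_module_left_module, symmetric])
  have exact: "d (Suc i) ` carrier (?F (N (Suc (Suc i))))
    = {c \<in> carrier (?F (N (Suc i))). d i c = \<zero>\<^bsub>?F (N i)\<^esub>}" for i
    using S(2)[of i] unfolding im_d by (simp add: Q_def S_eq d_def)
  define \<epsilon> :: "(nat \<Rightarrow> 'a) \<Rightarrow> 'a" where "\<epsilon> f = \<pi> 0 (f 0)" for f
  have \<epsilon>_hom: "\<epsilon> \<in> left_module_hom R (?F 1) (degree_zero_module R A)"
    using p_mem[of _ 0] p_add[of _ _ 0]
    by (auto simp: left_module_hom_def degree_zero_module_def \<epsilon>_def component_eq p_zero_mult)
  have \<epsilon>_graded: "\<epsilon> \<in> graded_hom R (?F 1) (free_grading 1 0) (degree_zero_module R A) (degree_zero_grading R A)"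
  proof -
    have "\<epsilon> f \<in> degree_zero_grading R A n" if f: "f \<in> free_grading 1 0 n" for f n
    proof -
      consider "n < 0" "f 0 = \<zero>" | "n = 0" "f 0 \<in> A 0" | "n > 0" "f 0 \<in> A (nat n)"
        using f by (cases n "0 :: int" rule: linorder_cases) (auto simp: free_grading_def int_part_def)
      then show ?thesis
        by cases (simp_all add: \<epsilon>_def degree_zero_grading_def p_zero p_same p_other[of "f 0" "nat n"])
    qed
    then show ?thesis
      using \<epsilon>_hom by (auto simp: graded_hom_def simp del: One_nat_def)
  qed
  have \<epsilon>_im: "\<epsilon> ` carrier (?F 1) = A 0"
  proof (intro equalityI subsetI)
    fix r assume "r \<in> A 0"
    then show "r \<in> \<epsilon> ` carrier (?F 1)"
      using p_same D_closed by (intro image_eqI[of _ _ "\<lambda>j. if j = 0 then r else \<zero>"]) (auto simp: \<epsilon>_def)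
  qed (use p_mem in \<open>auto simp: \<epsilon>_def\<close>)
  \<comment> \<open>The image of \<open>d 0\<close> consists of the vectors whose coordinate 0 lies
    in \<open>I k\<close>, and \<open>I k\<close> is the kernel of \<open>\<pi> 0\<close>.\<close>
  have \<epsilon>_ker: "d 0 ` carrier (?F (N 1)) = {f \<in> carrier (?F (N 0)). \<epsilon> f = \<zero>}"
    unfolding im_d[of 0, folded One_nat_def] using lspan_generators[of k]
    by (auto simp: start \<epsilon>_def I_k simp del: One_nat_def)
  have "linear_projective_resolution R A (\<lambda>i. ?F (N i)) (\<lambda>i. free_grading (N i) (int i)) d \<epsilon>"
    unfolding linear_projective_resolution_def
  proof (intro conjI allI free_graded_left_module free_module_projective free_generated exact \<epsilon>_ker)
    fix i
    have "d i \<in> graded_hom R (?F (N (Suc i))) (free_grading (N (Suc i)) (int i + 1))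
      (?F (N i)) (free_grading (N i) (int i))"
      unfolding d_def by (rule lin_comb_graded_hom) (use G in auto)
    then show "d i \<in> graded_hom R (?F (N (Suc i))) (free_grading (N (Suc i)) (int (Suc i)))
      (?F (N i)) (free_grading (N i) (int i))"
      by (simp add: add.commute)
  qed (use \<epsilon>_graded \<epsilon>_im start in simp_all)
  then show ?thesis
    unfolding koszul_def using graded_ring assms by blast
qed

end

section \<open>Monomial left ideals\<close>

lemma regular_left_module:
  assumes "ring S"
  shows "left_module S (regular_module S)"
proof -
  interpret S: ring S by fact
  have "abelian_group (regular_module S)"
  proof (rule abelian_groupI)
    fix a assume "a \<in> carrier (regular_module S)"
    then show "\<exists>b\<in>carrier (regular_module S). b \<oplus>\<^bsub>regular_module S\<^esub> a = \<zero>\<^bsub>regular_module S\<^esub>"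
      by (intro bexI[of _ "\<ominus>\<^bsub>S\<^esub> a"]) (simp_all add: regular_module_def S.l_neg)
  qed (simp_all add: regular_module_def S.a_ac)
  then show ?thesis
    by (intro left_module.intro left_module_axioms.intro assms)
      (simp_all add: regular_module_def S.l_distr S.r_distr S.m_assoc)
qed

text \<open>The ring records carry no scalar multiplication, so the complex vector space is visible
  only through the coordinates \<open>co\<close> with respect to a basis \<open>E\<close>. Of the
  multiplication, this locale fixes only its effect on degrees and its pointwise form in degree
  zero.\<close>

locale coordinate_ring = ring R for R :: "('a, 'c) ring_scheme" (structure) +
  fixes A :: "nat \<Rightarrow> 'a set" and co :: "'a \<Rightarrow> 'm \<Rightarrow> complex" and E :: "'m set" and deg :: "'m \<Rightarrow> nat"
  assumes co_bij: "bij_betw co (carrier R) {h. finite {z. h z \<noteq> 0} \<and> {z. h z \<noteq> 0} \<subseteq> E}"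
    and co_add: "a \<in> carrier R \<Longrightarrow> b \<in> carrier R \<Longrightarrow> co (a \<oplus> b) z = co a z + co b z"
    and A_eq: "A n = {a \<in> carrier R. \<forall>z. co a z \<noteq> 0 \<longrightarrow> deg z = n}"
    and co_mult: "a \<in> carrier R \<Longrightarrow> b \<in> carrier R \<Longrightarrow> co (a \<otimes> b) z \<noteq> 0
      \<Longrightarrow> \<exists>x y. co a x \<noteq> 0 \<and> co b y \<noteq> 0 \<and> deg z = deg x + deg y"
    and co_one: "co \<one> z \<noteq> 0 \<Longrightarrow> deg z = 0"
    and co_mult_A0: "a \<in> A 0 \<Longrightarrow> b \<in> A 0 \<Longrightarrow> co (a \<otimes> b) z = co a z * co b z"
begin

lemma co_eqI: "a \<in> carrier R \<Longrightarrow> b \<in> carrier R \<Longrightarrow> (\<And>z. co a z = co b z) \<Longrightarrow> a = b"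
  using inj_onD[OF bij_betw_imp_inj_on[OF co_bij], of a b] by (simp add: fun_eq_iff)

lemma co_supp:
  assumes "a \<in> carrier R"
  shows "finite {z. co a z \<noteq> 0}" "co a z \<noteq> 0 \<Longrightarrow> z \<in> E"
  using bij_betwE[OF co_bij] assms by auto

lemma ex_co:
  assumes "finite {z. h z \<noteq> 0}" "\<And>z. h z \<noteq> 0 \<Longrightarrow> z \<in> E"
  obtains a where "a \<in> carrier R" "\<And>z. co a z = h z"
proof -
  have "h \<in> co ` carrier R"
    using assms bij_betw_imp_surj_on[OF co_bij] by auto
  then show thesis using that by auto
qed

lemma co_zero [simp]: "co \<zero> z = 0"
  using co_add[of \<zero> \<zero> z] by simp

lemma co_minus: "a \<in> carrier R \<Longrightarrow> co (\<ominus> a) z = - co a z"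
  using co_add[of a "\<ominus> a" z] by (simp add: r_neg add_eq_0_iff)

lemma co_finsum:
  "finite S \<Longrightarrow> (\<And>i. i \<in> S \<Longrightarrow> c i \<in> carrier R) \<Longrightarrow> co (\<Oplus>i\<in>S. c i) z = (\<Sum>i\<in>S. co (c i) z)"
proof (induction S rule: finite_induct)
  case (insert i S)
  then show ?case
    by (subst finsum_insert) (auto simp: co_add finsum_closed Pi_iff)
qed simp

text \<open>The coordinate projection onto the span of the basis elements in \<open>S\<close>. One
  construction gives the projections of the grading, the complements in degree zero and the
  splitting of monomial ideals.\<close>

definition restrict_supp :: "'m set \<Rightarrow> 'a \<Rightarrow> 'a" where
  "restrict_supp S a = (SOME b. b \<in> carrier R \<and> (\<forall>z. co b z = (if z \<in> S then co a z else 0)))"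

lemma restrict_supp:
  assumes "a \<in> carrier R"
  shows "restrict_supp S a \<in> carrier R" "co (restrict_supp S a) z = (if z \<in> S then co a z else 0)"
proof -
  have "finite {z. (if z \<in> S then co a z else 0) \<noteq> 0}"
    by (rule finite_subset[OF _ co_supp(1)[OF assms]]) auto
  then obtain b where b: "b \<in> carrier R" "\<And>z. co b z = (if z \<in> S then co a z else 0)"
    using co_supp(2)[OF assms] by (rule ex_co) (auto split: if_splits)
  then have "\<exists>b. b \<in> carrier R \<and> (\<forall>z. co b z = (if z \<in> S then co a z else 0))" by blast
  from someI_ex[OF this]
  show "restrict_supp S a \<in> carrier R" "co (restrict_supp S a) z = (if z \<in> S then co a z else 0)"
    by (simp_all add: restrict_supp_def)
qed

sublocale projection_graded_ring R A "\<lambda>n. restrict_supp {z. deg z = n}"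
proof (intro projection_graded_ring.intro graded_projections.intro projection_graded_ring_axioms.intro
    graded_projections_axioms.intro ring_axioms abelian_group_axioms)
  fix n
  show "additive_subgroup (A n) R"
  proof (intro additive_subgroupI add.subgroupI)
    have "\<zero> \<in> A n" by (simp add: A_eq)
    then show "A n \<noteq> {}" by blast
  next
    fix a b assume "a \<in> A n" "b \<in> A n"
    then show "a \<oplus> b \<in> A n" by (force simp: A_eq co_add)
  qed (auto simp: A_eq co_minus a_inv_def[symmetric])
next
  fix x n m assume "x \<in> A n" "m \<noteq> n"
  then show "restrict_supp {z. deg z = m} x = \<zero>"
    by (intro co_eqI) (auto simp: A_eq restrict_supp)
next
  fix x n assume "x \<in> A n"
  then show "restrict_supp {z. deg z = n} x = x"
    by (intro co_eqI) (auto simp: A_eq restrict_supp)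
next
  fix x assume x: "x \<in> carrier R"
  let ?p = "\<lambda>n. restrict_supp {z. deg z = n} x"
  have zero: "?p n = \<zero>" if "n \<notin> deg ` {z. co x z \<noteq> 0}" for n
    using that x by (intro co_eqI) (auto simp: restrict_supp)
  show fin: "finite {n. ?p n \<noteq> \<zero>}"
    by (rule finite_subset[of _ "deg ` {z. co x z \<noteq> 0}"]) (use zero x co_supp(1) in auto)
  show "x = (\<Oplus>n\<in>{n. ?p n \<noteq> \<zero>}. ?p n)"
  proof (rule co_eqI)
    fix z
    have "co x z = co (?p (deg z)) z" using x by (simp add: restrict_supp)
    also have "\<dots> = (\<Sum>n\<in>{n. ?p n \<noteq> \<zero>}. if n = deg z then co (?p n) z else 0)"
      using fin by (auto simp: sum.delta)
    also have "\<dots> = (\<Sum>n\<in>{n. ?p n \<noteq> \<zero>}. co (?p n) z)"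
      using x by (intro sum.cong) (auto simp: restrict_supp)
    finally show "co x z = co (\<Oplus>n\<in>{n. ?p n \<noteq> \<zero>}. ?p n) z"
      using fin x by (simp add: co_finsum restrict_supp)
  qed (use x fin restrict_supp in auto)
next
  fix a b m n assume "a \<in> A m" "b \<in> A n"
  then show "a \<otimes> b \<in> A (m + n)"
    using co_mult[of a b] by (fastforce simp: A_eq)
qed (auto simp: A_eq restrict_supp co_add co_one intro!: co_eqI)

text \<open>With pointwise multiplication, an ideal is determined by the set of coordinates at which
  some member is nonzero. The coordinates of \<open>r\<close> are cancelled one at a time by members
  of \<open>U\<close>, by induction on the size of the support.\<close>

lemma degree_zero_left_ideal_eq:
  assumes U: "U \<subseteq> A 0" "\<zero> \<in> U" "\<And>u v. u \<in> U \<Longrightarrow> v \<in> U \<Longrightarrow> u \<oplus> v \<in> U"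
    "\<And>a u. a \<in> A 0 \<Longrightarrow> u \<in> U \<Longrightarrow> a \<otimes> u \<in> U"
    and r: "r \<in> A 0" "\<And>z. co r z \<noteq> 0 \<Longrightarrow> \<exists>u\<in>U. co u z \<noteq> 0"
  shows "r \<in> U"
  using r
proof (induction "card {z. co r z \<noteq> 0}" arbitrary: r rule: less_induct)
  case less
  have rc: "r \<in> carrier R" using less.prems D_closed by blast
  show ?case
  proof (cases "\<exists>z. co r z \<noteq> 0")
    case True
    then obtain z u where z: "co r z \<noteq> 0" "u \<in> U" "co u z \<noteq> 0" using less.prems(2) by blast
    have u: "u \<in> A 0" "u \<in> carrier R" using z(2) U(1) D_closed by auto
    \<comment> \<open>Supported at \<open>z\<close> alone and scaled so that
      \<open>a \<otimes> u\<close> has the same coordinate at \<open>z\<close> as \<open>r\<close>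
      and no other.\<close>
    obtain a where a: "a \<in> carrier R" "\<And>w. co a w = (if w = z then co r z / co u z else 0)"
      using co_supp(2)[OF rc z(1)] by (rule_tac ex_co[of "\<lambda>w. if w = z then co r z / co u z else 0"]) (auto split: if_splits)
    have a0: "a \<in> A 0" using a less.prems(1) z(1) by (auto simp: A_eq)
    have au: "a \<otimes> u \<in> carrier R" "a \<otimes> u \<in> U" "a \<otimes> u \<in> A 0"
      using a u U(4)[OF a0 z(2)] U(1) by auto
    let ?r = "r \<oplus> \<ominus> (a \<otimes> u)"
    have co_r: "co ?r w = (if w = z then 0 else co r w)" for w
      using rc au a(2) z co_mult_A0[OF a0 u(1), of w] by (simp add: co_add co_minus)
    have r0: "?r \<in> A 0" using rc au co_r less.prems(1) by (auto simp: A_eq)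
    have "card {w. co ?r w \<noteq> 0} < card {w. co r w \<noteq> 0}"
      by (rule psubset_card_mono[OF co_supp(1)[OF rc]]) (use z(1) co_r in auto)
    then have "?r \<in> U"
      using r0 co_r less.prems(2) by (intro less.hyps) (auto split: if_splits)
    then have "?r \<oplus> (a \<otimes> u) \<in> U" using au(2) U(3) by blast
    then show ?thesis using rc au(1) by (simp add: a_assoc l_neg)
  next
    case False
    then have "r = \<zero>" using rc by (intro co_eqI) auto
    then show ?thesis using U(2) by simp
  qed
qed

lemma degree_zero_subring: "subring (A 0) R"
  using mult_A[of _ 0 _ 0] additive_subgroup.a_closed[OF subgroup_D]
    additive_subgroup.a_inv_closed[OF subgroup_D]
  by (intro subringI) (auto simp: one_A D_closed)

lemma degree_zero_semisimple: "semisimple_ring (R\<lparr>carrier := A 0\<rparr>)"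
proof -
  let ?S = "R\<lparr>carrier := A 0\<rparr>"
  let ?M = "regular_module ?S"
  have ring_S: "ring ?S" by (rule subring_is_ring[OF degree_zero_subring])
  interpret M: left_module ?S ?M by (rule regular_left_module[OF ring_S])
  have M: "carrier ?M = A 0" "\<And>a b. a \<oplus>\<^bsub>?M\<^esub> b = a \<oplus> b" "\<And>a b. a \<odot>\<^bsub>?M\<^esub> b = a \<otimes> b" "\<zero>\<^bsub>?M\<^esub> = \<zero>"
    by (simp_all add: regular_module_def)
  have minus_M: "\<ominus>\<^bsub>?M\<^esub> a = \<ominus> a" if "a \<in> A 0" for a
    by (rule M.M.minus_equality)
      (use that D_closed additive_subgroup.a_inv_closed[OF subgroup_D that] in \<open>auto simp: M l_neg\<close>)
  have "\<exists>V. submodule V ?S ?M \<and> U \<inter> V = {\<zero>\<^bsub>?M\<^esub>} \<and> U <+>\<^bsub>?M\<^esub> V = carrier ?M"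
    if "submodule U ?S ?M" for U
  proof -
    interpret U: submodule U ?S ?M by fact
    have U: "U \<subseteq> A 0" "\<zero> \<in> U" "\<And>u v. u \<in> U \<Longrightarrow> v \<in> U \<Longrightarrow> u \<oplus> v \<in> U"
      "\<And>a u. a \<in> A 0 \<Longrightarrow> u \<in> U \<Longrightarrow> a \<otimes> u \<in> U"
      using U.subset U.one_closed U.m_closed U.smult_closed by (auto simp: M)
    \<comment> \<open>\<open>Z\<close> is the set of coordinates on which \<open>U\<close> lives;
      the complement consists of the elements that vanish there.\<close>
    define Z where "Z = {z. \<exists>u\<in>U. co u z \<noteq> 0}"
    define V where "V = {r \<in> A 0. \<forall>z\<in>Z. co r z = 0}"
    have cl: "\<And>a. a \<in> A 0 \<Longrightarrow> a \<in> carrier R" by (rule D_closed)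
    note sub = additive_subgroup.a_closed[OF subgroup_D] additive_subgroup.a_inv_closed[OF subgroup_D]
    have "subgroup V (add_monoid ?M)"
      by (rule M.M.add.subgroupI)
        (auto simp: V_def M minus_M a_inv_def[symmetric] cl co_add co_minus zero_D sub intro: exI[of _ \<zero>])
    then have "submodule V ?S ?M"
      using mult_A[of _ 0 _ 0]
      by (intro submodule.intro submodule_axioms.intro) (auto simp: V_def M co_mult_A0)
    moreover have "U \<inter> V = {\<zero>}"
    proof (intro equalityI subsetI)
      fix u assume "u \<in> U \<inter> V"
      then have "co u z = 0" "u \<in> A 0" for z by (auto simp: V_def Z_def)
      then show "u \<in> {\<zero>}" using co_eqI[of u \<zero>] cl by auto
    qed (use U(2) zero_D in \<open>auto simp: V_def\<close>)
    moreover have "U <+>\<^bsub>?M\<^esub> V = A 0"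
    proof (intro equalityI subsetI)
      fix r assume "r \<in> U <+>\<^bsub>?M\<^esub> V"
      then show "r \<in> A 0"
        using U(1) sub(1) by (auto simp: set_add_def' M V_def)
    next
      fix r assume r: "r \<in> A 0"
      have part: "restrict_supp S r \<in> A 0" for S
        using r by (auto simp: A_eq restrict_supp split: if_splits)
      have "restrict_supp Z r \<in> U"
        by (rule degree_zero_left_ideal_eq[OF U part]) (use r cl in \<open>auto simp: restrict_supp Z_def split: if_splits\<close>)
      moreover have "restrict_supp (- Z) r \<in> V"
        using part r cl by (auto simp: V_def restrict_supp)
      moreover have "r = restrict_supp Z r \<oplus> restrict_supp (- Z) r"
        by (rule co_eqI) (use r cl restrict_supp in \<open>auto simp: co_add\<close>)
      ultimately show "r \<in> U <+>\<^bsub>?M\<^esub> V"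
        unfolding set_add_def' M by blast
    qed
    ultimately show ?thesis unfolding M by blast
  qed
  then show ?thesis
    using ring_S M.left_module_axioms by (simp add: semisimple_ring_def semisimple_module_def)
qed

end

text \<open>Right multiplication by \<open>x j\<close> maps basis elements injectively to basis elements, so the left ideals generated by
  initial segments of the \<open>x j\<close> are spanned by basis elements and their colon ideals are combinatorial.\<close>

locale monomial_flag = coordinate_ring R A co E deg
  for R :: "('a, 'c) ring_scheme" (structure) and A and co :: "'a \<Rightarrow> 'm \<Rightarrow> complex" and E deg +
  fixes k :: nat and x :: "nat \<Rightarrow> 'a" and \<rho> :: "nat \<Rightarrow> 'm \<Rightarrow> 'm" and \<sigma> :: "nat \<Rightarrow> nat"
  assumes x_closed: "j < k \<Longrightarrow> x j \<in> carrier R"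
    and \<rho>_inj: "j < k \<Longrightarrow> inj_on (\<rho> j) E"
    and \<rho>_deg: "j < k \<Longrightarrow> z \<in> E \<Longrightarrow> deg (\<rho> j z) = Suc (deg z)"
    and co_x: "j < k \<Longrightarrow> a \<in> carrier R \<Longrightarrow> z \<in> E \<Longrightarrow> co (a \<otimes> x j) (\<rho> j z) = co a z"
    and co_x_0: "j < k \<Longrightarrow> a \<in> carrier R \<Longrightarrow> w \<notin> \<rho> j ` E \<Longrightarrow> co (a \<otimes> x j) w = 0"
    and colon: "j < k \<Longrightarrow> z \<in> E \<Longrightarrow> \<rho> j z \<in> (\<Union>i<j. \<rho> i ` E) \<longleftrightarrow> z \<in> (\<Union>i<\<sigma> j. \<rho> i ` E)"
    and \<sigma>_le: "j < k \<Longrightarrow> \<sigma> j \<le> k"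
    and generated: "z \<in> E \<Longrightarrow> deg z > 0 \<Longrightarrow> z \<in> (\<Union>i<k. \<rho> i ` E)"
begin

definition monomial_ideal :: "nat \<Rightarrow> 'a set" where
  "monomial_ideal j = {a \<in> carrier R. \<forall>z. co a z \<noteq> 0 \<longrightarrow> z \<in> (\<Union>i<j. \<rho> i ` E)}"

lemma monomial_ideal_Suc:
  assumes j: "j < k"
  shows "monomial_ideal (Suc j) = {a \<oplus> r \<otimes> x j | a r. a \<in> monomial_ideal j \<and> r \<in> carrier R}"
proof (intro equalityI subsetI)
  fix b assume "b \<in> {a \<oplus> r \<otimes> x j | a r. a \<in> monomial_ideal j \<and> r \<in> carrier R}"
  then obtain a r where b: "b = a \<oplus> r \<otimes> x j" "a \<in> monomial_ideal j" "r \<in> carrier R" by blast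
  then have a: "a \<in> carrier R" by (simp add: monomial_ideal_def)
  have "z \<in> (\<Union>i<Suc j. \<rho> i ` E)" if "co b z \<noteq> 0" for z
  proof (cases "z \<in> \<rho> j ` E")
    case False
    then have "co a z \<noteq> 0"
      using that b(1,3) a x_closed[OF j] co_x_0[OF j b(3) False] by (simp add: co_add)
    then have "z \<in> (\<Union>i<j. \<rho> i ` E)" using b(2) by (simp add: monomial_ideal_def)
    then show ?thesis by (auto simp: lessThan_Suc)
  qed auto
  then show "b \<in> monomial_ideal (Suc j)"
    using a b x_closed[OF j] by (simp add: monomial_ideal_def)
next
  let ?E = "\<Union>i<j. \<rho> i ` E"
  fix b assume b: "b \<in> monomial_ideal (Suc j)"
  then have bc: "b \<in> carrier R" by (simp add: monomial_ideal_def)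
  \<comment> \<open>The coordinates of the cofactor of \<open>x j\<close>: those of \<open>b\<close>
    pulled back along \<open>\<rho> j\<close>. Basis elements also reached by an earlier index are
    excluded, since \<open>?a\<close> accounts for them.\<close>
  let ?h = "\<lambda>z. if z \<in> E \<and> \<rho> j z \<notin> ?E then co b (\<rho> j z) else 0"
  have "finite {z. ?h z \<noteq> 0}"
  proof (rule finite_imageD)
    show "finite (\<rho> j ` {z. ?h z \<noteq> 0})"
      by (rule finite_subset[OF _ co_supp(1)[OF bc]]) (auto split: if_splits)
    show "inj_on (\<rho> j) {z. ?h z \<noteq> 0}"
      by (rule inj_on_subset[OF \<rho>_inj[OF j]]) (auto split: if_splits)
  qed
  then obtain r where r: "r \<in> carrier R" "\<And>z. co r z = ?h z"
    by (rule ex_co) (auto split: if_splits)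
  let ?a = "restrict_supp ?E b"
  have "b = ?a \<oplus> r \<otimes> x j"
  proof (rule co_eqI)
    fix z
    show "co b z = co (?a \<oplus> r \<otimes> x j) z"
    proof (cases "z \<in> \<rho> j ` E")
      case True
      then obtain w where w: "w \<in> E" "z = \<rho> j w" by blast
      then show ?thesis
        using r bc x_closed[OF j] co_x[OF j r(1) w(1)] by (simp add: co_add restrict_supp)
    next
      case False
      have "co b z = (if z \<in> ?E then co b z else 0)"
        using b False by (auto simp: monomial_ideal_def lessThan_Suc)
      then show ?thesis
        using r bc x_closed[OF j] co_x_0[OF j r(1) False] by (simp add: co_add restrict_supp)
    qed
  qed (use bc r(1) x_closed[OF j] restrict_supp in auto)
  moreover have "?a \<in> monomial_ideal j"
    using bc by (simp add: monomial_ideal_def restrict_supp)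
  ultimately show "b \<in> {a \<oplus> r \<otimes> x j | a r. a \<in> monomial_ideal j \<and> r \<in> carrier R}"
    using r(1) by blast
qed

theorem koszul: "koszul R A"
proof -
  have "koszul_flag R A (\<lambda>n. restrict_supp {z. deg z = n}) k x monomial_ideal \<sigma>"
  proof (intro koszul_flag.intro koszul_flag_axioms.intro projection_graded_ring_axioms)
    fix j assume j: "j < k"
    have "deg w = 1" if "co (x j) w \<noteq> 0" for w
    proof -
      \<comment> \<open>Writing \<open>x j\<close> as \<open>\<one> \<otimes> x j\<close> shows that
        it is supported on images under \<open>\<rho> j\<close> of basis elements of degree
        zero.\<close>
      have w: "co (\<one> \<otimes> x j) w \<noteq> 0" using that x_closed[OF j] by simp
      then obtain z where z: "z \<in> E" "w = \<rho> j z"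
        using co_x_0[OF j one_closed, of w] by blast
      then have "co \<one> z \<noteq> 0" using w co_x[OF j one_closed z(1)] by simp
      then show ?thesis using z \<rho>_deg[OF j z(1)] co_one by simp
    qed
    then show "x j \<in> A 1" using x_closed[OF j] by (simp add: A_eq)
    show "monomial_ideal (Suc j) = {a \<oplus> r \<otimes> x j | a r. a \<in> monomial_ideal j \<and> r \<in> carrier R}"
      by (rule monomial_ideal_Suc[OF j])
    show "{r \<in> carrier R. r \<otimes> x j \<in> monomial_ideal j} = monomial_ideal (\<sigma> j)"
    proof (intro equalityI subsetI)
      fix r assume "r \<in> {r \<in> carrier R. r \<otimes> x j \<in> monomial_ideal j}"
      then have r: "r \<in> carrier R" "\<And>z. co (r \<otimes> x j) z \<noteq> 0 \<Longrightarrow> z \<in> (\<Union>i<j. \<rho> i ` E)"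
        by (auto simp: monomial_ideal_def)
      have "z \<in> (\<Union>i<\<sigma> j. \<rho> i ` E)" if "co r z \<noteq> 0" for z
        using that r(2)[of "\<rho> j z"] co_supp(2)[OF r(1) that] co_x[OF j r(1)] colon[OF j] by simp
      then show "r \<in> monomial_ideal (\<sigma> j)" using r(1) by (simp add: monomial_ideal_def)
    next
      fix r assume "r \<in> monomial_ideal (\<sigma> j)"
      then have r: "r \<in> carrier R" "\<And>z. co r z \<noteq> 0 \<Longrightarrow> z \<in> (\<Union>i<\<sigma> j. \<rho> i ` E)"
        by (auto simp: monomial_ideal_def)
      have "w \<in> (\<Union>i<j. \<rho> i ` E)" if w: "co (r \<otimes> x j) w \<noteq> 0" for w
      proof -
        obtain z where z: "z \<in> E" "w = \<rho> j z" using co_x_0[OF j r(1), of w] w by blast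
        then show ?thesis using r(2)[of z] w co_x[OF j r(1)] colon[OF j z(1)] by simp
      qed
      then show "r \<in> {r \<in> carrier R. r \<otimes> x j \<in> monomial_ideal j}"
        using r(1) x_closed[OF j] by (simp add: monomial_ideal_def)
    qed
    show "\<sigma> j \<le> k" by (rule \<sigma>_le[OF j])
  next
    show "monomial_ideal 0 = {\<zero>}"
      using co_eqI[of _ \<zero>] by (auto simp: monomial_ideal_def)
    have zero: "restrict_supp {z. deg z = 0} r = \<zero> \<longleftrightarrow> (\<forall>z. deg z = 0 \<longrightarrow> co r z = 0)"
      if r: "r \<in> carrier R" for r
    proof
      assume "restrict_supp {z. deg z = 0} r = \<zero>"
      then show "\<forall>z. deg z = 0 \<longrightarrow> co r z = 0"
        using restrict_supp(2)[OF r, of "{z. deg z = 0}"] by (metis co_zero mem_Collect_eq)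
    next
      assume "\<forall>z. deg z = 0 \<longrightarrow> co r z = 0"
      then show "restrict_supp {z. deg z = 0} r = \<zero>"
        by (intro co_eqI) (simp_all add: restrict_supp r)
    qed
    have gen: "z \<in> (\<Union>i<k. \<rho> i ` E) \<longleftrightarrow> deg z \<noteq> 0" if "z \<in> E" for z
      using generated[OF that] \<rho>_deg by auto
    show "monomial_ideal k = {r \<in> carrier R. restrict_supp {z. deg z = 0} r = \<zero>}"
      unfolding monomial_ideal_def
    proof (intro Collect_cong conj_cong refl)
      fix r assume r: "r \<in> carrier R"
      have "(co r z \<noteq> 0 \<longrightarrow> z \<in> (\<Union>i<k. \<rho> i ` E)) \<longleftrightarrow> (deg z = 0 \<longrightarrow> co r z = 0)" for z
        using gen[OF co_supp(2)[OF r, of z]] by blast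
      then show "(\<forall>z. co r z \<noteq> 0 \<longrightarrow> z \<in> (\<Union>i<k. \<rho> i ` E)) \<longleftrightarrow> restrict_supp {z. deg z = 0} r = \<zero>"
        unfolding zero[OF r] by (rule all_cong1)
    qed
  qed
  then show ?thesis
    by (rule koszul_flag.koszul) (rule degree_zero_semisimple)
qed

end

section \<open>Path algebras\<close>

text \<open>All identities in the path algebra are checked against arbitrary test functions \<open>\<psi>\<close>: pairing the
  product of \<open>f\<close> and \<open>g\<close> with \<open>\<psi>\<close> is an iterated pairing, which makes associativity immediate.\<close>

definition pairing :: "('p \<Rightarrow> complex) \<Rightarrow> ('p \<Rightarrow> complex) \<Rightarrow> complex" where
  "pairing f \<psi> = (\<Sum>x\<in>{x. f x \<noteq> 0}. f x * \<psi> x)"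

lemma pairing_superset:
  "finite S \<Longrightarrow> {x. f x \<noteq> 0} \<subseteq> S \<Longrightarrow> pairing f \<psi> = (\<Sum>x\<in>S. f x * \<psi> x)"
  unfolding pairing_def by (rule sum.mono_neutral_left) auto

lemma pairing_cong: "(\<And>x. f x \<noteq> 0 \<Longrightarrow> \<psi> x = \<psi>' x) \<Longrightarrow> pairing f \<psi> = pairing f \<psi>'"
  unfolding pairing_def by (rule sum.cong) auto

lemma pairing_nonzero: "pairing f \<psi> \<noteq> 0 \<Longrightarrow> \<exists>x. f x \<noteq> 0 \<and> \<psi> x \<noteq> 0"
  unfolding pairing_def by (metis (no_types, lifting) mem_Collect_eq mult_not_zero sum.not_neutral_contains_not_neutral)

lemma pairing_0_left [simp]: "pairing (\<lambda>x. 0) \<psi> = 0"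
  and pairing_0_right [simp]: "pairing f (\<lambda>x. 0) = 0"
  by (simp_all add: pairing_def)

lemma pairing_add_right: "pairing f (\<lambda>x. \<psi> x + \<psi>' x) = pairing f \<psi> + pairing f \<psi>'"
  unfolding pairing_def by (simp add: distrib_left sum.distrib)

lemma pairing_add_left:
  assumes "finite {x. f x \<noteq> 0}" "finite {x. g x \<noteq> 0}"
  shows "pairing (\<lambda>x. f x + g x) \<psi> = pairing f \<psi> + pairing g \<psi>"
proof -
  let ?S = "{x. f x \<noteq> 0} \<union> {x. g x \<noteq> 0}"
  have "pairing (\<lambda>x. f x + g x) \<psi> = (\<Sum>x\<in>?S. (f x + g x) * \<psi> x)"
    "pairing f \<psi> = (\<Sum>x\<in>?S. f x * \<psi> x)" "pairing g \<psi> = (\<Sum>x\<in>?S. g x * \<psi> x)"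
    using assms by (intro pairing_superset; auto)+
  then show ?thesis by (simp add: distrib_right sum.distrib)
qed

lemma pairing_minus_left: "pairing (\<lambda>x. - f x) \<psi> = - pairing f \<psi>"
  by (simp add: pairing_def sum_negf)

lemma pairing_delta:
  assumes "finite {x. f x \<noteq> 0}"
  shows "pairing f (\<lambda>x. if x = z then c else 0) = f z * c"
  using assms by (simp add: pairing_def if_distrib[of "\<lambda>t. _ * t"] sum.delta cong: if_cong)

text \<open>Sums coefficients over the fibres of \<open>\<kappa>\<close>. For \<kappa> =
  \<open>key\<close> these sums turn out to be the coordinates in the quotient algebra.\<close>

definition pushforward :: "('p \<Rightarrow> 'q) \<Rightarrow> ('p \<Rightarrow> complex) \<Rightarrow> 'q \<Rightarrow> complex" where
  "pushforward \<kappa> f z = pairing f (\<lambda>x. if \<kappa> x = z then 1 else 0)"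

lemma pushforward_nonzero: "pushforward \<kappa> f z \<noteq> 0 \<Longrightarrow> \<exists>x. f x \<noteq> 0 \<and> \<kappa> x = z"
  unfolding pushforward_def by (drule pairing_nonzero) (auto split: if_splits)

lemma pushforward_finite:
  assumes "finite {x. f x \<noteq> 0}"
  shows "finite {z. pushforward \<kappa> f z \<noteq> 0}"
  by (rule finite_subset[of _ "\<kappa> ` {x. f x \<noteq> 0}"]) (use assms pushforward_nonzero in fastforce)+

lemma pairing_pushforward:
  assumes "finite {x. f x \<noteq> 0}"
  shows "pairing (pushforward \<kappa> f) \<psi> = pairing f (\<lambda>x. \<psi> (\<kappa> x))"
proof -
  let ?S = "{x. f x \<noteq> 0}"
  have "pairing (pushforward \<kappa> f) \<psi> = (\<Sum>z\<in>\<kappa> ` ?S. pushforward \<kappa> f z * \<psi> z)"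
    using assms pushforward_nonzero by (intro pairing_superset) fastforce+
  also have "\<dots> = (\<Sum>z\<in>\<kappa> ` ?S. \<Sum>x\<in>?S. if \<kappa> x = z then f x * \<psi> (\<kappa> x) else 0)"
    unfolding pushforward_def pairing_def sum_distrib_right by (intro sum.cong refl) auto
  also have "\<dots> = (\<Sum>x\<in>?S. \<Sum>z\<in>\<kappa> ` ?S. if \<kappa> x = z then f x * \<psi> (\<kappa> x) else 0)"
    by (rule sum.swap)
  also have "\<dots> = (\<Sum>x\<in>?S. f x * \<psi> (\<kappa> x))"
    using assms by (intro sum.cong refl) (simp add: sum.delta')
  finally show ?thesis by (simp add: pairing_def)
qed

section \<open>The path algebra as a ring\<close>

lemma path_concat_simps [simp]:
  "path_source (path_concat x y) = path_source x"
  "path_target (path_concat x y) = path_target y"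
  "path_arrows (path_concat x y) = path_arrows x @ path_arrows y"
  by (simp_all add: path_concat_def)

lemma path_concat_trivial:
  "u = path_source x \<Longrightarrow> path_concat (u, [], u) x = x"
  "path_target x = u \<Longrightarrow> path_concat x (u, [], u) = x"
  by (cases x; simp add: path_concat_def)+

lemma path_concat_assoc: "path_concat (path_concat x y) z = path_concat x (path_concat y z)"
  by (simp add: path_concat_def)

lemma path_algebra_simps [simp]:
  "f \<in> carrier (path_algebra G) \<longleftrightarrow> finite {x. f x \<noteq> 0} \<and> {x. f x \<noteq> 0} \<subseteq> paths G"
  "f \<oplus>\<^bsub>path_algebra G\<^esub> g = (\<lambda>z. f z + g z)"
  "\<zero>\<^bsub>path_algebra G\<^esub> = (\<lambda>z. 0)"
  by (simp_all add: path_algebra_def path_supp_def)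

text \<open>The nested conditionals match \<open>pairing_mult\<close> with the indicator of
  \<open>z\<close> as test function, so the two rewrite rules compose.\<close>

lemma path_algebra_mult:
  assumes "finite {x. f x \<noteq> 0}" "finite {x. g x \<noteq> 0}"
  shows "(f \<otimes>\<^bsub>path_algebra G\<^esub> g) z = pairing f (\<lambda>x. pairing g (\<lambda>y.
    if path_target x = path_source y then (if path_concat x y = z then 1 else 0) else 0))"
proof -
  let ?F = "{x. f x \<noteq> 0}" and ?G = "{x. g x \<noteq> 0}"
  let ?C = "\<lambda>x y. path_target x = path_source y \<and> path_concat x y = z"
  have "(f \<otimes>\<^bsub>path_algebra G\<^esub> g) z = (\<Sum>(x, y)\<in>{(x, y) \<in> ?F \<times> ?G. ?C x y}. f x * g y)"
    by (simp add: path_algebra_def path_supp_def)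
  also have "\<dots> = (\<Sum>(x, y)\<in>?F \<times> ?G. if ?C x y then f x * g y else 0)"
    using assms by (intro sum.mono_neutral_cong_left) (auto split: if_splits)
  also have "\<dots> = (\<Sum>x\<in>?F. \<Sum>y\<in>?G. if ?C x y then f x * g y else 0)"
    by (simp add: sum.cartesian_product)
  also have "\<dots> = pairing f (\<lambda>x. pairing g (\<lambda>y.
    if path_target x = path_source y then (if path_concat x y = z then 1 else 0) else 0))"
    unfolding pairing_def sum_distrib_left by (intro sum.cong refl) auto
  finally show ?thesis .
qed

lemma path_algebra_mult_supp:
  assumes "finite {x. f x \<noteq> 0}" "finite {x. g x \<noteq> 0}" "(f \<otimes>\<^bsub>path_algebra G\<^esub> g) z \<noteq> 0"
  obtains x y where "f x \<noteq> 0" "g y \<noteq> 0" "path_target x = path_source y" "path_concat x y = z"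
proof -
  let ?\<psi> = "\<lambda>x y. if path_target x = path_source y then (if path_concat x y = z then 1 else 0) else 0 :: complex"
  obtain x where x: "f x \<noteq> 0" "pairing g (?\<psi> x) \<noteq> 0"
    using pairing_nonzero[OF assms(3)[unfolded path_algebra_mult[OF assms(1,2)]]] by blast
  obtain y where "g y \<noteq> 0" "?\<psi> x y \<noteq> 0"
    using pairing_nonzero[OF x(2)] by blast
  then show thesis using that x(1) by (auto split: if_splits)
qed

lemma path_algebra_mult_supp_subset:
  assumes "finite {x. f x \<noteq> 0}" "finite {x. g x \<noteq> 0}"
  shows "{z. (f \<otimes>\<^bsub>path_algebra G\<^esub> g) z \<noteq> 0}
    \<subseteq> (\<lambda>(x, y). path_concat x y) ` ({x. f x \<noteq> 0} \<times> {x. g x \<noteq> 0})"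
proof
  fix z assume "z \<in> {z. (f \<otimes>\<^bsub>path_algebra G\<^esub> g) z \<noteq> 0}"
  then have "(f \<otimes>\<^bsub>path_algebra G\<^esub> g) z \<noteq> 0" by simp
  from path_algebra_mult_supp[OF assms this] obtain x y where "f x \<noteq> 0" "g y \<noteq> 0" "path_concat x y = z" .
  then show "z \<in> (\<lambda>(x, y). path_concat x y) ` ({x. f x \<noteq> 0} \<times> {x. g x \<noteq> 0})"
    by (intro image_eqI[of _ _ "(x, y)"]) auto
qed

lemma path_algebra_mult_finite:
  assumes "finite {x. f x \<noteq> 0}" "finite {x. g x \<noteq> 0}"
  shows "finite {z. (f \<otimes>\<^bsub>path_algebra G\<^esub> g) z \<noteq> 0}"
  by (rule finite_subset[OF path_algebra_mult_supp_subset[OF assms]]) (use assms in simp)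

lemma pairing_mult:
  assumes "finite {x. f x \<noteq> 0}" "finite {x. g x \<noteq> 0}"
  shows "pairing (f \<otimes>\<^bsub>path_algebra G\<^esub> g) \<psi> = pairing f (\<lambda>x. pairing g (\<lambda>y.
    if path_target x = path_source y then \<psi> (path_concat x y) else 0))"
proof -
  let ?F = "{x. f x \<noteq> 0}" and ?G = "{x. g x \<noteq> 0}"
  let ?S = "(\<lambda>(x, y). path_concat x y) ` (?F \<times> ?G)"
  have S: "finite ?S" using assms by simp
  have "pairing (f \<otimes>\<^bsub>path_algebra G\<^esub> g) \<psi> = (\<Sum>z\<in>?S. (f \<otimes>\<^bsub>path_algebra G\<^esub> g) z * \<psi> z)"
    by (rule pairing_superset[OF S path_algebra_mult_supp_subset[OF assms]])
  also have "\<dots> = (\<Sum>z\<in>?S. \<Sum>x\<in>?F. \<Sum>y\<in>?G. if path_concat x y = z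
      then f x * (g y * (if path_target x = path_source y then \<psi> (path_concat x y) else 0)) else 0)"
    unfolding path_algebra_mult[OF assms] pairing_def sum_distrib_left sum_distrib_right
    by (intro sum.cong refl) auto
  also have "\<dots> = (\<Sum>x\<in>?F. \<Sum>y\<in>?G. \<Sum>z\<in>?S. if path_concat x y = z
      then f x * (g y * (if path_target x = path_source y then \<psi> (path_concat x y) else 0)) else 0)"
    by (rule trans[OF sum.swap sum.cong[OF refl sum.swap]])
  also have "\<dots> = (\<Sum>x\<in>?F. \<Sum>y\<in>?G. f x * (g y * (if path_target x = path_source y then \<psi> (path_concat x y) else 0)))"
    using S by (intro sum.cong refl) (auto simp: sum.delta' simp del: mult_eq_0_iff)
  finally show ?thesis
    unfolding pairing_def sum_distrib_left .
qed

lemma path_algebra_assoc: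
  assumes f: "finite {x. f x \<noteq> 0}" and g: "finite {x. g x \<noteq> 0}" and h: "finite {x. h x \<noteq> 0}"
  shows "(f \<otimes>\<^bsub>path_algebra G\<^esub> g) \<otimes>\<^bsub>path_algebra G\<^esub> h = f \<otimes>\<^bsub>path_algebra G\<^esub> (g \<otimes>\<^bsub>path_algebra G\<^esub> h)"
  by (rule ext, unfold path_algebra_mult[OF path_algebra_mult_finite[OF f g] h]
      path_algebra_mult[OF f path_algebra_mult_finite[OF g h]] pairing_mult[OF f g] pairing_mult[OF g h],
      intro pairing_cong) (auto simp: path_concat_assoc cong: if_cong)

context wf_digraph
begin

lemma paths_iff: "x \<in> paths G \<longleftrightarrow> awalk (path_source x) (path_arrows x) (path_target x)"
  by (cases x) (auto simp: paths_def)

lemma path_concat_in_paths: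
  "x \<in> paths G \<Longrightarrow> y \<in> paths G \<Longrightarrow> path_target x = path_source y \<Longrightarrow> path_concat x y \<in> paths G"
  by (simp add: paths_iff awalk_appendI)

lemma path_ends_in_verts: "x \<in> paths G \<Longrightarrow> path_source x \<in> verts G \<and> path_target x \<in> verts G"
  by (auto simp: paths_iff)

lemma one_path_algebra_supp: "{x. \<one>\<^bsub>path_algebra G\<^esub> x \<noteq> 0} = (\<lambda>u. (u, [], u)) ` verts G"
  by (auto simp: path_algebra_def)

lemma pairing_one: "pairing \<one>\<^bsub>path_algebra G\<^esub> \<psi> = (\<Sum>u\<in>verts G. \<psi> (u, [], u))"
  unfolding pairing_def one_path_algebra_supp
  by (subst sum.reindex) (auto simp: inj_on_def path_algebra_def)

text \<open>The unit is the sum of all trivial paths, which has finite support because there are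
  finitely many vertices.\<close>

lemma path_algebra_ring:
  assumes "finite (verts G)"
  shows "ring (path_algebra G)"
proof (rule ringI)
  show "abelian_group (path_algebra G)"
  proof (rule abelian_groupI)
    fix f g assume "f \<in> carrier (path_algebra G)" "g \<in> carrier (path_algebra G)"
    then have fg: "finite ({x. f x \<noteq> 0} \<union> {x. g x \<noteq> 0})" "{x. f x \<noteq> 0} \<union> {x. g x \<noteq> 0} \<subseteq> paths G"
      by auto
    have sub: "{x. f x + g x \<noteq> 0} \<subseteq> {x. f x \<noteq> 0} \<union> {x. g x \<noteq> 0}" by auto
    show "f \<oplus>\<^bsub>path_algebra G\<^esub> g \<in> carrier (path_algebra G)"
      using finite_subset[OF sub fg(1)] order_trans[OF sub fg(2)] by simp
  next
    fix f assume "f \<in> carrier (path_algebra G)"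
    then show "\<exists>g\<in>carrier (path_algebra G). g \<oplus>\<^bsub>path_algebra G\<^esub> f = \<zero>\<^bsub>path_algebra G\<^esub>"
      by (intro bexI[of _ "\<lambda>x. - f x"]) auto
  qed (auto simp: add_ac)
  show "Group.monoid (path_algebra G)"
  proof (rule monoidI)
    fix f g assume f: "f \<in> carrier (path_algebra G)" and g: "g \<in> carrier (path_algebra G)"
    then have fin: "finite {x. f x \<noteq> 0}" "finite {x. g x \<noteq> 0}" by auto
    have "z \<in> paths G" if z: "(f \<otimes>\<^bsub>path_algebra G\<^esub> g) z \<noteq> 0" for z
    proof -
      from path_algebra_mult_supp[OF fin z] obtain x y where "f x \<noteq> 0" "g y \<noteq> 0"
        "path_target x = path_source y" "path_concat x y = z" .
      then show ?thesis using f g path_concat_in_paths[of x y] by auto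
    qed
    then show "f \<otimes>\<^bsub>path_algebra G\<^esub> g \<in> carrier (path_algebra G)"
      using path_algebra_mult_finite[OF fin] by auto
  next
    show "\<one>\<^bsub>path_algebra G\<^esub> \<in> carrier (path_algebra G)"
      using assms by (auto simp: one_path_algebra_supp paths_iff awalk_Nil_iff)
  next
    fix f assume f: "f \<in> carrier (path_algebra G)"
    have one: "finite {x. \<one>\<^bsub>path_algebra G\<^esub> x \<noteq> 0}"
      using assms by (simp add: one_path_algebra_supp)
    have fin: "finite {x. f x \<noteq> 0}" using f by simp
    have ends: "path_source x \<in> verts G" "path_target x \<in> verts G" if "f x \<noteq> 0" for x
      using that f path_ends_in_verts[of x] unfolding path_algebra_simps by blast+
    show "\<one>\<^bsub>path_algebra G\<^esub> \<otimes>\<^bsub>path_algebra G\<^esub> f = f"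
    proof
      fix z
      have "(\<one>\<^bsub>path_algebra G\<^esub> \<otimes>\<^bsub>path_algebra G\<^esub> f) z
        = (\<Sum>u\<in>verts G. \<Sum>x\<in>{x. f x \<noteq> 0}. if u = path_source x then (if x = z then f x else 0) else 0)"
        unfolding path_algebra_mult[OF one fin] pairing_one unfolding pairing_def
        by (intro sum.cong refl) (simp add: path_concat_trivial cong: if_cong)
      also have "\<dots> = (\<Sum>x\<in>{x. f x \<noteq> 0}. if x = z then f x else 0)"
        using assms ends by (subst sum.swap) (auto intro!: sum.cong simp: sum.delta)
      also have "\<dots> = f z" using fin by (auto simp: sum.delta)
      finally show "(\<one>\<^bsub>path_algebra G\<^esub> \<otimes>\<^bsub>path_algebra G\<^esub> f) z = f z" .
    qed
    show "f \<otimes>\<^bsub>path_algebra G\<^esub> \<one>\<^bsub>path_algebra G\<^esub> = f"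
    proof
      fix z
      have "(f \<otimes>\<^bsub>path_algebra G\<^esub> \<one>\<^bsub>path_algebra G\<^esub>) z
        = (\<Sum>x\<in>{x. f x \<noteq> 0}. f x * (\<Sum>u\<in>verts G. if path_target x = u then (if x = z then 1 else 0) else 0))"
        unfolding path_algebra_mult[OF fin one] pairing_one unfolding pairing_def
        by (intro sum.cong refl arg_cong2[where f = "(*)"]) (simp add: path_concat_trivial cong: if_cong)
      also have "\<dots> = (\<Sum>x\<in>{x. f x \<noteq> 0}. if x = z then f x else 0)"
        using assms ends by (auto intro!: sum.cong simp: sum.delta')
      also have "\<dots> = f z" using fin by (auto simp: sum.delta)
      finally show "(f \<otimes>\<^bsub>path_algebra G\<^esub> \<one>\<^bsub>path_algebra G\<^esub>) z = f z" .
    qed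
  qed (simp add: path_algebra_assoc)
next
  fix f g h
  assume "f \<in> carrier (path_algebra G)" "g \<in> carrier (path_algebra G)" "h \<in> carrier (path_algebra G)"
  then have fin: "finite {x. f x \<noteq> 0}" "finite {x. g x \<noteq> 0}" "finite {x. h x \<noteq> 0}"
    by auto
  have add: "finite {x. f x + g x \<noteq> 0}"
    by (rule finite_subset[OF _ finite_UnI[OF fin(1,2)]]) auto
  show "(f \<oplus>\<^bsub>path_algebra G\<^esub> g) \<otimes>\<^bsub>path_algebra G\<^esub> h
    = f \<otimes>\<^bsub>path_algebra G\<^esub> h \<oplus>\<^bsub>path_algebra G\<^esub> g \<otimes>\<^bsub>path_algebra G\<^esub> h"
    by (rule ext) (simp add: path_algebra_mult fin add pairing_add_left)
  show "h \<otimes>\<^bsub>path_algebra G\<^esub> (f \<oplus>\<^bsub>path_algebra G\<^esub> g)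
    = h \<otimes>\<^bsub>path_algebra G\<^esub> f \<oplus>\<^bsub>path_algebra G\<^esub> h \<otimes>\<^bsub>path_algebra G\<^esub> g"
    by (rule ext) (simp add: path_algebra_mult fin add pairing_add_left pairing_add_right)
qed

end

section \<open>Quotients of path algebras by congruences of paths\<close>

text \<open>The class of a path is recorded by its ends and a weight, which is the multiset of colors for \<open>A\<close> and
  the length for \<open>B\<close>.\<close>

type_synonym ('v, 'w) key = "'v \<times> 'v \<times> 'w"

text \<open>Right cancellation of weights is what makes appending a color injective on classes
  (\<open>step_inj\<close>). A neutral element is not demanded: \<open>\<mu> []\<close> acts as one
  on the weights of paths.\<close>

locale weighted_quiver = wf_digraph G for G :: "('v, 'e) pre_digraph" +
  fixes \<mu> :: "'e list \<Rightarrow> 'w :: cancel_semigroup_add" and wlen :: "'w \<Rightarrow> nat"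
    and rel :: "('v, 'e) path \<Rightarrow> ('v, 'e) path \<Rightarrow> bool"
  assumes finite_verts: "finite (verts G)"
    and \<mu>_append: "\<mu> (p @ q) = \<mu> p + \<mu> q"
    and wlen_\<mu>: "wlen (\<mu> p) = length p"
    and rel_iff: "rel x y \<longleftrightarrow> \<mu> (path_arrows x) = \<mu> (path_arrows y)"
begin

abbreviation PA :: "(('v, 'e) path \<Rightarrow> complex) ring" where "PA \<equiv> path_algebra G"

abbreviation J :: "(('v, 'e) path \<Rightarrow> complex) set" where "J \<equiv> path_ideal G rel"

definition key :: "('v, 'e) path \<Rightarrow> ('v, 'w) key" where
  "key x = (path_source x, path_target x, \<mu> (path_arrows x))"

abbreviation key_len :: "('v, 'w) key \<Rightarrow> nat" where "key_len z \<equiv> wlen (snd (snd z))"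

definition key_mult :: "('v, 'w) key \<Rightarrow> ('v, 'w) key \<Rightarrow> ('v, 'w) key" where
  "key_mult a b = (fst a, fst (snd b), snd (snd a) + snd (snd b))"

lemma key_len [simp]: "key_len (key x) = path_length x"
  by (simp add: key_def wlen_\<mu>)

lemma key_concat: "key (path_concat x y) = key_mult (key x) (key y)"
  by (simp add: key_def key_mult_def \<mu>_append)

sublocale PA: ring PA
  by (rule path_algebra_ring[OF finite_verts])

lemma PA_minus: "f \<in> carrier PA \<Longrightarrow> \<ominus>\<^bsub>PA\<^esub> f = (\<lambda>x. - f x)"
  by (rule PA.minus_equality) auto

lemma pushforward_mult:
  assumes "f \<in> carrier PA" "g \<in> carrier PA"
  shows "pushforward key (f \<otimes>\<^bsub>PA\<^esub> g) z = pairing (pushforward key f) (\<lambda>a. pairing (pushforward key g)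
    (\<lambda>b. if fst (snd a) = fst b then (if key_mult a b = z then 1 else 0) else 0))"
proof -
  have fin: "finite {x. f x \<noteq> 0}" "finite {x. g x \<noteq> 0}" using assms by auto
  show ?thesis
    unfolding pushforward_def[of key "f \<otimes>\<^bsub>PA\<^esub> g"] pairing_mult[OF fin]
      pairing_pushforward[OF fin(1)] pairing_pushforward[OF fin(2)]
    by (intro pairing_cong) (simp add: key_concat, simp add: key_def)
qed

lemma pushforward_add:
  "f \<in> carrier PA \<Longrightarrow> g \<in> carrier PA \<Longrightarrow>
    pushforward key (f \<oplus>\<^bsub>PA\<^esub> g) z = pushforward key f z + pushforward key g z"
  by (simp add: pushforward_def pairing_add_left)

lemma pushforward_minus:
  "f \<in> carrier PA \<Longrightarrow> pushforward key (\<ominus>\<^bsub>PA\<^esub> f) z = - pushforward key f z"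
  by (simp add: pushforward_def PA_minus pairing_minus_left)

lemma pushforward_zero: "pushforward key (\<lambda>x. 0) = (\<lambda>z. 0)"
  by (simp add: pushforward_def fun_eq_iff)

lemma pushforward_in_keys: "f \<in> carrier PA \<Longrightarrow> pushforward key f z \<noteq> 0 \<Longrightarrow> z \<in> key ` paths G"
  by (drule pushforward_nonzero) auto

definition relators :: "(('v, 'e) path \<Rightarrow> complex) set" where
  "relators = {path_basis x \<ominus>\<^bsub>PA\<^esub> path_basis y | x y. x \<in> paths G \<and> y \<in> paths G \<and> key x = key y}"

lemma path_ideal_eq: "J = Idl\<^bsub>PA\<^esub> relators"
proof -
  have "path_source x = path_source y \<and> path_target x = path_target y \<and> rel x y \<longleftrightarrow> key x = key y" for x y
    by (auto simp: key_def rel_iff)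
  then show ?thesis by (simp add: path_ideal_def relators_def)
qed

lemma basis_supp: "{z. path_basis x z \<noteq> 0} = {x}"
  by (auto simp: path_basis_def)

lemma basis_closed: "x \<in> paths G \<Longrightarrow> path_basis x \<in> carrier PA"
  by (simp add: basis_supp)

lemma basis_diff: "x \<in> paths G \<Longrightarrow> y \<in> paths G \<Longrightarrow>
  path_basis x \<ominus>\<^bsub>PA\<^esub> path_basis y = (\<lambda>z. path_basis x z - path_basis y z)"
  using PA_minus[OF basis_closed[of y]] by (simp add: a_minus_def)

lemma relators_closed: "relators \<subseteq> carrier PA"
  using basis_closed PA.minus_closed unfolding relators_def by blast

lemma ideal_J: "ideal J PA"
  unfolding path_ideal_eq by (rule PA.genideal_ideal[OF relators_closed])

lemma relator_in_J:
  assumes "x \<in> paths G" "y \<in> paths G" "key x = key y"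
  shows "(\<lambda>z. path_basis x z - path_basis y z) \<in> J"
proof -
  have "path_basis x \<ominus>\<^bsub>PA\<^esub> path_basis y \<in> relators"
    unfolding relators_def using assms by blast
  then show ?thesis
    using subsetD[OF PA.genideal_self[OF relators_closed]] basis_diff[OF assms(1,2)]
    by (simp add: path_ideal_eq)
qed

definition rep :: "('v, 'w) key \<Rightarrow> ('v, 'e) path" where
  "rep z = (SOME x. x \<in> paths G \<and> key x = z)"

lemma rep: "z \<in> key ` paths G \<Longrightarrow> rep z \<in> paths G \<and> key (rep z) = z"
  unfolding rep_def by (rule someI_ex) auto

text \<open>A ring ideal is not closed under scalars by definition. Here the scalar is supplied by
  left multiplication with \<open>c\<close> times the trivial path at the common source.\<close>

lemma scaled_relator_in_J:
  assumes x: "x \<in> paths G" and y: "y \<in> paths G" and k: "key x = key y"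
  shows "(\<lambda>z. c * (path_basis x z - path_basis y z)) \<in> J"
proof -
  interpret J: ideal J PA by (rule ideal_J)
  let ?d = "\<lambda>z. path_basis x z - path_basis y z"
  let ?e = "\<lambda>z. if z = (path_source x, [], path_source x) then c else 0"
  have src: "path_source y = path_source x" using k by (simp add: key_def)
  have e_supp: "{z. ?e z \<noteq> 0} \<subseteq> {(path_source x, [], path_source x)}" by auto
  have e: "?e \<in> carrier PA"
    using finite_subset[OF e_supp] e_supp x path_ends_in_verts[OF x] by (auto simp: paths_iff awalk_Nil_iff)
  have d: "?d \<in> J" by (rule relator_in_J[OF x y k])
  then have dc: "?d \<in> carrier PA" by (rule J.a_Hcarr)
  have fin: "finite {z. ?e z \<noteq> 0}" "finite {z. ?d z \<noteq> 0}" using e dc by auto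
  have d_src: "path_source w = path_source x" if "?d w \<noteq> 0" for w
    using that src by (auto simp: path_basis_def split: if_splits)
  have "?e \<otimes>\<^bsub>PA\<^esub> ?d = (\<lambda>z. c * ?d z)"
  proof
    fix z
    have "(?e \<otimes>\<^bsub>PA\<^esub> ?d) z = (\<Sum>w\<in>{(path_source x, [], path_source x)}. ?e w * pairing ?d (\<lambda>v.
      if path_target w = path_source v then (if path_concat w v = z then 1 else 0) else 0))"
      unfolding path_algebra_mult[OF fin] by (rule pairing_superset) (use e_supp in auto)
    also have "\<dots> = c * pairing ?d (\<lambda>v. if path_source x = path_source v
      then (if path_concat (path_source x, [], path_source x) v = z then 1 else 0) else 0)"
      by simp
    also have "pairing ?d (\<lambda>v. if path_source x = path_source v
      then (if path_concat (path_source x, [], path_source x) v = z then 1 else 0) else 0)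
      = pairing ?d (\<lambda>v. if v = z then 1 else 0)"
    proof (rule pairing_cong)
      fix v assume "?d v \<noteq> 0"
      then have "path_source v = path_source x" by (rule d_src)
      then show "(if path_source x = path_source v
        then (if path_concat (path_source x, [], path_source x) v = z then 1 else 0) else 0)
        = (if v = z then 1 else 0 :: complex)"
        by (simp add: path_concat_trivial(1))
    qed
    finally show "(?e \<otimes>\<^bsub>PA\<^esub> ?d) z = c * ?d z"
      using fin(2) by (simp add: pairing_delta)
  qed
  then show ?thesis using J.I_l_closed[OF d e] by simp
qed

lemma pushforward_basis: "pushforward key (path_basis x) z = (if key x = z then 1 else 0)"
  unfolding pushforward_def by (subst pairing_superset[of "{x}"]) (auto simp: path_basis_def)

text \<open>By \<open>pushforward_mult\<close> the fibre sums of a product depend only on the fibre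
  sums of the factors.\<close>

lemma pushforward_kernel_ideal: "ideal {f \<in> carrier PA. \<forall>z. pushforward key f z = 0} PA" (is "ideal ?K PA")
proof (rule idealI)
  show "subgroup ?K (add_monoid PA)"
  proof (intro PA.add.subgroupI)
    have "(\<lambda>x. 0) \<in> ?K" by (simp add: pushforward_zero)
    then show "?K \<noteq> {}" by blast
  next
    fix f assume "f \<in> ?K"
    then show "\<ominus>\<^bsub>PA\<^esub> f \<in> ?K"
      using PA.a_inv_closed[of f]
      by (simp add: pushforward_minus del: path_algebra_simps)
  next
    fix f g assume "f \<in> ?K" "g \<in> ?K"
    then show "f \<oplus>\<^bsub>PA\<^esub> g \<in> ?K"
      using PA.a_closed[of f g] by (simp add: pushforward_add del: path_algebra_simps)
  qed blast
  fix f g assume "f \<in> ?K" "g \<in> carrier PA"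
  moreover from this have "pushforward key f = (\<lambda>z. 0)" by auto
  ultimately show "g \<otimes>\<^bsub>PA\<^esub> f \<in> ?K" "f \<otimes>\<^bsub>PA\<^esub> g \<in> ?K"
    using PA.m_closed[of f g] PA.m_closed[of g f]
    by (simp_all add: pushforward_mult del: path_algebra_simps)
qed (rule PA.ring_axioms)

text \<open>One inclusion is minimality of the generated ideal. For the other, replace every path of
  \<open>f\<close> by the representative of its class: the change lies in \<open>J\<close>, and what
  remains has the fibre sums of \<open>f\<close> as coefficients, so it is zero.\<close>

lemma path_ideal_iff: "f \<in> J \<longleftrightarrow> f \<in> carrier PA \<and> (\<forall>z. pushforward key f z = 0)"
proof
  let ?K = "{f \<in> carrier PA. \<forall>z. pushforward key f z = 0}"
  have "relators \<subseteq> ?K"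
  proof
    fix d assume "d \<in> relators"
    then obtain x y where xy: "x \<in> paths G" "y \<in> paths G" "key x = key y"
      "d = path_basis x \<ominus>\<^bsub>PA\<^esub> path_basis y"
      by (auto simp: relators_def)
    then show "d \<in> ?K"
      using basis_closed[OF xy(1)] basis_closed[OF xy(2)]
      by (simp add: a_minus_def pushforward_add pushforward_minus pushforward_basis
          PA.a_inv_closed PA.a_closed del: path_algebra_simps)
  qed
  then have "J \<subseteq> ?K"
    unfolding path_ideal_eq by (rule PA.genideal_minimal[OF pushforward_kernel_ideal])
  then show "f \<in> J \<Longrightarrow> f \<in> carrier PA \<and> (\<forall>z. pushforward key f z = 0)" by blast
next
  interpret J: ideal J PA by (rule ideal_J)
  assume f: "f \<in> carrier PA \<and> (\<forall>z. pushforward key f z = 0)"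
  let ?S = "{x. f x \<noteq> 0}"
  let ?d = "\<lambda>F y. \<Sum>x\<in>F. f x * (path_basis x y - path_basis (rep (key x)) y)"
  have "?d F \<in> J" if "finite F" "F \<subseteq> paths G" for F
    using that
  proof (induction F rule: finite_induct)
    case empty
    then show ?case using J.zero_closed by simp
  next
    case (insert x F)
    then have "key x \<in> key ` paths G" "x \<in> paths G" by auto
    then have "(\<lambda>y. f x * (path_basis x y - path_basis (rep (key x)) y)) \<in> J"
      using rep[of "key x"] by (intro scaled_relator_in_J) auto
    from J.a_closed[OF this insert.IH] show ?case using insert by simp
  qed
  then have "?d ?S \<in> J" using f by simp
  moreover have "?d ?S y = f y" for y
  proof -
    have fin: "finite ?S" using f by simp
    have "?d ?S y = pairing f (\<lambda>x. if x = y then 1 else 0) - pairing f (\<lambda>x. if rep (key x) = y then 1 else 0)"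
      unfolding pairing_def sum_subtractf[symmetric]
      by (intro sum.cong refl) (auto simp: path_basis_def)
    also have "pairing f (\<lambda>x. if rep (key x) = y then 1 else 0)
      = pairing (pushforward key f) (\<lambda>z. if rep z = y then 1 else 0)"
      by (rule pairing_pushforward[OF fin, symmetric])
    also have "pushforward key f = (\<lambda>z. 0)" using f by blast
    also have "pairing (\<lambda>z. 0) (\<lambda>z. if rep z = y then 1 else 0) = 0" by simp
    finally show ?thesis using fin by (simp add: pairing_delta)
  qed
  ultimately show "f \<in> J" by simp
qed

section \<open>Coordinates on the quotient algebra\<close>

abbreviation Q :: "(('v, 'e) path \<Rightarrow> complex) set ring" where "Q \<equiv> path_quotient G rel"

abbreviation coset :: "(('v, 'e) path \<Rightarrow> complex) \<Rightarrow> (('v, 'e) path \<Rightarrow> complex) set" where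
  "coset f \<equiv> J +>\<^bsub>PA\<^esub> f"

lemma coset_eq_iff:
  assumes f: "f \<in> carrier PA" and g: "g \<in> carrier PA"
  shows "coset f = coset g \<longleftrightarrow> pushforward key f = pushforward key g"
proof -
  interpret J: ideal J PA by (rule ideal_J)
  have "coset f = coset g \<longleftrightarrow> f \<in> coset g"
    using J.a_rcos_self[OF f] J.a_repr_independence'[of f g] f g by auto
  also have "\<dots> \<longleftrightarrow> f \<ominus>\<^bsub>PA\<^esub> g \<in> J"
    by (rule J.a_rcos_module_minus[OF PA.ring_axioms g f])
  also have "\<dots> \<longleftrightarrow> pushforward key f = pushforward key g"
    using f g unfolding path_ideal_iff
    by (simp add: a_minus_def pushforward_add pushforward_minus PA.a_inv_closed PA.a_closed fun_eq_iff
        del: path_algebra_simps)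
  finally show ?thesis .
qed

text \<open>The choice of representative is harmless: by \<open>coset_eq_iff\<close> all of them
  have the same fibre sums.\<close>

definition coord :: "(('v, 'e) path \<Rightarrow> complex) set \<Rightarrow> ('v, 'w) key \<Rightarrow> complex" where
  "coord X = pushforward key (SOME f. f \<in> carrier PA \<and> X = coset f)"

lemma coord_coset:
  assumes "f \<in> carrier PA"
  shows "coord (coset f) = pushforward key f"
proof -
  let ?g = "SOME g. g \<in> carrier PA \<and> coset f = coset g"
  have "\<exists>g. g \<in> carrier PA \<and> coset f = coset g" using assms by blast
  then have g: "?g \<in> carrier PA \<and> coset f = coset ?g" by (rule someI_ex)
  then have "pushforward key f = pushforward key ?g"
    using coset_eq_iff[OF assms, of ?g] by blast
  then show ?thesis by (simp add: coord_def)
qed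

lemma quotient_carrier: "carrier Q = coset ` carrier PA"
  by (auto simp: path_quotient_def FactRing_def A_RCOSETS_def')

lemma quotient_ops:
  "f \<in> carrier PA \<Longrightarrow> g \<in> carrier PA \<Longrightarrow> coset f \<oplus>\<^bsub>Q\<^esub> coset g = coset (f \<oplus>\<^bsub>PA\<^esub> g)"
  "f \<in> carrier PA \<Longrightarrow> g \<in> carrier PA \<Longrightarrow> coset f \<otimes>\<^bsub>Q\<^esub> coset g = coset (f \<otimes>\<^bsub>PA\<^esub> g)"
  "\<one>\<^bsub>Q\<^esub> = coset \<one>\<^bsub>PA\<^esub>"
proof -
  interpret J: ideal J PA by (rule ideal_J)
  show "f \<in> carrier PA \<Longrightarrow> g \<in> carrier PA \<Longrightarrow> coset f \<oplus>\<^bsub>Q\<^esub> coset g = coset (f \<oplus>\<^bsub>PA\<^esub> g)"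
    by (simp add: path_quotient_def FactRing_def J.a_rcos_sum del: path_algebra_simps)
  show "f \<in> carrier PA \<Longrightarrow> g \<in> carrier PA \<Longrightarrow> coset f \<otimes>\<^bsub>Q\<^esub> coset g = coset (f \<otimes>\<^bsub>PA\<^esub> g)"
    by (simp add: path_quotient_def FactRing_def J.rcoset_mult_add del: path_algebra_simps)
  show "\<one>\<^bsub>Q\<^esub> = coset \<one>\<^bsub>PA\<^esub>"
    by (simp add: path_quotient_def FactRing_def)
qed

text \<open>A right inverse of the pushforward along \<open>key\<close>, placing the coefficient of
  a class on its chosen representative.\<close>

definition lift :: "(('v, 'w) key \<Rightarrow> complex) \<Rightarrow> ('v, 'e) path \<Rightarrow> complex" where
  "lift h x = (if x \<in> paths G \<and> x = rep (key x) then h (key x) else 0)"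

lemma lift:
  assumes h: "finite {z. h z \<noteq> 0}" "{z. h z \<noteq> 0} \<subseteq> key ` paths G"
  shows "lift h \<in> carrier PA" "pushforward key (lift h) = h"
proof -
  have sub: "{x. lift h x \<noteq> 0} \<subseteq> rep ` {z. h z \<noteq> 0}"
    by (auto simp: lift_def split: if_splits)
  then show "lift h \<in> carrier PA"
    using finite_subset[OF sub] h(1) by (auto simp: lift_def split: if_splits)
  show "pushforward key (lift h) = h"
  proof
    fix z
    show "pushforward key (lift h) z = h z"
    proof (cases "z \<in> key ` paths G")
      case True
      then have r: "rep z \<in> paths G" "key (rep z) = z" using rep by auto
      have "pushforward key (lift h) z = pairing (lift h) (\<lambda>x. if x = rep z then 1 else 0)"
        unfolding pushforward_def using r by (intro pairing_cong) (auto simp: lift_def split: if_splits)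
      also have "\<dots> = lift h (rep z)"
        using finite_subset[OF sub] h(1) by (simp add: pairing_delta)
      finally show ?thesis using r by (simp add: lift_def)
    next
      case False
      moreover from this have "h z = 0" using h(2) by blast
      ultimately show ?thesis
        using pushforward_in_keys[OF \<open>lift h \<in> carrier PA\<close>, of z] by metis
    qed
  qed
qed

lemma coord_props:
  assumes "X \<in> carrier Q"
  shows "finite {z. coord X z \<noteq> 0}" "{z. coord X z \<noteq> 0} \<subseteq> key ` paths G"
  using assms pushforward_in_keys by (auto simp: quotient_carrier coord_coset pushforward_finite simp del: split_paired_All)

lemma coord_mult:
  assumes "X \<in> carrier Q" "Y \<in> carrier Q"
  shows "coord (X \<otimes>\<^bsub>Q\<^esub> Y) z = pairing (coord X) (\<lambda>a. pairing (coord Y)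
    (\<lambda>b. if fst (snd a) = fst b then (if key_mult a b = z then 1 else 0) else 0))"
proof -
  obtain f g where "X = coset f" "Y = coset g" "f \<in> carrier PA" "g \<in> carrier PA"
    using assms unfolding quotient_carrier by blast
  then show ?thesis
    using PA.m_closed[of f g]
    by (simp add: quotient_ops coord_coset pushforward_mult del: path_algebra_simps)
qed

lemma key_length_zero:
  assumes "a \<in> key ` paths G" "key_len a = 0"
  shows "fst (snd a) = fst a" "snd (snd a) = \<mu> []"
proof -
  obtain p where p: "p \<in> paths G" "a = key p" using assms by blast
  then have "path_arrows p = []" using assms key_len by simp
  then show "fst (snd a) = fst a" "snd (snd a) = \<mu> []"
    using p by (auto simp: key_def paths_iff awalk_Nil_iff)
qed

text \<open>An element whose coordinates have degree n may be given by an inhomogeneous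
  representative; \<open>lift\<close> of its coordinates is a homogeneous one.\<close>

lemma grading_eq:
  "path_length_grading G rel n = {X \<in> carrier Q. \<forall>z. coord X z \<noteq> 0 \<longrightarrow> key_len z = n}"
proof (intro equalityI subsetI)
  fix X assume "X \<in> path_length_grading G rel n"
  then obtain f where f: "X = coset f" "f \<in> carrier PA" "\<forall>x\<in>path_supp f. path_length x = n"
    unfolding path_length_grading_def by blast
  have "key_len z = n" if "coord X z \<noteq> 0" for z
  proof -
    from that have "pushforward key f z \<noteq> 0" using f(1) coord_coset[OF f(2)] by simp
    from pushforward_nonzero[OF this] obtain x where "f x \<noteq> 0" "key x = z" by blast
    moreover from this have "x \<in> path_supp f" by (simp add: path_supp_def)
    ultimately show ?thesis using f(3) key_len[of x] by metis
  qed
  then show "X \<in> {X \<in> carrier Q. \<forall>z. coord X z \<noteq> 0 \<longrightarrow> key_len z = n}"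
    using f by (auto simp: quotient_carrier simp del: path_algebra_simps)
next
  fix X assume X: "X \<in> {X \<in> carrier Q. \<forall>z. coord X z \<noteq> 0 \<longrightarrow> key_len z = n}"
  then obtain f where f: "X = coset f" "f \<in> carrier PA" unfolding quotient_carrier by blast
  have l: "lift (coord X) \<in> carrier PA" "pushforward key (lift (coord X)) = coord X"
    using lift coord_props X by blast+
  then have "X = coset (lift (coord X))"
    using f coset_eq_iff[OF f(2) l(1)] coord_coset[OF f(2)] by simp
  moreover have "path_length x = n" if "x \<in> path_supp (lift (coord X))" for x
  proof -
    have "coord X (key x) \<noteq> 0" using that by (auto simp: path_supp_def lift_def split: if_splits)
    then have "key_len (key x) = n" using X by blast
    then show ?thesis by simp
  qed
  ultimately show "X \<in> path_length_grading G rel n"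
    unfolding path_length_grading_def using l(1) by blast
qed

lemma quotient_coordinate_ring:
  "coordinate_ring Q (path_length_grading G rel) coord (key ` paths G) key_len"
proof (intro coordinate_ring.intro coordinate_ring_axioms.intro)
  interpret J: ideal J PA by (rule ideal_J)
  show "ring Q" unfolding path_quotient_def by (rule J.quotient_is_ring)
  let ?H = "{h :: ('v, 'w) key \<Rightarrow> complex. finite {z. h z \<noteq> 0} \<and> {z. h z \<noteq> 0} \<subseteq> key ` paths G}"
  show "bij_betw coord (carrier Q) ?H"
    unfolding bij_betw_def
  proof (intro conjI equalityI subsetI)
    show "inj_on coord (carrier Q)"
    proof (rule inj_onI)
      fix X Y assume "X \<in> carrier Q" "Y \<in> carrier Q" "coord X = coord Y"
      moreover from this obtain f g where "X = coset f" "Y = coset g" "f \<in> carrier PA" "g \<in> carrier PA"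
        unfolding quotient_carrier by blast
      ultimately show "X = Y" using coset_eq_iff[of f g] coord_coset by simp
    qed
  next
    fix h assume h: "h \<in> ?H"
    then have "coord (coset (lift h)) = h" "coset (lift h) \<in> carrier Q"
      using lift[of h] coord_coset[of "lift h"] unfolding quotient_carrier by auto
    then show "h \<in> coord ` carrier Q" by (metis imageI)
  next
    fix h assume "h \<in> coord ` carrier Q"
    then show "h \<in> ?H" using coord_props by blast
  qed
next
  fix X Y z assume "X \<in> carrier Q" "Y \<in> carrier Q"
  then obtain f g where "X = coset f" "Y = coset g" "f \<in> carrier PA" "g \<in> carrier PA"
    unfolding quotient_carrier by blast
  then show "coord (X \<oplus>\<^bsub>Q\<^esub> Y) z = coord X z + coord Y z"
    using PA.a_closed[of f g]
    by (simp add: quotient_ops(1) coord_coset pushforward_add del: path_algebra_simps)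
next
  fix X Y z assume X: "X \<in> carrier Q" and Y: "Y \<in> carrier Q" and nz: "coord (X \<otimes>\<^bsub>Q\<^esub> Y) z \<noteq> 0"
  from pairing_nonzero[OF nz[unfolded coord_mult[OF X Y]]]
  obtain a where a: "coord X a \<noteq> 0" "pairing (coord Y)
    (\<lambda>b. if fst (snd a) = fst b then (if key_mult a b = z then 1 else 0) else 0) \<noteq> 0"
    by blast
  obtain b where b: "coord Y b \<noteq> 0"
    "(if fst (snd a) = fst b then (if key_mult a b = z then 1 else 0) else 0) \<noteq> (0::complex)"
    using pairing_nonzero[OF a(2)] by blast
  obtain p q where pq: "p \<in> paths G" "a = key p" "q \<in> paths G" "b = key q"
    using a(1) b(1) coord_props(2)[OF X] coord_props(2)[OF Y] by blast
  have "z = key (path_concat p q)"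
    using b(2) pq by (simp add: key_concat split: if_splits)
  then have "key_len z = key_len a + key_len b" using pq key_len by simp
  then show "\<exists>x y. coord X x \<noteq> 0 \<and> coord Y y \<noteq> 0 \<and> key_len z = key_len x + key_len y"
    using a(1) b(1) by blast
next
  fix z assume "coord \<one>\<^bsub>Q\<^esub> z \<noteq> 0"
  then have "pushforward key \<one>\<^bsub>PA\<^esub> z \<noteq> 0"
    using coord_coset[OF PA.one_closed] by (simp add: quotient_ops(3))
  from pushforward_nonzero[OF this] obtain x where x: "\<one>\<^bsub>PA\<^esub> x \<noteq> 0" "key x = z" by blast
  then have "x \<in> (\<lambda>u. (u, [], u)) ` verts G"
    using one_path_algebra_supp by blast
  then show "key_len z = 0" using x(2) key_len by auto
next
  fix X Y z assume "X \<in> path_length_grading G rel 0" "Y \<in> path_length_grading G rel 0"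
  then have X: "X \<in> carrier Q" "\<And>z. coord X z \<noteq> 0 \<Longrightarrow> key_len z = 0"
    and Y: "Y \<in> carrier Q" "\<And>z. coord Y z \<noteq> 0 \<Longrightarrow> key_len z = 0"
    unfolding grading_eq by blast+
  \<comment> \<open>Classes of length zero are those of trivial paths. Two of them compose only if
    they are equal, and then the product is the same class.\<close>
  have "(if fst (snd a) = fst b then (if key_mult a b = z then 1 else 0) else 0)
    = (if a = z then if b = z then 1 else 0 else 0 :: complex)" if "coord X a \<noteq> 0" "coord Y b \<noteq> 0" for a b
  proof -
    have "a \<in> key ` paths G" "b \<in> key ` paths G"
      using coord_props(2)[OF X(1)] coord_props(2)[OF Y(1)] that by blast+
    from key_length_zero[OF this(1) X(2)[OF that(1)]] key_length_zero[OF this(2) Y(2)[OF that(2)]]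
    have "a = (fst a, fst a, \<mu> [])" "b = (fst b, fst b, \<mu> [])"
      by (simp_all add: prod_eq_iff)
    then obtain u v where "a = (u, u, \<mu> [])" "b = (v, v, \<mu> [])" by blast
    moreover have "\<mu> [] + \<mu> [] = \<mu> []" using \<mu>_append[of "[]" "[]"] by simp
    ultimately show ?thesis by (auto simp: key_mult_def)
  qed
  then have "coord (X \<otimes>\<^bsub>Q\<^esub> Y) z
    = pairing (coord X) (\<lambda>a. pairing (coord Y) (\<lambda>b. if a = z then if b = z then 1 else 0 else 0))"
    unfolding coord_mult[OF X(1) Y(1)] by (intro pairing_cong)
  also have "\<dots> = pairing (coord X) (\<lambda>a. if a = z then coord Y z else 0)"
    by (intro pairing_cong) (simp add: pairing_delta[OF coord_props(1)[OF Y(1)]])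
  also have "\<dots> = coord X z * coord Y z"
    by (rule pairing_delta[OF coord_props(1)[OF X(1)]])
  finally show "coord (X \<otimes>\<^bsub>Q\<^esub> Y) z = coord X z * coord Y z" .
qed (rule grading_eq)

end

section \<open>The cube\<close>

text \<open>All that the general argument needs of the cube: every color gives one arrow out of each
  vertex, different vertices are sent to different vertices by it, and every arrow has a
  color.\<close>

locale colored_quiver = weighted_quiver G \<mu> wlen rel
  for G :: "('v, 'e) pre_digraph" and \<mu> :: "'e list \<Rightarrow> 'w :: cancel_semigroup_add" and wlen rel +
  fixes k :: nat and \<alpha> :: "nat \<Rightarrow> 'v \<Rightarrow> 'e"
  assumes \<alpha>_arc: "i < k \<Longrightarrow> v \<in> verts G \<Longrightarrow> \<alpha> i v \<in> arcs G \<and> tail G (\<alpha> i v) = v"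
    and \<alpha>_inj: "i < k \<Longrightarrow> inj_on (\<lambda>v. head G (\<alpha> i v)) (verts G)"
    and arc_cases: "e \<in> arcs G \<Longrightarrow> \<exists>i<k. e = \<alpha> i (tail G e)"
begin

abbreviation keys :: "('v, 'w) key set" where "keys \<equiv> key ` paths G"

text \<open>The effect on path classes of appending the arrow of color \<open>i\<close>; it becomes
  the map \<open>\<rho>\<close> of \<open>monomial_flag\<close>.\<close>

definition step :: "nat \<Rightarrow> ('v, 'w) key \<Rightarrow> ('v, 'w) key" where
  "step i z = (fst z, head G (\<alpha> i (fst (snd z))), snd (snd z) + \<mu> [\<alpha> i (fst (snd z))])"

definition arrow_path :: "nat \<Rightarrow> 'v \<Rightarrow> ('v, 'e) path" where
  "arrow_path i v = (v, [\<alpha> i v], head G (\<alpha> i v))"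

definition arrow_sum :: "nat \<Rightarrow> ('v, 'e) path \<Rightarrow> complex" where
  "arrow_sum i x = (if x \<in> arrow_path i ` verts G then 1 else 0)"

lemma arrow_path_in_paths: "i < k \<Longrightarrow> v \<in> verts G \<Longrightarrow> arrow_path i v \<in> paths G"
  using \<alpha>_arc[of i v] by (simp add: arrow_path_def paths_iff awalk_simps)

lemma path_source_arrow_path [simp]: "path_source (arrow_path i v) = v"
  by (simp add: arrow_path_def)

lemma arrow_sum_supp: "{x. arrow_sum i x \<noteq> 0} = arrow_path i ` verts G"
  by (auto simp: arrow_sum_def)

lemma arrow_sum_closed: "i < k \<Longrightarrow> arrow_sum i \<in> carrier PA"
  using arrow_path_in_paths finite_verts by (auto simp: arrow_sum_supp)

lemma pairing_arrow_sum: "pairing (arrow_sum i) \<psi> = (\<Sum>v\<in>verts G. \<psi> (arrow_path i v))"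
  unfolding pairing_def arrow_sum_supp
  by (subst sum.reindex) (auto simp: inj_on_def arrow_path_def arrow_sum_def intro!: sum.cong)

lemma step_key:
  "i < k \<Longrightarrow> x \<in> paths G \<Longrightarrow> step i (key x) = key (path_concat x (arrow_path i (path_target x)))"
  by (simp add: step_def key_def arrow_path_def \<mu>_append)

lemma step_closed:
  assumes i: "i < k" and "z \<in> keys"
  shows "step i z \<in> keys"
proof -
  obtain x where x: "x \<in> paths G" "z = key x" using assms by blast
  have "path_concat x (arrow_path i (path_target x)) \<in> paths G"
    using path_ends_in_verts[OF x(1)] by (intro path_concat_in_paths arrow_path_in_paths x i) simp_all
  then show ?thesis unfolding x(2) step_key[OF i x(1)] by (rule imageI)
qed

lemma key_len_step: "i < k \<Longrightarrow> z \<in> keys \<Longrightarrow> key_len (step i z) = Suc (key_len z)"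
  by (auto simp: step_key arrow_path_def simp del: split_paired_All)

lemma step_inj: "i < k \<Longrightarrow> inj_on (step i) keys"
proof (rule inj_onI)
  fix a b assume i: "i < k" and ab: "a \<in> keys" "b \<in> keys" "step i a = step i b"
  have verts: "fst (snd z) \<in> verts G" if "z \<in> keys" for z
    using that path_ends_in_verts by (auto simp: key_def)
  have "fst (snd a) = fst (snd b)"
    by (rule inj_onD[OF \<alpha>_inj[OF i]]) (use ab verts in \<open>auto simp: step_def\<close>)
  then show "a = b" using ab(3) by (simp add: step_def prod_eq_iff)
qed

text \<open>Splits off the last arrow of a representative, since right multiplication acts at the
  end of a path.\<close>

lemma key_cases:
  assumes "z \<in> keys"
  obtains (trivial) v where "v \<in> verts G" "z = (v, v, \<mu> [])"
  | (step) i z' where "i < k" "z' \<in> keys" "z = step i z'"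
proof -
  obtain x where x: "x \<in> paths G" "z = key x" using assms by blast
  obtain u p v where xp: "x = (u, p, v)" by (cases x)
  show thesis
  proof (cases p rule: rev_cases)
    case Nil
    then show thesis using x xp trivial[of u] by (auto simp: key_def paths_iff awalk_Nil_iff)
  next
    case (snoc q e)
    then have w: "awalk u q (tail G e)" "e \<in> arcs G" "v = head G e"
      using x xp by (auto simp: paths_iff awalk_simps)
    then obtain i where i: "i < k" "e = \<alpha> i (tail G e)" using arc_cases by blast
    have q: "(u, q, tail G e) \<in> paths G" using w by (simp add: paths_iff)
    have "z = step i (key (u, q, tail G e))"
      using x xp snoc w i(2)[symmetric] by (simp add: step_def key_def \<mu>_append)
    then show thesis using step[OF i(1)] q by blast
  qed
qed

lemma key_induct [consumes 1, case_names trivial step]: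
  assumes "z \<in> keys"
    and "\<And>v. v \<in> verts G \<Longrightarrow> P (v, v, \<mu> [])"
    and "\<And>i z. i < k \<Longrightarrow> z \<in> keys \<Longrightarrow> P z \<Longrightarrow> P (step i z)"
  shows "P z"
  using assms(1)
proof (induction "key_len z" arbitrary: z rule: less_induct)
  case less
  from less.prems show ?case
  proof (cases rule: key_cases)
    case (step i z')
    then show ?thesis using less.hyps[of z'] key_len_step[of i z'] assms(3) by simp
  qed (simp add: assms(2))
qed

lemma trivial_key: "v \<in> verts G \<Longrightarrow> (v, v, \<mu> []) \<in> keys"
  by (rule image_eqI[of _ _ "(v, [], v)"]) (auto simp: key_def paths_iff awalk_Nil_iff)

text \<open>A path can be continued by exactly one of the summands, the arrow of color
  \<open>i\<close> at its target, so the sum over the vertices collapses to one term.\<close>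

lemma coord_mult_arrow_sum:
  assumes i: "i < k" and X: "X \<in> carrier Q"
  shows "coord (X \<otimes>\<^bsub>Q\<^esub> coset (arrow_sum i)) z = pairing (coord X) (\<lambda>a. if step i a = z then 1 else 0)"
proof -
  obtain f where f: "X = coset f" "f \<in> carrier PA" using X unfolding quotient_carrier by blast
  have fin: "finite {x. f x \<noteq> 0}" "finite {x. arrow_sum i x \<noteq> 0}"
    using f(2) arrow_sum_closed[OF i] by simp_all
  have "coord (X \<otimes>\<^bsub>Q\<^esub> coset (arrow_sum i)) z = pushforward key (f \<otimes>\<^bsub>PA\<^esub> arrow_sum i) z"
    using f arrow_sum_closed[OF i] coord_coset[OF PA.m_closed] by (simp add: quotient_ops(2) del: path_algebra_simps)
  also have "\<dots> = pairing f (\<lambda>x. \<Sum>v\<in>verts G. if path_target x = v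
    then (if key (path_concat x (arrow_path i v)) = z then 1 else 0) else 0)"
    unfolding pushforward_def pairing_mult[OF fin] pairing_arrow_sum by simp
  also have "\<dots> = pairing f (\<lambda>x. if step i (key x) = z then 1 else 0)"
  proof (rule pairing_cong)
    fix x assume "f x \<noteq> 0"
    then have "x \<in> paths G" using f(2) by auto
    then show "(\<Sum>v\<in>verts G. if path_target x = v
        then (if key (path_concat x (arrow_path i v)) = z then 1 else 0) else 0)
      = (if step i (key x) = z then 1 else 0 :: complex)"
      using path_ends_in_verts[of x] finite_verts by (simp add: step_key[OF i] sum.delta')
  qed
  also have "\<dots> = pairing (coord X) (\<lambda>a. if step i a = z then 1 else 0)"
    unfolding f(1) coord_coset[OF f(2)] pairing_pushforward[OF fin(1)] ..
  finally show ?thesis .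
qed

text \<open>Reduces Koszulity to a divisibility question about path classes, answered separately for
  the two algebras.\<close>

theorem koszul:
  fixes \<sigma> :: "nat \<Rightarrow> nat"
  assumes \<sigma>: "\<And>j. j < k \<Longrightarrow> \<sigma> j \<le> k"
    and colon: "\<And>j z. j < k \<Longrightarrow> z \<in> keys \<Longrightarrow>
      step j z \<in> (\<Union>i<j. step i ` keys) \<longleftrightarrow> z \<in> (\<Union>i<\<sigma> j. step i ` keys)"
  shows "koszul Q (path_length_grading G rel)"
proof -
  have "monomial_flag Q (path_length_grading G rel) coord keys key_len k (\<lambda>i. coset (arrow_sum i)) step \<sigma>"
  proof (intro monomial_flag.intro monomial_flag_axioms.intro quotient_coordinate_ring)
    fix j X z assume j: "j < k" and X: "X \<in> carrier Q" and z: "z \<in> keys"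
    have "pairing (coord X) (\<lambda>a. if step j a = step j z then 1 else 0)
      = pairing (coord X) (\<lambda>a. if a = z then 1 else 0)"
    proof (rule pairing_cong)
      fix a assume "coord X a \<noteq> 0"
      then have "a \<in> keys" using coord_props(2)[OF X] by blast
      then show "(if step j a = step j z then 1 else 0) = (if a = z then 1 else 0 :: complex)"
        using inj_on_eq_iff[OF step_inj[OF j] _ z] by simp
    qed
    then show "coord (X \<otimes>\<^bsub>Q\<^esub> coset (arrow_sum j)) (step j z) = coord X z"
      unfolding coord_mult_arrow_sum[OF j X] by (simp add: pairing_delta[OF coord_props(1)[OF X]])
  next
    fix j X w assume j: "j < k" and X: "X \<in> carrier Q" and w: "w \<notin> step j ` keys"
    have "pairing (coord X) (\<lambda>a. if step j a = w then 1 else 0) = pairing (coord X) (\<lambda>a. 0)"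
      by (rule pairing_cong) (use coord_props(2)[OF X] w in auto)
    then show "coord (X \<otimes>\<^bsub>Q\<^esub> coset (arrow_sum j)) w = 0"
      unfolding coord_mult_arrow_sum[OF j X] by simp
  next
    fix z assume "z \<in> keys" "0 < key_len z"
    then show "z \<in> (\<Union>i<k. step i ` keys)"
      by (cases rule: key_cases) (auto simp: wlen_\<mu>)
  next
    fix j assume "j < k"
    then show "coset (arrow_sum j) \<in> carrier Q"
      using arrow_sum_closed unfolding quotient_carrier by blast
  qed (fact \<sigma> colon step_closed step_inj key_len_step)+
  then show ?thesis by (rule monomial_flag.koszul)
qed

end

section \<open>The cube and its two algebras\<close>

lemma cube_quiver_simps [simp]:
  "verts (cube_quiver k) = Pow {..<k}"
  "arcs (cube_quiver k) = {(S, T). S \<subseteq> {..<k} \<and> T \<subseteq> {..<k} \<and> card (sym_diff S T) = 1}"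
  "tail (cube_quiver k) = fst"
  "head (cube_quiver k) = snd"
  by (simp_all add: cube_quiver_def)

lemma sym_diff_cancel: "sym_diff S (sym_diff S T) = T"
  and sym_diff_cancel_right: "sym_diff (sym_diff S T) T = S"
  by auto

lemma cube_colored_quiver:
  assumes "\<And>p q. \<mu> (p @ q) = \<mu> p + \<mu> q" "\<And>p. wlen (\<mu> p) = length p"
    "\<And>x y. rel x y \<longleftrightarrow> \<mu> (path_arrows x) = \<mu> (path_arrows y)"
  shows "colored_quiver (cube_quiver k) \<mu> wlen rel k (\<lambda>i S. (S, sym_diff S {i}))"
proof (intro colored_quiver.intro colored_quiver_axioms.intro weighted_quiver.intro
    weighted_quiver_axioms.intro wf_digraph.intro assms)
  fix i v assume "i < k" "v \<in> verts (cube_quiver k)"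
  moreover have "sym_diff v (sym_diff v {i}) = {i}" by (rule sym_diff_cancel)
  ultimately show "(v, sym_diff v {i}) \<in> arcs (cube_quiver k)
      \<and> tail (cube_quiver k) (v, sym_diff v {i}) = v"
    by auto
next
  fix i assume "i < k"
  show "inj_on (\<lambda>v. head (cube_quiver k) (v, sym_diff v {i})) (verts (cube_quiver k))"
  proof (rule inj_onI)
    fix S T assume "head (cube_quiver k) (S, sym_diff S {i}) = head (cube_quiver k) (T, sym_diff T {i})"
    then have "sym_diff (sym_diff S {i}) {i} = sym_diff (sym_diff T {i}) {i}" by simp
    then show "S = T" by (simp only: sym_diff_cancel_right)
  qed
next
  fix e assume "e \<in> arcs (cube_quiver k)"
  then obtain S T where e: "e = (S, T)" "S \<subseteq> {..<k}" "T \<subseteq> {..<k}" "card (sym_diff S T) = 1" by auto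
  obtain i where i: "sym_diff S T = {i}" using card_1_singletonE[OF e(4)] .
  then have "i < k" using e by blast
  moreover have "T = sym_diff S {i}" using sym_diff_cancel[of S T] i by simp
  ultimately show "\<exists>i<k. e = (tail (cube_quiver k) e, sym_diff (tail (cube_quiver k) e) {i})"
    using e(1) by auto
qed auto

lemma card_sym_diff_singleton:
  assumes "finite S"
  shows "card (sym_diff S {i}) = (if i \<in> S then card S - 1 else Suc (card S))"
proof (cases "i \<in> S")
  case True
  then have "sym_diff S {i} = S - {i}" by auto
  then show ?thesis using True assms by simp
next
  case False
  then have "sym_diff S {i} = insert i S" by auto
  then show ?thesis using False assms by simp
qed

text \<open>The target of a path is its source flipped at the colors of odd multiplicity. A class
  thus amounts to a source vertex and a monomial in k variables, and \<open>step i\<close>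
  multiplies by the variable i. If a monomial times the variable j is divisible by another variable,
  so is the monomial itself; hence \<sigma> is the identity.\<close>

lemma koszul_A: "koszul (algebra_A k) (grading_A k)"
proof -
  let ?\<mu> = "\<lambda>p. image_mset arrow_color (mset p)"
  interpret colored_quiver "cube_quiver k" ?\<mu> size same_colors k "\<lambda>i S. (S, sym_diff S {i})"
    by (rule cube_colored_quiver) (auto simp: same_colors_def)
  let ?par = "\<lambda>m :: nat multiset. {i. odd (count m i)}"
  have color: "arrow_color (v, sym_diff v {i}) = i" for v i
    by (simp only: arrow_color.simps sym_diff_cancel the_elem_eq)
  have step: "step i (u, v, m) = (u, sym_diff v {i}, add_mset i m)" for i u v m
    by (simp only: step_def cube_quiver_simps fst_conv snd_conv mset.simps image_mset_add_mset
        image_mset_empty color union_mset_add_mset_right add_0_right)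
  have par: "?par (add_mset i m) = sym_diff (?par m) {i}" for i m
    by (auto simp: count_add_mset)
  have assoc: "sym_diff (sym_diff u S) T = sym_diff u (sym_diff S T)" for u S T :: "nat set"
    by auto
  have keysD: "fst z \<subseteq> {..<k} \<and> set_mset (snd (snd z)) \<subseteq> {..<k} \<and> fst (snd z) = sym_diff (fst z) (?par (snd (snd z)))"
    if "z \<in> keys" for z
    using that
  proof (induction z rule: key_induct)
    case (step i z)
    then show ?case
      by (cases z) (simp only: \<open>\<And>i u v m. step i (u, v, m) = _\<close> fst_conv snd_conv par assoc, auto)
  qed auto
  have keysI: "(u, sym_diff u (?par m), m) \<in> keys" if "u \<subseteq> {..<k}" "set_mset m \<subseteq> {..<k}" for u m
    using that(2)
  proof (induction m)
    case empty
    then show ?case using trivial_key[of u] that(1) by simp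
  next
    case (add i m)
    then have "step i (u, sym_diff u (?par m), m) \<in> keys" by (intro step_closed) auto
    then show ?case by (simp only: step par assoc)
  qed
  show ?thesis
    unfolding algebra_A_def grading_A_def
  proof (rule koszul[of "\<lambda>j. j"])
    fix j z assume j: "j < k" and z: "z \<in> keys"
    obtain u v m where zz: "z = (u, v, m)" by (cases z)
    show "step j z \<in> (\<Union>i<j. step i ` keys) \<longleftrightarrow> z \<in> (\<Union>i<j. step i ` keys)"
    proof
      assume "step j z \<in> (\<Union>i<j. step i ` keys)"
      then obtain i z' where i: "i < j" "z' \<in> keys" "step j z = step i z'" by blast
      obtain u' v' m' where z': "z' = (u', v', m')" by (cases z')
      have "add_mset j m = add_mset i m'" using i(3) by (simp add: zz z' step)
      then have im: "i \<in># m" using i(1) by (metis insert_noteq_member less_irrefl)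
      define m1 where "m1 = m - {#i#}"
      have m: "add_mset i m1 = m" using im by (simp add: m1_def)
      have uvm: "u \<subseteq> {..<k}" "set_mset m \<subseteq> {..<k}" "v = sym_diff u (?par m)"
        using keysD[OF z] unfolding zz fst_conv snd_conv by blast+
      have "set_mset m1 \<subseteq> {..<k}"
        unfolding m1_def by (rule order_trans[OF set_mset_mono[OF diff_subset_eq_self] uvm(2)])
      then have "(u, sym_diff u (?par m1), m1) \<in> keys" by (rule keysI[OF uvm(1)])
      moreover have "step i (u, sym_diff u (?par m1), m1) = (u, sym_diff u (?par m), m)"
        by (simp only: step assoc par[symmetric] m)
      then have "z = step i (u, sym_diff u (?par m1), m1)"
        by (simp only: zz uvm(3)[symmetric])
      ultimately show "z \<in> (\<Union>i<j. step i ` keys)" using i(1) by blast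
    next
      assume "z \<in> (\<Union>i<j. step i ` keys)"
      then obtain i z' where i: "i < j" "z' \<in> keys" "z = step i z'" by blast
      \<comment> \<open>Appended colors commute in A(k): both the flips and the color multisets
        do.\<close>
      then have "step j z = step i (step j z')"
        by (cases z') (auto simp: step)
      then show "step j z \<in> (\<Union>i<j. step i ` keys)"
        using i(1) step_closed[OF j i(2)] by auto
    qed
  qed simp
qed

text \<open>A class is a pair of vertices with a length. It exists iff the length is at least the
  distance of the vertices and has the same parity, because a path can be lengthened by going back
  and forth along an edge.\<close>

lemma koszul_B:
  assumes "k \<ge> 1"
  shows "koszul (algebra_B k) (grading_B k)"
proof -
  interpret colored_quiver "cube_quiver k" length "\<lambda>n. n" same_length k "\<lambda>i S. (S, sym_diff S {i})"
    by (rule cube_colored_quiver) (auto simp: same_length_def)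
  have step: "step i (u, v, n) = (u, sym_diff v {i}, Suc n)" for i u v n
    by (simp add: step_def)
  have assoc: "sym_diff u (sym_diff S T) = sym_diff (sym_diff u S) T" for u S T :: "nat set"
    by auto
  let ?E = "\<lambda>u v n. u \<subseteq> {..<k} \<and> v \<subseteq> {..<k} \<and> card (sym_diff u v) \<le> n \<and> (even n \<longleftrightarrow> even (card (sym_diff u v)))"
  have fin: "finite (sym_diff u v)" if "u \<subseteq> {..<k}" "v \<subseteq> {..<k}" for u v
    using that by (meson finite_Diff finite_UnI finite_lessThan finite_subset)
  have card_step: "card (sym_diff u (sym_diff v {i}))
      = (if i \<in> sym_diff u v then card (sym_diff u v) - 1 else Suc (card (sym_diff u v)))"
    if "u \<subseteq> {..<k}" "v \<subseteq> {..<k}" for u v i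
    unfolding assoc by (rule card_sym_diff_singleton[OF fin[OF that]])
  have card_pos: "card (sym_diff u v) > 0" if "u \<subseteq> {..<k}" "v \<subseteq> {..<k}" "i \<in> sym_diff u v" for u v i
    using card_gt_0_iff fin[OF that(1,2)] that(3) by blast
  have E_step: "?E u (sym_diff v {i}) n \<longleftrightarrow>
      (if i \<in> sym_diff u v then card (sym_diff u v) - 1 else Suc (card (sym_diff u v))) \<le> n \<and>
      (even n \<longleftrightarrow> even (if i \<in> sym_diff u v then card (sym_diff u v) - 1 else Suc (card (sym_diff u v))))"
    if "u \<subseteq> {..<k}" "v \<subseteq> {..<k}" "i < k" for u v i n
  proof -
    have "sym_diff v {i} \<subseteq> {..<k}" using that by auto
    then show ?thesis unfolding card_step[OF that(1,2)] using that(1) by blast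
  qed
  have keysD: "?E (fst z) (fst (snd z)) (snd (snd z))" if "z \<in> keys" for z
    using that
  proof (induction z rule: key_induct)
    case (step i z)
    obtain u v n where z: "z = (u, v, n)" by (cases z)
    have E: "?E u v n" using step.IH by (simp only: z fst_conv snd_conv)
    then have uv: "u \<subseteq> {..<k}" "v \<subseteq> {..<k}" by blast+
    \<comment> \<open>Here \<open>c\<close> is the distance from the source, and \<open>b\<close>
      says whether flipping \<open>i\<close> brings the vertex closer to it. In these terms the
      claim is pure arithmetic.\<close>
    define c b where "c = card (sym_diff u v)" and "b \<longleftrightarrow> i \<in> sym_diff u v"
    have "(if b then c - 1 else Suc c) \<le> Suc n \<and> (even (Suc n) \<longleftrightarrow> even (if b then c - 1 else Suc c))"
      using E[folded c_def] card_pos[OF uv, of i, folded c_def b_def] by (cases b) auto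
    then have "?E u (sym_diff v {i}) (Suc n)"
      unfolding c_def b_def E_step[OF uv \<open>i < k\<close>] .
    then show ?case
      unfolding z \<open>\<And>i u v n. step i (u, v, n) = _\<close> fst_conv snd_conv .
  qed auto
  have keysI: "(u, v, n) \<in> keys" if "?E u v n" for u v n
    using that
  proof (induction n arbitrary: v)
    case 0
    then have "sym_diff u v = {}" using fin[of u v] by simp
    then have "u = v" by blast
    then show ?case using trivial_key[of u] 0 by simp
  next
    case (Suc n)
    then have uv: "u \<subseteq> {..<k}" "v \<subseteq> {..<k}" by blast+
    \<comment> \<open>The color of the last arrow: on the way from \<open>u\<close> to
      \<open>v\<close> if they differ, and any direction if they agree. Direction 0 exists because k
      is positive.\<close>
    obtain i where i: "i < k" "i \<in> sym_diff u v \<or> card (sym_diff u v) = 0"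
    proof (cases "sym_diff u v = {}")
      case True
      then have "card (sym_diff u v) = 0" by (simp only: card.empty)
      then show thesis using that[of 0] assms by linarith
    next
      case False
      then obtain i where "i \<in> sym_diff u v" by blast
      moreover from this have "i < k" using uv by blast
      ultimately show thesis using that by blast
    qed
    define c b where "c = card (sym_diff u v)" and "b \<longleftrightarrow> i \<in> sym_diff u v"
    have "(if b then c - 1 else Suc c) \<le> n \<and> (even n \<longleftrightarrow> even (if b then c - 1 else Suc c))"
      using Suc.prems[folded c_def] i(2)[folded c_def b_def] card_pos[OF uv, of i, folded c_def b_def]
      by (cases b) (auto dest: odd_pos)
    then have "?E u (sym_diff v {i}) n"
      unfolding c_def b_def E_step[OF uv i(1)] .
    then have "step i (u, sym_diff v {i}, n) \<in> keys" by (intro step_closed i(1) Suc.IH)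
    then show ?case by (simp only: step sym_diff_cancel_right)
  qed
  \<comment> \<open>A path class is a multiple of an arrow of color \<open>i\<close> iff one of its representatives ends with that color:
    either \<open>i\<close> occurs in every representative, or the path is longer than a geodesic.\<close>
  have image_iff: "(u, v, n) \<in> (\<Union>i<j. step i ` keys) \<longleftrightarrow> (\<exists>i<j. i \<in> sym_diff u v \<or> card (sym_diff u v) < n)"
    if "(u, v, n) \<in> keys" "j \<le> k" for u v n j
  proof
    assume "(u, v, n) \<in> (\<Union>i<j. step i ` keys)"
    then obtain i z' where "i < j" "z' \<in> keys" "(u, v, n) = step i z'" by blast
    moreover obtain u' v' n' where "z' = (u', v', n')" by (cases z')
    ultimately have i: "i < j" "(u', v', n') \<in> keys" "(u, v, n) = step i (u', v', n')" by simp_all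
    then have eq: "u' = u" "v = sym_diff v' {i}" "n = Suc n'" unfolding step prod.inject by blast+
    have E: "?E u v' n'" using keysD[OF i(2)] unfolding eq(1) fst_conv snd_conv .
    have uv: "u \<subseteq> {..<k}" "v' \<subseteq> {..<k}" using E by blast+
    define c b where "c = card (sym_diff u v')" and "b \<longleftrightarrow> i \<in> sym_diff u v'"
    have "i \<in> sym_diff u v \<longleftrightarrow> \<not> b" unfolding eq(2) b_def by auto
    moreover have "card (sym_diff u v) = (if b then c - 1 else Suc c)"
      unfolding eq(2) c_def b_def by (rule card_step[OF uv])
    ultimately have "i \<in> sym_diff u v \<or> card (sym_diff u v) < n"
      using E[folded c_def] eq(3) by (cases b) auto
    then show "\<exists>i<j. i \<in> sym_diff u v \<or> card (sym_diff u v) < n" using i(1) by blast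
  next
    assume "\<exists>i<j. i \<in> sym_diff u v \<or> card (sym_diff u v) < n"
    then obtain i where i: "i < j" "i \<in> sym_diff u v \<or> card (sym_diff u v) < n" by blast
    have E: "?E u v n" using keysD[OF that(1)] unfolding fst_conv snd_conv .
    have uv: "u \<subseteq> {..<k}" "v \<subseteq> {..<k}" using E by blast+
    define c b where "c = card (sym_diff u v)" and "b \<longleftrightarrow> i \<in> sym_diff u v"
    have cb: "c \<le> n" "even n \<longleftrightarrow> even c" "b \<or> c < n" "b \<Longrightarrow> c > 0"
      using E[folded c_def] i(2)[folded c_def b_def] card_pos[OF uv, of i, folded c_def b_def] by blast+
    then obtain n' where n: "n = Suc n'" by (cases n) auto
    have "i < k" using i(1) that(2) by simp
    have "(if b then c - 1 else Suc c) \<le> n' \<and> (even n' \<longleftrightarrow> even (if b then c - 1 else Suc c))"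
    proof (cases b)
      case False
      \<comment> \<open>Equal parity of \<open>c\<close> and n sharpens c < n to
        \<open>Suc c \<le> n'\<close>, so there is room to arrive from the farther neighbour of
        \<open>v\<close>.\<close>
      then have "c \<noteq> n'" "c \<le> n'" using cb n by auto
      then show ?thesis using False cb(2) n by (simp, blast)
    qed (use cb n in auto)
    then have "?E u (sym_diff v {i}) n'"
      unfolding c_def b_def E_step[OF uv \<open>i < k\<close>] .
    then have "(u, sym_diff v {i}, n') \<in> keys" by (rule keysI)
    moreover have "(u, v, n) = step i (u, sym_diff v {i}, n')"
      by (simp only: step n sym_diff_cancel_right)
    ultimately show "(u, v, n) \<in> (\<Union>i<j. step i ` keys)" using i(1) by blast
  qed
  show ?thesis
    unfolding algebra_B_def grading_B_def
  \<comment> \<open>For j = 0 both unions are empty. For j > 0, the class after a step of color j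
    exceeds a geodesic iff it did so before or j was already a direction between its ends. The
    second alternative adds the color j to those below it, which gives index
    \<open>Suc j\<close>.\<close>
  proof (rule koszul[of "\<lambda>j. if j = 0 then 0 else Suc j"])
    fix j z assume j: "j < k" and z: "z \<in> keys"
    obtain u v n where zz: "z = (u, v, n)" by (cases z)
    have E: "?E u v n" using keysD[OF z] unfolding zz fst_conv snd_conv .
    have uv: "u \<subseteq> {..<k}" "v \<subseteq> {..<k}" using E by blast+
    define c b where "c = card (sym_diff u v)" and "b \<longleftrightarrow> j \<in> sym_diff u v"
    have step_z: "step j z = (u, sym_diff v {j}, Suc n)" by (simp only: zz step)
    have cn: "c \<le> n" using E[folded c_def] by blast
    show "step j z \<in> (\<Union>i<j. step i ` keys) \<longleftrightarrow> z \<in> (\<Union>i<(if j = 0 then 0 else Suc j). step i ` keys)"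
    proof (cases "j = 0")
      case False
      then have "0 < j" by simp
      have mem: "i \<in> sym_diff u (sym_diff v {j}) \<longleftrightarrow> i \<in> sym_diff u v" if "i < j" for i
        using that by auto
      have "step j z \<in> (\<Union>i<j. step i ` keys)
        \<longleftrightarrow> (\<exists>i<j. i \<in> sym_diff u (sym_diff v {j}) \<or> card (sym_diff u (sym_diff v {j})) < Suc n)"
        using step_closed[OF j z] j unfolding step_z by (intro image_iff) auto
      also have "\<dots> \<longleftrightarrow> (\<exists>i<j. i \<in> sym_diff u v \<or> (if b then c - 1 else Suc c) < Suc n)"
        unfolding card_step[OF uv] c_def b_def using mem by blast
      also have "\<dots> \<longleftrightarrow> (\<exists>i<Suc j. i \<in> sym_diff u v \<or> c < n)"
      proof (cases b)
        case True
        \<comment> \<open>The step returns towards \<open>u\<close> while the length grows, so the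
          new path is longer than a geodesic; \<open>0 < j\<close> provides a color below j for the
          witness.\<close>
        have "(if b then c - 1 else Suc c) < Suc n" using True cn by simp
        moreover have "j \<in> sym_diff u v" using True unfolding b_def .
        ultimately show ?thesis using \<open>0 < j\<close> lessI by blast
      next
        case False
        then have "(if b then c - 1 else Suc c) < Suc n \<longleftrightarrow> c < n" by simp
        moreover have "j \<notin> sym_diff u v" using False unfolding b_def .
        ultimately show ?thesis using \<open>0 < j\<close> less_Suc_eq by metis
      qed
      also have "\<dots> \<longleftrightarrow> z \<in> (\<Union>i<Suc j. step i ` keys)"
        unfolding zz c_def by (rule image_iff[symmetric]) (use z zz j in auto)
      finally show ?thesis using False by simp
    qed simp
  qed auto
qed

theorem proposition4p3:
  fixes k :: nat
  assumes "k \<ge> 2"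
  shows "koszul (algebra_A k) (grading_A k) \<and> koszul (algebra_B k) (grading_B k)"
  using koszul_A koszul_B[of k] assms by simp

end
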